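(* There is an equivalence of categories between the category of cofree-coassociative combinatorial Hopf algebras over a field $\mathbb{K}$ and the category of multibrace algebras over $\mathbb{K}$.
   Context: $\mathbb{K}$ is a field. For a vector space $R$, $T^c(R)=\bigoplus_{n\ge 0}R^{\otimes n}$ is the cofree conilpotent coassociative coalgebra, with deconcatenation coproduct $\Delta(x_1\cdots x_n)=\sum_{i=0}^n x_1\cdots x_i\otimes x_{i+1}\cdots x_n$ (elements $x_1\otimes\cdots\otimes x_n$ are written $x_1\cdots x_n$). A cofree-coassociative combinatorial Hopf algebra (CHA) is a vector space $R$ together with a product $*$ on $T^c(R)$, associative and unital with unit $1\in\mathbb{K}=R^{\otimes 0}$, making $(T^c(R),*,\Delta)$ a Hopf algebra (so $R=\mathrm{Prim}\,T^c(R)$). A morphism from $(R,* )$ to $(R',*')$ is a linear map $\varphi:R\to R'$ such that $T^c(\varphi):T^c(R)\to T^c(R')$ is a morphism of Hopf algebras. A multibrace algebra ($MB$-algebra) is a vector space $R$ with linear maps $M_{pq}:R^{\otimes p}\otimes R^{\otimes q}\to R$, $p,q\ge 0$, such that $M_{00}=0$, $M_{10}=M_{01}=\mathrm{id}$, $M_{p0}=M_{0q}=0$ for $p,q>1$, and for all $i,j,k\ge 1$ $$\sum_{1\le l\le i+j}\ \sum M_{lk}\circ(M_{i_1j_1}\cdots M_{i_lj_l};\mathrm{id}^{\otimes k})=\sum_{1\le m\le j+k}\ \sum M_{im}\circ(\mathrm{id}^{\otimes i};M_{j_1k_1}\cdots M_{j_mk_m}),$$ where the left inner sum is over all nonnegative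 integers with $i_1+\cdots+i_l=i$, $j_1+\cdots+j_l=j$, and the right inner sum over all nonnegative integers with $j_1+\cdots+j_m=j$, $k_1+\cdots+k_m=k$. Concatenation of operations means $M_{pq}M_{rs}(x_1\cdots x_{p+r};y_1\cdots y_{q+s})=M_{pq}(x_1\cdots x_p;y_1\cdots y_q)\otimes M_{rs}(x_{p+1}\cdots x_{p+r};y_{q+1}\cdots y_{q+s})$. Morphisms of multibrace algebras are linear maps commuting with all $M_{pq}$. *)

theory Defs
  imports "HOL-Algebra.Module" "HOL-Algebra.AbelCoset"
begin

section \<open>Categories and their equivalences\<close>

text \<open>Morphisms are not required to determine their domain and codomain, so homs, identities
  and composition are indexed by objects: \<open>Comp C A B D g f\<close> is the composite of
  \<open>f \<in> Hom C A B\<close> and \<open>g \<in> Hom C B D\<close>.\<close>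

record ('o, 'm) category =
  Ob :: "'o set"
  Hom :: "'o \<Rightarrow> 'o \<Rightarrow> 'm set"
  Id :: "'o \<Rightarrow> 'm"
  Comp :: "'o \<Rightarrow> 'o \<Rightarrow> 'o \<Rightarrow> 'm \<Rightarrow> 'm \<Rightarrow> 'm"

definition is_category :: "('o, 'm) category \<Rightarrow> bool" where
  "is_category C \<longleftrightarrow>
     (\<forall>A\<in>Ob C. Id C A \<in> Hom C A A) \<and>
     (\<forall>A\<in>Ob C. \<forall>B\<in>Ob C. \<forall>D\<in>Ob C. \<forall>f\<in>Hom C A B. \<forall>g\<in>Hom C B D.
        Comp C A B D g f \<in> Hom C A D) \<and>
     (\<forall>A\<in>Ob C. \<forall>B\<in>Ob C. \<forall>f\<in>Hom C A B.
        Comp C A A B f (Id C A) = f \<and> Comp C A B B (Id C B) f = f) \<and>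
     (\<forall>A\<in>Ob C. \<forall>B\<in>Ob C. \<forall>D\<in>Ob C. \<forall>E\<in>Ob C. \<forall>f\<in>Hom C A B. \<forall>g\<in>Hom C B D. \<forall>h\<in>Hom C D E.
        Comp C A D E h (Comp C A B D g f) = Comp C A B E (Comp C B D E h g) f)"

definition is_functor ::
  "('o, 'm) category \<Rightarrow> ('p, 'n) category \<Rightarrow> ('o \<Rightarrow> 'p) \<Rightarrow> ('o \<Rightarrow> 'o \<Rightarrow> 'm \<Rightarrow> 'n) \<Rightarrow> bool" where
  "is_functor C D Fo Fm \<longleftrightarrow>
     (\<forall>A\<in>Ob C. Fo A \<in> Ob D) \<and>
     (\<forall>A\<in>Ob C. \<forall>B\<in>Ob C. \<forall>f\<in>Hom C A B. Fm A B f \<in> Hom D (Fo A) (Fo B)) \<and>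
     (\<forall>A\<in>Ob C. Fm A A (Id C A) = Id D (Fo A)) \<and>
     (\<forall>A\<in>Ob C. \<forall>B\<in>Ob C. \<forall>E\<in>Ob C. \<forall>f\<in>Hom C A B. \<forall>g\<in>Hom C B E.
        Fm A E (Comp C A B E g f) = Comp D (Fo A) (Fo B) (Fo E) (Fm B E g) (Fm A B f))"

definition is_iso :: "('o, 'm) category \<Rightarrow> 'o \<Rightarrow> 'o \<Rightarrow> 'm \<Rightarrow> bool" where
  "is_iso C A B f \<longleftrightarrow> f \<in> Hom C A B \<and>
     (\<exists>g\<in>Hom C B A. Comp C A B A g f = Id C A \<and> Comp C B A B f g = Id C B)"

definition is_nat_iso ::
  "('o, 'm) category \<Rightarrow> ('p, 'n) category \<Rightarrow> ('o \<Rightarrow> 'p) \<Rightarrow> ('o \<Rightarrow> 'o \<Rightarrow> 'm \<Rightarrow> 'n) \<Rightarrow>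
     ('o \<Rightarrow> 'p) \<Rightarrow> ('o \<Rightarrow> 'o \<Rightarrow> 'm \<Rightarrow> 'n) \<Rightarrow> ('o \<Rightarrow> 'n) \<Rightarrow> bool" where
  "is_nat_iso C D Fo Fm Go Gm \<eta> \<longleftrightarrow>
     (\<forall>A\<in>Ob C. is_iso D (Fo A) (Go A) (\<eta> A)) \<and>
     (\<forall>A\<in>Ob C. \<forall>B\<in>Ob C. \<forall>f\<in>Hom C A B.
        Comp D (Fo A) (Go A) (Go B) (Gm A B f) (\<eta> A) =
        Comp D (Fo A) (Fo B) (Go B) (\<eta> B) (Fm A B f))"

definition equivalent_categories :: "('o, 'm) category \<Rightarrow> ('p, 'n) category \<Rightarrow> bool" where
  "equivalent_categories C D \<longleftrightarrow> is_category C \<and> is_category D \<and>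
     (\<exists>Fo Fm Go Gm \<eta> \<theta>. is_functor C D Fo Fm \<and> is_functor D C Go Gm \<and>
        is_nat_iso C C (\<lambda>A. A) (\<lambda>A B f. f)
          (\<lambda>A. Go (Fo A)) (\<lambda>A B f. Gm (Fo A) (Fo B) (Fm A B f)) \<eta> \<and>
        is_nat_iso D D (\<lambda>A. Fo (Go A)) (\<lambda>A B f. Fm (Go A) (Go B) (Gm A B f))
          (\<lambda>A. A) (\<lambda>A B f. f) \<theta>)"

section \<open>Linear algebra over a field\<close>

text \<open>A vector space over the field \<open>K\<close> is a HOL-Algebra \<open>module K V\<close>. The record type of modules
  also has fields \<open>mult\<close> and \<open>one\<close>; these are irrelevant for a mere vector space, and they carry
  the algebra structure of an algebra.\<close>

definition linear_map ::
  "'k ring \<Rightarrow> ('k, 'a) module \<Rightarrow> ('k, 'b) module \<Rightarrow> ('a \<Rightarrow> 'b) \<Rightarrow> bool" where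
  "linear_map K V W f \<longleftrightarrow> f \<in> carrier V \<rightarrow> carrier W \<and>
     (\<forall>x\<in>carrier V. \<forall>y\<in>carrier V. f (x \<oplus>\<^bsub>V\<^esub> y) = f x \<oplus>\<^bsub>W\<^esub> f y) \<and>
     (\<forall>a\<in>carrier K. \<forall>x\<in>carrier V. f (a \<odot>\<^bsub>V\<^esub> x) = a \<odot>\<^bsub>W\<^esub> f x)"

definition self_module :: "'k ring \<Rightarrow> ('k, 'k) module" where
  "self_module K = \<lparr>carrier = carrier K, monoid.mult = mult K, one = one K,
     zero = zero K, add = add K, smult = mult K\<rparr>"

definition free_module :: "'k ring \<Rightarrow> 's set \<Rightarrow> ('k, 's \<Rightarrow> 'k) module" where
  "free_module K S =
     \<lparr>carrier = {f. (\<forall>s. f s \<in> carrier K) \<and> finite {s. f s \<noteq> \<zero>\<^bsub>K\<^esub>} \<and> {s. f s \<noteq> \<zero>\<^bsub>K\<^esub>} \<subseteq> S},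
      monoid.mult = undefined, one = undefined,
      zero = (\<lambda>s. \<zero>\<^bsub>K\<^esub>), add = (\<lambda>f g s. f s \<oplus>\<^bsub>K\<^esub> g s), smult = (\<lambda>a f s. a \<otimes>\<^bsub>K\<^esub> f s)\<rparr>"

definition free_gen :: "'k ring \<Rightarrow> 's \<Rightarrow> 's \<Rightarrow> 'k" where
  "free_gen K s = (\<lambda>t. if t = s then \<one>\<^bsub>K\<^esub> else \<zero>\<^bsub>K\<^esub>)"

definition submodule_span :: "'k ring \<Rightarrow> ('k, 'a) module \<Rightarrow> 'a set \<Rightarrow> 'a set" where
  "submodule_span K V A = \<Inter>{N. submodule N K V \<and> A \<subseteq> N}"

definition quotient_module :: "('k, 'a) module \<Rightarrow> 'a set \<Rightarrow> ('k, 'a set) module" where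
  "quotient_module V N =
     \<lparr>carrier = a_rcosets\<^bsub>V\<^esub> N, monoid.mult = undefined, one = undefined,
      zero = N, add = set_add V, smult = (\<lambda>a X. \<Union>x\<in>X. N +>\<^bsub>V\<^esub> (a \<odot>\<^bsub>V\<^esub> x))\<rparr>"

text \<open>The linear extension of \<open>g\<close>, defined on generators, to the quotient of a free module:
  the coset \<open>X\<close> is sent to \<open>\<Sum>\<^sub>s f(s) g(s)\<close> for a representative \<open>f\<close> of \<open>X\<close>. The choice of \<open>f\<close> does
  not matter as soon as \<open>g\<close> respects the relations defining the quotient.\<close>

definition linear_ext :: "'k ring \<Rightarrow> ('k, 'b) module \<Rightarrow> ('s \<Rightarrow> 'b) \<Rightarrow> ('s \<Rightarrow> 'k) set \<Rightarrow> 'b" where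
  "linear_ext K W g X =
     (let f = (SOME f. f \<in> X) in \<Oplus>\<^bsub>W\<^esub>s\<in>{s. f s \<noteq> \<zero>\<^bsub>K\<^esub>}. f s \<odot>\<^bsub>W\<^esub> g s)"

subsection \<open>Tensor product of two spaces\<close>

definition tensor_relators ::
  "'k ring \<Rightarrow> ('k, 'a) module \<Rightarrow> ('k, 'b) module \<Rightarrow> ('a \<times> 'b \<Rightarrow> 'k) set" where
  "tensor_relators K V W = (let F = free_module K (carrier V \<times> carrier W); e = free_gen K in
     {e (x \<oplus>\<^bsub>V\<^esub> x', y) \<ominus>\<^bsub>F\<^esub> e (x, y) \<ominus>\<^bsub>F\<^esub> e (x', y) | x x' y.
        x \<in> carrier V \<and> x' \<in> carrier V \<and> y \<in> carrier W} \<union>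
     {e (x, y \<oplus>\<^bsub>W\<^esub> y') \<ominus>\<^bsub>F\<^esub> e (x, y) \<ominus>\<^bsub>F\<^esub> e (x, y') | x y y'.
        x \<in> carrier V \<and> y \<in> carrier W \<and> y' \<in> carrier W} \<union>
     {e (a \<odot>\<^bsub>V\<^esub> x, y) \<ominus>\<^bsub>F\<^esub> a \<odot>\<^bsub>F\<^esub> e (x, y) | a x y.
        a \<in> carrier K \<and> x \<in> carrier V \<and> y \<in> carrier W} \<union>
     {e (x, a \<odot>\<^bsub>W\<^esub> y) \<ominus>\<^bsub>F\<^esub> a \<odot>\<^bsub>F\<^esub> e (x, y) | a x y.
        a \<in> carrier K \<and> x \<in> carrier V \<and> y \<in> carrier W})"

definition tensor ::
  "'k ring \<Rightarrow> ('k, 'a) module \<Rightarrow> ('k, 'b) module \<Rightarrow> ('k, ('a \<times> 'b \<Rightarrow> 'k) set) module" where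
  "tensor K V W = (let F = free_module K (carrier V \<times> carrier W) in
     quotient_module F (submodule_span K F (tensor_relators K V W)))"

text \<open>\<open>pure_tensor K V W v w\<close> is \<open>v \<otimes> w\<close>.\<close>

definition pure_tensor ::
  "'k ring \<Rightarrow> ('k, 'a) module \<Rightarrow> ('k, 'b) module \<Rightarrow> 'a \<Rightarrow> 'b \<Rightarrow> ('a \<times> 'b \<Rightarrow> 'k) set" where
  "pure_tensor K V W v w = (let F = free_module K (carrier V \<times> carrier W) in
     submodule_span K F (tensor_relators K V W) +>\<^bsub>F\<^esub> free_gen K (v, w))"

text \<open>For linear maps \<open>f\<close> into \<open>V'\<close> and \<open>g\<close> into \<open>W'\<close>, the map \<open>f \<otimes> g\<close> into \<open>V' \<otimes> W'\<close>.\<close>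

definition tensor_map ::
  "'k ring \<Rightarrow> ('k, 'c) module \<Rightarrow> ('k, 'd) module \<Rightarrow> ('a \<Rightarrow> 'c) \<Rightarrow> ('b \<Rightarrow> 'd) \<Rightarrow>
     ('a \<times> 'b \<Rightarrow> 'k) set \<Rightarrow> ('c \<times> 'd \<Rightarrow> 'k) set" where
  "tensor_map K V' W' f g =
     linear_ext K (tensor K V' W') (\<lambda>(v, w). pure_tensor K V' W' (f v) (g w))"

text \<open>The canonical map \<open>(U \<otimes> V) \<otimes> W \<rightarrow> U \<otimes> (V \<otimes> W)\<close>.\<close>

definition tensor_assoc ::
  "'k ring \<Rightarrow> ('k, 'a) module \<Rightarrow> ('k, 'b) module \<Rightarrow> ('k, 'c) module \<Rightarrow>
     (('a \<times> 'b \<Rightarrow> 'k) set \<times> 'c \<Rightarrow> 'k) set \<Rightarrow> ('a \<times> ('b \<times> 'c \<Rightarrow> 'k) set \<Rightarrow> 'k) set" where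
  "tensor_assoc K U V W = (let VW = tensor K V W; T = tensor K U VW in
     linear_ext K T (\<lambda>(t, w).
       linear_ext K T (\<lambda>(u, v). pure_tensor K U VW u (pure_tensor K V W v w)) t))"

section \<open>Hopf algebras\<close>

definition unital_algebra :: "'k ring \<Rightarrow> ('k, 'a) module \<Rightarrow> bool" where
  "unital_algebra K A \<longleftrightarrow> module K A \<and> ring A \<and>
     (\<forall>a\<in>carrier K. \<forall>x\<in>carrier A. \<forall>y\<in>carrier A.
        (a \<odot>\<^bsub>A\<^esub> x) \<otimes>\<^bsub>A\<^esub> y = a \<odot>\<^bsub>A\<^esub> (x \<otimes>\<^bsub>A\<^esub> y) \<and> x \<otimes>\<^bsub>A\<^esub> (a \<odot>\<^bsub>A\<^esub> y) = a \<odot>\<^bsub>A\<^esub> (x \<otimes>\<^bsub>A\<^esub> y))"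

text \<open>The product of the algebra \<open>A \<otimes> A\<close>, i.e. \<open>(a \<otimes> b)(c \<otimes> d) = ac \<otimes> bd\<close>.\<close>

definition tensor_square_mult ::
  "'k ring \<Rightarrow> ('k, 'a) module \<Rightarrow> ('a \<times> 'a \<Rightarrow> 'k) set \<Rightarrow> ('a \<times> 'a \<Rightarrow> 'k) set \<Rightarrow> ('a \<times> 'a \<Rightarrow> 'k) set"
  where
  "tensor_square_mult K A X Y = (let T = tensor K A A in
     linear_ext K T (\<lambda>(a, b).
       linear_ext K T (\<lambda>(c, d). pure_tensor K A A (a \<otimes>\<^bsub>A\<^esub> c) (b \<otimes>\<^bsub>A\<^esub> d)) Y) X)"

definition coalgebra ::
  "'k ring \<Rightarrow> ('k, 'a) module \<Rightarrow> ('a \<Rightarrow> ('a \<times> 'a \<Rightarrow> 'k) set) \<Rightarrow> ('a \<Rightarrow> 'k) \<Rightarrow> bool" where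
  "coalgebra K C \<Delta> \<epsilon> \<longleftrightarrow> module K C \<and>
     linear_map K C (tensor K C C) \<Delta> \<and> linear_map K C (self_module K) \<epsilon> \<and>
     (\<forall>x\<in>carrier C.
        tensor_assoc K C C C (tensor_map K (tensor K C C) C \<Delta> (\<lambda>y. y) (\<Delta> x)) =
        tensor_map K C (tensor K C C) (\<lambda>y. y) \<Delta> (\<Delta> x)) \<and>
     (\<forall>x\<in>carrier C.
        linear_ext K C (\<lambda>(y, z). \<epsilon> y \<odot>\<^bsub>C\<^esub> z) (\<Delta> x) = x \<and>
        linear_ext K C (\<lambda>(y, z). \<epsilon> z \<odot>\<^bsub>C\<^esub> y) (\<Delta> x) = x)"

definition bialgebra ::
  "'k ring \<Rightarrow> ('k, 'a) module \<Rightarrow> ('a \<Rightarrow> ('a \<times> 'a \<Rightarrow> 'k) set) \<Rightarrow> ('a \<Rightarrow> 'k) \<Rightarrow> bool" where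
  "bialgebra K H \<Delta> \<epsilon> \<longleftrightarrow> unital_algebra K H \<and> coalgebra K H \<Delta> \<epsilon> \<and>
     \<Delta> \<one>\<^bsub>H\<^esub> = pure_tensor K H H \<one>\<^bsub>H\<^esub> \<one>\<^bsub>H\<^esub> \<and> \<epsilon> \<one>\<^bsub>H\<^esub> = \<one>\<^bsub>K\<^esub> \<and>
     (\<forall>x\<in>carrier H. \<forall>y\<in>carrier H.
        \<Delta> (x \<otimes>\<^bsub>H\<^esub> y) = tensor_square_mult K H (\<Delta> x) (\<Delta> y) \<and> \<epsilon> (x \<otimes>\<^bsub>H\<^esub> y) = \<epsilon> x \<otimes>\<^bsub>K\<^esub> \<epsilon> y)"

definition hopf_algebra ::
  "'k ring \<Rightarrow> ('k, 'a) module \<Rightarrow> ('a \<Rightarrow> ('a \<times> 'a \<Rightarrow> 'k) set) \<Rightarrow> ('a \<Rightarrow> 'k) \<Rightarrow> bool" where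
  "hopf_algebra K H \<Delta> \<epsilon> \<longleftrightarrow> bialgebra K H \<Delta> \<epsilon> \<and>
     (\<exists>S. linear_map K H H S \<and> (\<forall>x\<in>carrier H.
        linear_ext K H (\<lambda>(y, z). S y \<otimes>\<^bsub>H\<^esub> z) (\<Delta> x) = \<epsilon> x \<odot>\<^bsub>H\<^esub> \<one>\<^bsub>H\<^esub> \<and>
        linear_ext K H (\<lambda>(y, z). y \<otimes>\<^bsub>H\<^esub> S z) (\<Delta> x) = \<epsilon> x \<odot>\<^bsub>H\<^esub> \<one>\<^bsub>H\<^esub>))"

text \<open>Compatibility with the antipodes is automatic and, as usual, not part of the definition.\<close>

definition hopf_morphism ::
  "'k ring \<Rightarrow> ('k, 'a) module \<Rightarrow> ('a \<Rightarrow> ('a \<times> 'a \<Rightarrow> 'k) set) \<Rightarrow> ('a \<Rightarrow> 'k) \<Rightarrow>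
     ('k, 'b) module \<Rightarrow> ('b \<Rightarrow> ('b \<times> 'b \<Rightarrow> 'k) set) \<Rightarrow> ('b \<Rightarrow> 'k) \<Rightarrow> ('a \<Rightarrow> 'b) \<Rightarrow> bool" where
  "hopf_morphism K H \<Delta> \<epsilon> H' \<Delta>' \<epsilon>' f \<longleftrightarrow> linear_map K H H' f \<and>
     f \<one>\<^bsub>H\<^esub> = \<one>\<^bsub>H'\<^esub> \<and>
     (\<forall>x\<in>carrier H. \<forall>y\<in>carrier H. f (x \<otimes>\<^bsub>H\<^esub> y) = f x \<otimes>\<^bsub>H'\<^esub> f y) \<and>
     (\<forall>x\<in>carrier H. \<Delta>' (f x) = tensor_map K H' H' f f (\<Delta> x)) \<and>
     (\<forall>x\<in>carrier H. \<epsilon>' (f x) = \<epsilon> x)"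

section \<open>The tensor coalgebra\<close>

text \<open>The tensor power \<open>R\<^sup>\<otimes>\<^sup>n\<close> is the free module on the words \<open>x\<^sub>1 \<dots> x\<^sub>n\<close>, represented by lists
  of length \<open>n\<close>, modulo multilinearity. For \<open>n = 0\<close> there are no relations, so it is \<open>K\<close> with
  the empty word as unit.\<close>

definition words :: "('k, 'v) module \<Rightarrow> nat \<Rightarrow> 'v list set" where
  "words R n = {xs. set xs \<subseteq> carrier R \<and> length xs = n}"

definition power_relators :: "'k ring \<Rightarrow> ('k, 'v) module \<Rightarrow> nat \<Rightarrow> ('v list \<Rightarrow> 'k) set" where
  "power_relators K R n = (let F = free_module K (words R n); e = free_gen K in
     {e (us @ [x \<oplus>\<^bsub>R\<^esub> y] @ ws) \<ominus>\<^bsub>F\<^esub> e (us @ [x] @ ws) \<ominus>\<^bsub>F\<^esub> e (us @ [y] @ ws) | us x y ws.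
        x \<in> carrier R \<and> y \<in> carrier R \<and> set us \<subseteq> carrier R \<and> set ws \<subseteq> carrier R \<and>
        length us + 1 + length ws = n} \<union>
     {e (us @ [a \<odot>\<^bsub>R\<^esub> x] @ ws) \<ominus>\<^bsub>F\<^esub> a \<odot>\<^bsub>F\<^esub> e (us @ [x] @ ws) | us a x ws.
        a \<in> carrier K \<and> x \<in> carrier R \<and> set us \<subseteq> carrier R \<and> set ws \<subseteq> carrier R \<and>
        length us + 1 + length ws = n})"

definition tensor_power ::
  "'k ring \<Rightarrow> ('k, 'v) module \<Rightarrow> nat \<Rightarrow> ('k, ('v list \<Rightarrow> 'k) set) module" where
  "tensor_power K R n = (let F = free_module K (words R n) in
     quotient_module F (submodule_span K F (power_relators K R n)))"

text \<open>\<open>pure_word K R [x\<^sub>1, \<dots>, x\<^sub>n]\<close> is \<open>x\<^sub>1 \<otimes> \<dots> \<otimes> x\<^sub>n\<close>.\<close>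

definition pure_word :: "'k ring \<Rightarrow> ('k, 'v) module \<Rightarrow> 'v list \<Rightarrow> ('v list \<Rightarrow> 'k) set" where
  "pure_word K R xs = (let F = free_module K (words R (length xs)) in
     submodule_span K F (power_relators K R (length xs)) +>\<^bsub>F\<^esub> free_gen K xs)"

definition direct_sum :: "(nat \<Rightarrow> ('k, 'a) module) \<Rightarrow> ('k, nat \<Rightarrow> 'a) module" where
  "direct_sum V =
     \<lparr>carrier = {t. (\<forall>n. t n \<in> carrier (V n)) \<and> finite {n. t n \<noteq> \<zero>\<^bsub>V n\<^esub>}},
      monoid.mult = undefined, one = undefined,
      zero = (\<lambda>n. \<zero>\<^bsub>V n\<^esub>), add = (\<lambda>s t n. s n \<oplus>\<^bsub>V n\<^esub> t n), smult = (\<lambda>a t n. a \<odot>\<^bsub>V n\<^esub> t n)\<rparr>"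

type_synonym ('k, 'v) tc = "nat \<Rightarrow> ('v list \<Rightarrow> 'k) set"

definition tensor_coalg :: "'k ring \<Rightarrow> ('k, 'v) module \<Rightarrow> ('k, ('k, 'v) tc) module" where
  "tensor_coalg K R = direct_sum (tensor_power K R)"

definition tc_word :: "'k ring \<Rightarrow> ('k, 'v) module \<Rightarrow> 'v list \<Rightarrow> ('k, 'v) tc" where
  "tc_word K R xs =
     (\<lambda>n. if n = length xs then pure_word K R xs else \<zero>\<^bsub>tensor_power K R n\<^esub>)"

text \<open>The linear map from the tensor coalgebra to \<open>W\<close> with prescribed (multilinear) values \<open>g\<close>
  on words.\<close>

definition tc_ext ::
  "'k ring \<Rightarrow> ('k, 'v) module \<Rightarrow> ('k, 'b) module \<Rightarrow> ('v list \<Rightarrow> 'b) \<Rightarrow> ('k, 'v) tc \<Rightarrow> 'b" where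
  "tc_ext K R W g t = (\<Oplus>\<^bsub>W\<^esub>n\<in>{n. t n \<noteq> \<zero>\<^bsub>tensor_power K R n\<^esub>}. linear_ext K W g (t n))"

definition deconcatenation ::
  "'k ring \<Rightarrow> ('k, 'v) module \<Rightarrow> ('k, 'v) tc \<Rightarrow> (('k, 'v) tc \<times> ('k, 'v) tc \<Rightarrow> 'k) set" where
  "deconcatenation K R = (let T = tensor_coalg K R in
     tc_ext K R (tensor K T T) (\<lambda>xs.
       \<Oplus>\<^bsub>tensor K T T\<^esub>i\<in>{0..length xs}.
         pure_tensor K T T (tc_word K R (take i xs)) (tc_word K R (drop i xs))))"

definition tc_counit :: "'k ring \<Rightarrow> ('k, 'v) module \<Rightarrow> ('k, 'v) tc \<Rightarrow> 'k" where
  "tc_counit K R = tc_ext K R (self_module K) (\<lambda>xs. if xs = [] then \<one>\<^bsub>K\<^esub> else \<zero>\<^bsub>K\<^esub>)"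

definition tc_map ::
  "'k ring \<Rightarrow> ('k, 'v) module \<Rightarrow> ('k, 'w) module \<Rightarrow> ('v \<Rightarrow> 'w) \<Rightarrow> ('k, 'v) tc \<Rightarrow> ('k, 'w) tc" where
  "tc_map K R R' \<phi> = tc_ext K R (tensor_coalg K R') (\<lambda>xs. tc_word K R' (map \<phi> xs))"

section \<open>Cofree-coassociative combinatorial Hopf algebras\<close>

type_synonym ('k, 'v) cha = "('k, 'v) module \<times> (('k, 'v) tc \<Rightarrow> ('k, 'v) tc \<Rightarrow> ('k, 'v) tc)"

definition tc_algebra ::
  "'k ring \<Rightarrow> ('k, 'v) module \<Rightarrow> (('k, 'v) tc \<Rightarrow> ('k, 'v) tc \<Rightarrow> ('k, 'v) tc) \<Rightarrow>
     ('k, ('k, 'v) tc) module" where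
  "tc_algebra K R star =
     (tensor_coalg K R)\<lparr>monoid.mult := star, one := tc_word K R []\<rparr>"

text \<open>HOL has no type of all vector spaces: the objects of \<open>CHA\<close> and \<open>MB\<close> below are the structures
  on all vector spaces whose underlying set is contained in a type \<open>'v\<close>, the same (arbitrary)
  universe \<open>'v\<close> for both categories. Structure maps and morphisms are extensional functions on the carriers, so that they are
  equal as soon as they agree there.\<close>

definition is_cha :: "'k ring \<Rightarrow> ('k, 'v) cha \<Rightarrow> bool" where
  "is_cha K = (\<lambda>(R, star). module K R \<and>
     star \<in> carrier (tensor_coalg K R) \<rightarrow>\<^sub>E carrier (tensor_coalg K R) \<rightarrow>\<^sub>E carrier (tensor_coalg K R) \<and>
     hopf_algebra K (tc_algebra K R star) (deconcatenation K R) (tc_counit K R))"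

definition cha_hom :: "'k ring \<Rightarrow> ('k, 'v) cha \<Rightarrow> ('k, 'v) cha \<Rightarrow> ('v \<Rightarrow> 'v) set" where
  "cha_hom K = (\<lambda>(R, star) (R', star').
     {\<phi> \<in> extensional (carrier R). linear_map K R R' \<phi> \<and>
        hopf_morphism K
          (tc_algebra K R star) (deconcatenation K R) (tc_counit K R)
          (tc_algebra K R' star') (deconcatenation K R') (tc_counit K R')
          (tc_map K R R' \<phi>)})"

definition CHA :: "'k ring \<Rightarrow> (('k, 'v) cha, 'v \<Rightarrow> 'v) category" where
  "CHA K = \<lparr>Ob = {A. is_cha K A}, Hom = cha_hom K,
     Id = (\<lambda>A. \<lambda>x\<in>carrier (fst A). x),
     Comp = (\<lambda>A B C g f. compose (carrier (fst A)) g f)\<rparr>"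

section \<open>Multibrace algebras\<close>

type_synonym ('k, 'v) mb =
  "('k, 'v) module \<times> (nat \<Rightarrow> nat \<Rightarrow> (('v list \<Rightarrow> 'k) set \<times> ('v list \<Rightarrow> 'k) set \<Rightarrow> 'k) set \<Rightarrow> 'v)"

definition mb_domain ::
  "'k ring \<Rightarrow> ('k, 'v) module \<Rightarrow> nat \<Rightarrow> nat \<Rightarrow>
     ('k, (('v list \<Rightarrow> 'k) set \<times> ('v list \<Rightarrow> 'k) set \<Rightarrow> 'k) set) module" where
  "mb_domain K R p q = tensor K (tensor_power K R p) (tensor_power K R q)"

text \<open>\<open>mb_apply K (R, M) [x\<^sub>1, \<dots>, x\<^sub>p] [y\<^sub>1, \<dots>, y\<^sub>q]\<close> is \<open>M\<^sub>p\<^sub>q(x\<^sub>1 \<dots> x\<^sub>p; y\<^sub>1 \<dots> y\<^sub>q)\<close>.\<close>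

definition mb_apply :: "'k ring \<Rightarrow> ('k, 'v) mb \<Rightarrow> 'v list \<Rightarrow> 'v list \<Rightarrow> 'v" where
  "mb_apply K = (\<lambda>(R, M) xs ys. M (length xs) (length ys)
     (pure_tensor K (tensor_power K R (length xs)) (tensor_power K R (length ys))
        (pure_word K R xs) (pure_word K R ys)))"

text \<open>For \<open>is = [i\<^sub>1, \<dots>, i\<^sub>l]\<close> and \<open>js = [j\<^sub>1, \<dots>, j\<^sub>l]\<close>, the value of the concatenation
  \<open>M\<^bsub>i\<^sub>1j\<^sub>1\<^esub> \<dots> M\<^bsub>i\<^sub>lj\<^sub>l\<^esub>\<close> on \<open>(xs; ys)\<close>, which is a pure tensor and is returned as a word of length \<open>l\<close>.\<close>

fun mb_concat ::
  "'k ring \<Rightarrow> ('k, 'v) mb \<Rightarrow> nat list \<Rightarrow> nat list \<Rightarrow> 'v list \<Rightarrow> 'v list \<Rightarrow> 'v list" where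
  "mb_concat K A (i # is) (j # js) xs ys =
     mb_apply K A (take i xs) (take j ys) # mb_concat K A is js (drop i xs) (drop j ys)"
| "mb_concat K A _ _ xs ys = []"

definition weak_compositions :: "nat \<Rightarrow> nat \<Rightarrow> nat list set" where
  "weak_compositions n l = {is. length is = l \<and> sum_list is = n}"

text \<open>The multibrace relations are identities between linear maps on \<open>R\<^sup>\<otimes>\<^sup>i \<otimes> R\<^sup>\<otimes>\<^sup>j \<otimes> R\<^sup>\<otimes>\<^sup>k\<close>; they are
  written out on the spanning set of elements \<open>(x\<^sub>1 \<dots> x\<^sub>i; y\<^sub>1 \<dots> y\<^sub>j; z\<^sub>1 \<dots> z\<^sub>k)\<close>.
  Likewise, a linear map commutes with \<open>M\<^sub>p\<^sub>q\<close> iff it does so on the elements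
  \<open>(x\<^sub>1 \<dots> x\<^sub>p; y\<^sub>1 \<dots> y\<^sub>q)\<close>, which is how \<open>mb_hom\<close> states it.\<close>

definition is_mb :: "'k ring \<Rightarrow> ('k, 'v) mb \<Rightarrow> bool" where
  "is_mb K = (\<lambda>(R, M). module K R \<and>
     (\<forall>p q. M p q \<in> extensional (carrier (mb_domain K R p q)) \<and>
            linear_map K (mb_domain K R p q) R (M p q)) \<and>
     (\<forall>t\<in>carrier (mb_domain K R 0 0). M 0 0 t = \<zero>\<^bsub>R\<^esub>) \<and>
     (\<forall>x\<in>carrier R. mb_apply K (R, M) [x] [] = x \<and> mb_apply K (R, M) [] [x] = x) \<and>
     (\<forall>p>1. \<forall>t\<in>carrier (mb_domain K R p 0). M p 0 t = \<zero>\<^bsub>R\<^esub>) \<and>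
     (\<forall>q>1. \<forall>t\<in>carrier (mb_domain K R 0 q). M 0 q t = \<zero>\<^bsub>R\<^esub>) \<and>
     (\<forall>i\<ge>1. \<forall>j\<ge>1. \<forall>k\<ge>1. \<forall>xs\<in>words R i. \<forall>ys\<in>words R j. \<forall>zs\<in>words R k.
        (\<Oplus>\<^bsub>R\<^esub>l\<in>{1..i + j}. \<Oplus>\<^bsub>R\<^esub>is\<in>weak_compositions i l. \<Oplus>\<^bsub>R\<^esub>js\<in>weak_compositions j l.
           mb_apply K (R, M) (mb_concat K (R, M) is js xs ys) zs) =
        (\<Oplus>\<^bsub>R\<^esub>m\<in>{1..j + k}. \<Oplus>\<^bsub>R\<^esub>js\<in>weak_compositions j m. \<Oplus>\<^bsub>R\<^esub>ks\<in>weak_compositions k m.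
           mb_apply K (R, M) xs (mb_concat K (R, M) js ks ys zs))))"

definition mb_hom :: "'k ring \<Rightarrow> ('k, 'v) mb \<Rightarrow> ('k, 'v) mb \<Rightarrow> ('v \<Rightarrow> 'v) set" where
  "mb_hom K A A' =
     {\<phi> \<in> extensional (carrier (fst A)). linear_map K (fst A) (fst A') \<phi> \<and>
        (\<forall>p q. \<forall>xs\<in>words (fst A) p. \<forall>ys\<in>words (fst A) q.
           \<phi> (mb_apply K A xs ys) = mb_apply K A' (map \<phi> xs) (map \<phi> ys))}"

definition MB :: "'k ring \<Rightarrow> (('k, 'v) mb, 'v \<Rightarrow> 'v) category" where
  "MB K = \<lparr>Ob = {A. is_mb K A}, Hom = mb_hom K,
     Id = (\<lambda>A. \<lambda>x\<in>carrier (fst A). x),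
     Comp = (\<lambda>A B C g f. compose (carrier (fst A)) g f)\<rparr>"

end

theory Submission
  imports Defs
begin

text \<open>A coalgebra morphism into \<open>T\<^sup>c(R)\<close> is determined by its projection to \<open>R\<close>: any \<open>t\<close> equals
  \<open>\<epsilon>(t) 1\<close> plus the reassembly of \<open>\<Delta>(t)\<close> obtained by projecting the left tensor factor to \<open>R\<close> and
  prepending it to the right one. Applied to a product \<open>*\<close> that is compatible with \<open>\<Delta>\<close>, this is a
  recursion for \<open>x\<^sub>1 \<dots> x\<^sub>p * y\<^sub>1 \<dots> y\<^sub>q\<close> in terms of the maps \<open>M\<^sub>p\<^sub>q = proj \<circ> *\<close>, whose unrolling is
  \<open>\<Sum>\<^sub>l M\<^bsub>i\<^sub>1j\<^sub>1\<^esub> \<dots> M\<^bsub>i\<^sub>lj\<^sub>l\<^esub>\<close>; conversely, for unital \<open>M\<close> the solution of the recursion is compatible with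
  \<open>\<Delta>\<close>. Hence \<open>*\<close> and \<open>M\<close> determine each other. The same principle on \<open>T \<otimes> T \<otimes> T\<close> shows that \<open>*\<close> is
  associative iff the projections of \<open>(x * y) * z\<close> and \<open>x * (y * z)\<close> agree, which is the multibrace
  relation. The antipode exists by another recursion of the same shape, and \<open>T\<^sup>c(\<phi>)\<close> is multiplicative iff
  \<open>\<phi>\<close> commutes with all \<open>M\<^sub>p\<^sub>q\<close>. So the two categories are even isomorphic.\<close>

section \<open>Finite sums and linear maps\<close>

text \<open>The recursion for \<open>*\<close> is well founded only because M_00 = 0: the cut that
  takes nothing from either word would call the recursion on the same pair, and its coefficient
  vanishes. The same device returns at the cut 0, 0, 0 of the associativity proof and, through a
  function that vanishes at the empty word, in the antipode. The obstacle that shapes the text is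
  representational. Linear maps out of tensor products are evaluated at a representative picked by
  choice, so a formula on words can be used only once its multilinearity is known, and linearity in
  a parameter is proved by comparing values on generators. Hence the machinery for presented modules
  and the reduction of identities to words. The multibrace relations speak only of i, j, k \<ge> 1
  and of sums from l = 1. The missing cases are the unit laws, and the missing term l = 0 would need
  two empty words. Structure maps are extensional and both kinds of morphism are linear maps from
  \<open>R\<close> to \<open>R'\<close>, so the functors are the identity on morphisms and both
  round trips on objects are equalities.\<close>

lemma foldSetD_cong_on:
  assumes "(A, y) \<in> foldSetD D (\<lambda>x. h (f x)) e" "\<And>x. x \<in> A \<Longrightarrow> f x = g x"
  shows "(A, y) \<in> foldSetD D (\<lambda>x. h (g x)) e"
  using assms
proof (induction rule: foldSetD.induct)
  \<comment> \<open>The fold relation evaluates the summand only at elements that it inserts, all of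
    them in the index set; closure in a carrier never enters.\<close>
  case (insertI x A y)
  then show ?case
    by (metis (no_types, lifting) foldSetD.insertI insertCI)
qed (auto intro: foldSetD.intros)

text \<open>Unlike the library's congruence rule this one needs no closure premise, which makes it
  usable as a congruence rule of the simplifier.\<close>

lemma finsum_cong_on:
  assumes "\<And>i. i \<in> A \<Longrightarrow> f i = g i"
  shows "finsum G f A = finsum G g A"
proof -
  have "(A, y) \<in> foldSetD D (\<lambda>x. add G (f x)) e \<longleftrightarrow> (A, y) \<in> foldSetD D (\<lambda>x. add G (g x)) e" for y D e
    using foldSetD_cong_on[of A y D "add G" f e g] foldSetD_cong_on[of A y D "add G" g e f] assms by auto
  then show ?thesis
    by (simp add: finsum_def finprod_def foldD_def comp_def)
qed

lemma finsum_cong_on':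
  assumes "A = B" "\<And>i. i \<in> B \<Longrightarrow> f i = g i"
  shows "finsum G f A = finsum G g B"
  using assms finsum_cong_on by metis

context abelian_monoid
begin

lemma finsum_in [intro, simp]:
  "(\<And>i. i \<in> A \<Longrightarrow> f i \<in> carrier G) \<Longrightarrow> finsum G f A \<in> carrier G"
  by (rule finsum_closed) auto

lemma finsum_eq_zero: "(\<And>i. i \<in> A \<Longrightarrow> f i = \<zero>) \<Longrightarrow> finsum G f A = \<zero>"
  using finsum_cong_on[of A f "\<lambda>_. \<zero>" G] finsum_zero by simp

lemma finsum_add:
  assumes "\<And>i. i \<in> A \<Longrightarrow> f i \<in> carrier G" "\<And>i. i \<in> A \<Longrightarrow> g i \<in> carrier G"
  shows "finsum G (\<lambda>i. f i \<oplus> g i) A = finsum G f A \<oplus> finsum G g A"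
  by (rule finsum_addf) (use assms in auto)

lemma finsum_insert_in:
  assumes "finite A" "a \<notin> A" "f a \<in> carrier G" "\<And>i. i \<in> A \<Longrightarrow> f i \<in> carrier G"
  shows "finsum G f (insert a A) = f a \<oplus> finsum G f A"
  by (rule finsum_insert) (use assms in auto)

lemma finsum_mono_neutral:
  assumes "finite B" "A \<subseteq> B" "\<And>i. i \<in> B \<Longrightarrow> f i \<in> carrier G" "\<And>i. i \<in> B - A \<Longrightarrow> f i = \<zero>"
  shows "finsum G f A = finsum G f B"
  by (rule add.finprod_mono_neutral_cong_left) (use assms in auto)

lemma finsum_delta:
  assumes "finite A" "a \<in> A" "f a \<in> carrier G"  "\<And>i. i \<in> A \<Longrightarrow> i \<noteq> a \<Longrightarrow> f i = \<zero>"
  shows "finsum G f A = f a"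
proof -
  have "finsum G f {a} = finsum G f A"
    by (rule finsum_mono_neutral) (use assms in \<open>auto, metis zero_closed\<close>)
  then show ?thesis using finsum_insert_in[of "{}" a f] assms by (simp add: finsum_empty r_zero)
qed

lemma finsum_one: "f a \<in> carrier G \<Longrightarrow> finsum G f {a} = f a"
  using finsum_delta[of "{a}"] by auto

lemma finsum_swap:
  assumes "finite A" "finite B" "\<And>a b. a \<in> A \<Longrightarrow> b \<in> B \<Longrightarrow> f a b \<in> carrier G"
  shows "finsum G (\<lambda>a. finsum G (\<lambda>b. f a b) B) A = finsum G (\<lambda>b. finsum G (\<lambda>a. f a b) A) B"
  using assms
proof (induction A rule: finite_induct)
  case (insert a A)
  have "finsum G (\<lambda>b. finsum G (\<lambda>a. f a b) (insert a A)) B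
      = finsum G (\<lambda>b. f a b \<oplus> finsum G (\<lambda>a. f a b) A) B"
    by (rule finsum_cong_on, rule finsum_insert_in) (use insert in auto)
  also have "\<dots> = finsum G (\<lambda>b. f a b) B \<oplus> finsum G (\<lambda>b. finsum G (\<lambda>a. f a b) A) B"
    by (rule finsum_add) (use insert in auto)
  also have "\<dots> = finsum G (\<lambda>a. finsum G (\<lambda>b. f a b) B) (insert a A)"
    by (subst finsum_insert_in) (use insert in auto)
  finally show ?case by simp
qed (simp add: finsum_eq_zero finsum_empty)

lemma finsum_atMost_Suc_shift:
  assumes "\<And>i. i \<le> Suc n \<Longrightarrow> f i \<in> carrier G"
  shows "finsum G f {..Suc n} = f 0 \<oplus> finsum G (\<lambda>i. f (Suc i)) {..n}"
proof -
  have "finsum G f {..Suc n} = f 0 \<oplus> finsum G f (Suc ` {..n})"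
    unfolding atMost_Suc_eq_insert_0 by (rule finsum_insert_in) (use assms in auto)
  also have "finsum G f (Suc ` {..n}) = finsum G (\<lambda>i. f (Suc i)) {..n}"
    by (rule finsum_reindex) (use assms in auto)
  finally show ?thesis .
qed

text \<open>Pairs \<open>i \<le> a \<le> n\<close> are reindexed by \<open>i\<close> and
  \<open>k = a - i\<close>. With \<open>i\<close> and \<open>a\<close> as cut positions of a word,
  cutting at \<open>a\<close> and cutting the left piece again becomes cutting at \<open>i\<close>
  and cutting the right piece again, which is the combinatorial content of coassociativity.\<close>

lemma finsum_triangle:
  assumes "\<And>a i. i \<le> a \<Longrightarrow> a \<le> n \<Longrightarrow> f i a \<in> carrier G"
  shows "finsum G (\<lambda>a. finsum G (\<lambda>i. f i a) {..a}) {..n}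
       = finsum G (\<lambda>i. finsum G (\<lambda>k. f i (i + k)) {..n - i}) {..(n::nat)}"
proof -
  \<comment> \<open>The triangle is padded with zeros to a square, where the order of summation may
    be exchanged.\<close>
  have "finsum G (\<lambda>a. finsum G (\<lambda>i. f i a) {..a}) {..n}
      = finsum G (\<lambda>a. finsum G (\<lambda>i. if i \<le> a then f i a else \<zero>) {..n}) {..n}"
    by (intro finsum_cong_on add.finprod_mono_neutral_cong_left) (use assms in auto)
  also have "\<dots> = finsum G (\<lambda>i. finsum G (\<lambda>a. if i \<le> a then f i a else \<zero>) {..n}) {..n}"
    by (rule finsum_swap) (use assms in auto)
  \<comment> \<open>The padding is dropped again: for fixed \<open>i\<close> the remaining
    \<open>a\<close> are the numbers \<open>i + k\<close>.\<close>
  also have "\<dots> = finsum G (\<lambda>i. finsum G (f i) ((+) i ` {..n - i})) {..n}"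
  proof (intro finsum_cong_on add.finprod_mono_neutral_cong_right ballI)
    fix i a assume "i \<in> {..n}" "a \<in> {..n} - (+) i ` {..n - i}"
    then have "\<not> i \<le> a" by (auto simp: image_iff le_iff_add)
    then show "(if i \<le> a then f i a else \<zero>) = \<zero>" by simp
  qed (use assms in auto)
  also have "\<dots> = finsum G (\<lambda>i. finsum G (\<lambda>k. f i (i + k)) {..n - i}) {..n}"
    by (intro finsum_cong_on finsum_reindex) (use assms in auto)
  finally show ?thesis .
qed

end

section \<open>Linear maps between modules\<close>

lemma module_abelian_group [simp]: "module K V \<Longrightarrow> abelian_group V"
  by (rule module.axioms)

lemma module_abelian_monoid [simp]: "module K V \<Longrightarrow> abelian_monoid V"
  by (simp add: abelian_group.axioms)

lemma linear_mapI:
  assumes "\<And>x. x \<in> carrier V \<Longrightarrow> f x \<in> carrier W"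
    "\<And>x y. x \<in> carrier V \<Longrightarrow> y \<in> carrier V \<Longrightarrow> f (x \<oplus>\<^bsub>V\<^esub> y) = f x \<oplus>\<^bsub>W\<^esub> f y"
    "\<And>a x. a \<in> carrier K \<Longrightarrow> x \<in> carrier V \<Longrightarrow> f (a \<odot>\<^bsub>V\<^esub> x) = a \<odot>\<^bsub>W\<^esub> f x"
  shows "linear_map K V W f"
  using assms by (auto simp: linear_map_def)

lemma linear_map_closed:
  "linear_map K V W f \<Longrightarrow> x \<in> carrier V \<Longrightarrow> f x \<in> carrier W"
  by (auto simp: linear_map_def)

lemma linear_map_add:
  "linear_map K V W f \<Longrightarrow> x \<in> carrier V \<Longrightarrow> y \<in> carrier V \<Longrightarrow> f (x \<oplus>\<^bsub>V\<^esub> y) = f x \<oplus>\<^bsub>W\<^esub> f y"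
  by (auto simp: linear_map_def)

lemma linear_map_smult:
  "linear_map K V W f \<Longrightarrow> a \<in> carrier K \<Longrightarrow> x \<in> carrier V \<Longrightarrow> f (a \<odot>\<^bsub>V\<^esub> x) = a \<odot>\<^bsub>W\<^esub> f x"
  by (auto simp: linear_map_def)

lemma linear_map_cong:
  assumes "module K V" "\<And>x. x \<in> carrier V \<Longrightarrow> f x = g x"
  shows "linear_map K V W f \<longleftrightarrow> linear_map K V W g"
proof -
  interpret module K V by fact
  show ?thesis using assms(2) by (auto simp: linear_map_def Pi_iff)
qed

lemma linear_map_zero:
  assumes "module K V" "module K W" "linear_map K V W f"
  shows "f \<zero>\<^bsub>V\<^esub> = \<zero>\<^bsub>W\<^esub>"
proof -
  interpret V: module K V by fact
  interpret W: module K W by fact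
  have "f (\<zero>\<^bsub>K\<^esub> \<odot>\<^bsub>V\<^esub> \<zero>\<^bsub>V\<^esub>) = \<zero>\<^bsub>K\<^esub> \<odot>\<^bsub>W\<^esub> f \<zero>\<^bsub>V\<^esub>"
    by (rule linear_map_smult) (use assms in auto)
  then show ?thesis using linear_map_closed[OF assms(3)] by simp
qed

lemma linear_map_neg:
  assumes "module K V" "module K W" "linear_map K V W f" "x \<in> carrier V"
  shows "f (\<ominus>\<^bsub>V\<^esub> x) = \<ominus>\<^bsub>W\<^esub> f x"
proof -
  interpret V: module K V by fact
  interpret W: module K W by fact
  have "f (\<ominus>\<^bsub>V\<^esub> x) \<oplus>\<^bsub>W\<^esub> f x = \<zero>\<^bsub>W\<^esub>"
    using linear_map_add[OF assms(3), of "\<ominus>\<^bsub>V\<^esub> x" x] linear_map_zero[OF assms(1-3)] assms(4)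
    by (simp add: V.M.l_neg)
  then show ?thesis
    using linear_map_closed[OF assms(3)] assms(4) W.M.minus_equality by auto
qed

lemma linear_map_diff:
  assumes "module K V" "module K W" "linear_map K V W f" "x \<in> carrier V" "y \<in> carrier V"
  shows "f (x \<ominus>\<^bsub>V\<^esub> y) = f x \<ominus>\<^bsub>W\<^esub> f y"
proof -
  interpret V: module K V by fact
  show ?thesis
    using assms by (simp add: a_minus_def linear_map_add linear_map_neg)
qed

lemma linear_map_finsum:
  assumes "module K V" "module K W" "linear_map K V W f" "\<And>i. i \<in> A \<Longrightarrow> g i \<in> carrier V"
  shows "f (finsum V g A) = finsum W (\<lambda>i. f (g i)) A"
proof -
  interpret V: module K V by fact
  interpret W: module K W by fact
  show ?thesis
  proof (cases "finite A")
    case True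
    then show ?thesis using assms(4)
    proof (induction A rule: finite_induct)
      case empty
      then show ?case using linear_map_zero[OF assms(1-3)] by simp
    next
      case (insert a A)
      then show ?case
        by (simp add: V.M.finsum_insert_in W.M.finsum_insert_in linear_map_closed[OF assms(3)]
            linear_map_add[OF assms(3)])
    qed
  \<comment> \<open>Over an infinite index set both sums take the default value zero, which
    \<open>f\<close> preserves.\<close>
  qed (simp add: V.M.finsum_infinite W.M.finsum_infinite linear_map_zero[OF assms(1-3)])
qed

lemma linear_map_ident: "linear_map K V V (\<lambda>x. x)"
  by (auto simp: linear_map_def)

lemma linear_map_comp:
  assumes "linear_map K V W f" "linear_map K W U g"
  shows "linear_map K V U (\<lambda>x. g (f x))"
  using assms by (auto simp: linear_map_def Pi_iff)

lemma linear_map_const_zero: "module K W \<Longrightarrow> linear_map K V W (\<lambda>x. \<zero>\<^bsub>W\<^esub>)"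
  by (auto simp: linear_map_def abelian_monoid.zero_closed abelian_monoid.l_zero module.smult_r_null)

lemma linear_map_plus:
  assumes "module K W" "linear_map K V W f" "linear_map K V W g"
  shows "linear_map K V W (\<lambda>x. f x \<oplus>\<^bsub>W\<^esub> g x)"
proof -
  interpret W: module K W by fact
  show ?thesis
  proof (rule linear_mapI)
    show "f (x \<oplus>\<^bsub>V\<^esub> y) \<oplus>\<^bsub>W\<^esub> g (x \<oplus>\<^bsub>V\<^esub> y) = f x \<oplus>\<^bsub>W\<^esub> g x \<oplus>\<^bsub>W\<^esub> (f y \<oplus>\<^bsub>W\<^esub> g y)"
      if "x \<in> carrier V" "y \<in> carrier V" for x y
      using that assms(2,3) linear_map_closed[OF assms(2)] linear_map_closed[OF assms(3)]
      by (simp add: linear_map_add W.M.a_ac)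
  qed (use assms in \<open>auto simp: linear_map_closed linear_map_smult W.smult_r_distr\<close>)
qed

lemma linear_map_sum:
  assumes "module K W" "\<And>i. i \<in> A \<Longrightarrow> linear_map K V W (f i)"
  shows "linear_map K V W (\<lambda>x. finsum W (\<lambda>i. f i x) A)"
proof -
  interpret W: module K W by fact
  show ?thesis
  proof (cases "finite A")
    case True
    then show ?thesis using assms(2)
    proof (induction A rule: finite_induct)
      case (insert a A)
      have "linear_map K V W (\<lambda>x. f a x \<oplus>\<^bsub>W\<^esub> finsum W (\<lambda>i. f i x) A)"
        using insert assms(1) by (intro linear_map_plus) auto
      then show ?case
        using insert by (auto simp: linear_map_def W.M.finsum_insert_in Pi_iff)
    qed (simp add: linear_map_const_zero assms)
  qed (simp add: W.M.finsum_infinite linear_map_const_zero assms)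
qed

lemma linear_map_scale:
  assumes "module K W" "linear_map K V W f" "a \<in> carrier K"
  shows "linear_map K V W (\<lambda>x. a \<odot>\<^bsub>W\<^esub> f x)"
proof -
  interpret W: module K W by fact
  show ?thesis
    using assms linear_map_closed[OF assms(2)]
    by (intro linear_mapI)
      (auto simp: linear_map_add linear_map_smult W.smult_r_distr W.R.m_comm simp flip: W.smult_assoc1)
qed

lemma linear_map_uminus:
  assumes "module K W" "linear_map K V W f"
  shows "linear_map K V W (\<lambda>x. \<ominus>\<^bsub>W\<^esub> f x)"
proof -
  interpret W: module K W by fact
  show ?thesis
    using assms linear_map_closed[OF assms(2)]
    by (intro linear_mapI)
      (auto simp: linear_map_add linear_map_smult W.smult_r_minus W.M.minus_add)
qed

text \<open>The map is curried, whereas \<open>linear_ext\<close> takes a function of a pair; this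
  is why later statements carry \<open>case (u, v) of (u, v)\<close> and are opened with
  \<open>prod.case\<close>.\<close>

definition bilinear_map ::
  "'k ring \<Rightarrow> ('k, 'a) module \<Rightarrow> ('k, 'b) module \<Rightarrow> ('k, 'c) module \<Rightarrow> ('a \<Rightarrow> 'b \<Rightarrow> 'c) \<Rightarrow> bool" where
  "bilinear_map K V W U b \<longleftrightarrow>
     (\<forall>v\<in>carrier V. linear_map K W U (b v)) \<and> (\<forall>w\<in>carrier W. linear_map K V U (\<lambda>v. b v w))"

lemma bilinear_mapI:
  assumes "\<And>v. v \<in> carrier V \<Longrightarrow> linear_map K W U (b v)"
    "\<And>w. w \<in> carrier W \<Longrightarrow> linear_map K V U (\<lambda>v. b v w)"
  shows "bilinear_map K V W U b"
  using assms by (auto simp: bilinear_map_def)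

lemma bilinear_map_right: "bilinear_map K V W U b \<Longrightarrow> v \<in> carrier V \<Longrightarrow> linear_map K W U (b v)"
  by (auto simp: bilinear_map_def)

lemma bilinear_map_left: "bilinear_map K V W U b \<Longrightarrow> w \<in> carrier W \<Longrightarrow> linear_map K V U (\<lambda>v. b v w)"
  by (auto simp: bilinear_map_def)

lemma bilinear_map_closed:
  "bilinear_map K V W U b \<Longrightarrow> v \<in> carrier V \<Longrightarrow> w \<in> carrier W \<Longrightarrow> b v w \<in> carrier U"
  by (rule linear_map_closed[OF bilinear_map_right])

lemma bilinear_map_comp:
  assumes "bilinear_map K V' W' U b" "linear_map K V V' f" "linear_map K W W' g"
  shows "bilinear_map K V W U (\<lambda>v w. b (f v) (g w))"
  using assms by (auto simp: bilinear_map_def intro!: linear_map_comp[OF assms(2), of U "\<lambda>v. b v _"]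
      linear_map_comp[OF assms(3)] linear_map_closed[OF assms(2)] linear_map_closed[OF assms(3)])

lemma linear_bilinear_comp:
  assumes "bilinear_map K V W U b" "linear_map K U U' f"
  shows "bilinear_map K V W U' (\<lambda>v w. f (b v w))"
  using assms by (auto simp: bilinear_map_def intro!: linear_map_comp[OF _ assms(2)])

section \<open>Quotients of free modules\<close>

lemma free_module_simps [simp]:
  "zero (free_module K S) = (\<lambda>s. \<zero>\<^bsub>K\<^esub>)"
  "add (free_module K S) = (\<lambda>f g s. f s \<oplus>\<^bsub>K\<^esub> g s)"
  "smult (free_module K S) = (\<lambda>a f s. a \<otimes>\<^bsub>K\<^esub> f s)"
  by (auto simp: free_module_def)

lemma free_module_carrier:
  "f \<in> carrier (free_module K S) \<longleftrightarrow>
    (\<forall>s. f s \<in> carrier K) \<and> finite {s. f s \<noteq> \<zero>\<^bsub>K\<^esub>} \<and> {s. f s \<noteq> \<zero>\<^bsub>K\<^esub>} \<subseteq> S"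
  by (auto simp: free_module_def)

lemma module_free_module:
  assumes "cring K"
  shows "module K (free_module K S)"
proof -
  interpret cring K by fact
  show ?thesis
  proof (rule moduleI)
    show "abelian_group (free_module K S)"
    proof (rule abelian_groupI)
      fix f g assume fg: "f \<in> carrier (free_module K S)" "g \<in> carrier (free_module K S)"
      have sub: "{s. f s \<oplus>\<^bsub>K\<^esub> g s \<noteq> \<zero>\<^bsub>K\<^esub>} \<subseteq> {s. f s \<noteq> \<zero>\<^bsub>K\<^esub>} \<union> {s. g s \<noteq> \<zero>\<^bsub>K\<^esub>}"
        by auto
      have "finite {s. f s \<oplus>\<^bsub>K\<^esub> g s \<noteq> \<zero>\<^bsub>K\<^esub>}"
        by (rule finite_subset[OF sub]) (use fg in \<open>auto simp: free_module_carrier\<close>)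
      with fg sub show "f \<oplus>\<^bsub>free_module K S\<^esub> g \<in> carrier (free_module K S)"
        by (auto simp: free_module_carrier)
    next
      fix f assume f: "f \<in> carrier (free_module K S)"
      have "{s. \<ominus>\<^bsub>K\<^esub> f s \<noteq> \<zero>\<^bsub>K\<^esub>} \<subseteq> {s. f s \<noteq> \<zero>\<^bsub>K\<^esub>}" by auto
      then have "(\<lambda>s. \<ominus>\<^bsub>K\<^esub> f s) \<in> carrier (free_module K S)"
        using f by (auto simp: free_module_carrier intro: finite_subset)
      moreover have "(\<lambda>s. \<ominus>\<^bsub>K\<^esub> f s) \<oplus>\<^bsub>free_module K S\<^esub> f = \<zero>\<^bsub>free_module K S\<^esub>"
        using f by (auto simp: free_module_carrier l_neg)
      ultimately show "\<exists>y\<in>carrier (free_module K S). y \<oplus>\<^bsub>free_module K S\<^esub> f = \<zero>\<^bsub>free_module K S\<^esub>"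
        by blast
    qed (auto simp: free_module_carrier a_ac)
    fix a f assume f: "a \<in> carrier K" "f \<in> carrier (free_module K S)"
    then have "{s. a \<otimes>\<^bsub>K\<^esub> f s \<noteq> \<zero>\<^bsub>K\<^esub>} \<subseteq> {s. f s \<noteq> \<zero>\<^bsub>K\<^esub>}" by auto
    then show "a \<odot>\<^bsub>free_module K S\<^esub> f \<in> carrier (free_module K S)"
      using f by (auto simp: free_module_carrier intro: finite_subset)
  qed (auto simp: free_module_carrier l_distr r_distr m_assoc \<open>cring K\<close>)
qed

lemma free_gen_in [simp, intro]:
  assumes "cring K" "s \<in> S"
  shows "free_gen K s \<in> carrier (free_module K S)"
proof -
  interpret cring K by fact
  have "{t. free_gen K s t \<noteq> \<zero>\<^bsub>K\<^esub>} \<subseteq> {s}" by (auto simp: free_gen_def)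
  then show ?thesis
    using assms(2) by (auto simp: free_module_carrier intro: finite_subset) (auto simp: free_gen_def)
qed

text \<open>A finitely supported function is taken apart one point at a time. The induction runs
  over a finite set containing the support rather than over the support itself, so that the
  hypothesis applies after the value at one point is reset to zero.\<close>

lemma free_module_span:
  assumes K: "cring K" and N: "submodule N K (free_module K S)" "\<And>s. s \<in> S \<Longrightarrow> free_gen K s \<in> N"
    and f: "f \<in> carrier (free_module K S)"
  shows "f \<in> N"
proof -
  interpret cring K by fact
  interpret F: module K "free_module K S" using K by (rule module_free_module)
  note NE = F.submoduleE[OF N(1)]
  have zero: "(\<lambda>s. \<zero>\<^bsub>K\<^esub>) \<in> N"
    using subgroup.one_closed[OF submodule.axioms(1)[OF N(1)]] by simp
  have "finite A \<Longrightarrow> (\<And>f. f \<in> carrier (free_module K S) \<Longrightarrow> {s. f s \<noteq> \<zero>\<^bsub>K\<^esub>} \<subseteq> A \<Longrightarrow> f \<in> N)" for A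
  proof (induction A rule: finite_induct)
    case empty
    then have "f = (\<lambda>s. \<zero>\<^bsub>K\<^esub>)" by auto
    then show ?case using zero by simp
  next
    case (insert a A)
    have fK: "f s \<in> carrier K" for s using insert by (auto simp: free_module_carrier)
    show ?case
    proof (cases "f a = \<zero>\<^bsub>K\<^esub>")
      case True
      then show ?thesis using insert by blast
    next
      case False
      let ?g = "f(a := \<zero>\<^bsub>K\<^esub>)"
      have sub: "{s. ?g s \<noteq> \<zero>\<^bsub>K\<^esub>} \<subseteq> {s. f s \<noteq> \<zero>\<^bsub>K\<^esub>}" by auto
      then have "?g \<in> carrier (free_module K S)"
        using insert.prems(1) unfolding free_module_carrier by (auto intro: finite_subset)
      moreover have "{s. ?g s \<noteq> \<zero>\<^bsub>K\<^esub>} \<subseteq> A" using insert by auto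
      ultimately have "?g \<in> N" by (rule insert.IH)
      moreover have "f a \<odot>\<^bsub>free_module K S\<^esub> free_gen K a \<in> N"
        using insert.prems(1) False by (intro NE(4) N(2)) (auto simp: free_module_carrier)
      ultimately have "?g \<oplus>\<^bsub>free_module K S\<^esub> (f a \<odot>\<^bsub>free_module K S\<^esub> free_gen K a) \<in> N"
        by (rule NE(5))
      moreover have "?g \<oplus>\<^bsub>free_module K S\<^esub> (f a \<odot>\<^bsub>free_module K S\<^esub> free_gen K a) = f"
        using fK by (auto simp: free_gen_def)
      ultimately show ?thesis by metis
    qed
  qed
  then show ?thesis using f by (auto simp: free_module_carrier)
qed

text \<open>The sum inside \<open>linear_ext\<close> with the chosen representative turned into an
  argument.\<close>

definition free_ext :: "'k ring \<Rightarrow> ('k, 'b) module \<Rightarrow> ('s \<Rightarrow> 'b) \<Rightarrow> ('s \<Rightarrow> 'k) \<Rightarrow> 'b" where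
  "free_ext K W g f = (\<Oplus>\<^bsub>W\<^esub>s\<in>{s. f s \<noteq> \<zero>\<^bsub>K\<^esub>}. f s \<odot>\<^bsub>W\<^esub> g s)"

text \<open>The supports of \<open>f\<close>, \<open>h\<close> and their sum differ in general;
  additivity needs a common range of summation, which any finite set between support and
  \<open>S\<close> provides.\<close>

lemma free_ext_eq:
  assumes "module K W" "\<And>s. s \<in> S \<Longrightarrow> g s \<in> carrier W" "f \<in> carrier (free_module K S)"
    "finite A" "A \<subseteq> S" "{s. f s \<noteq> \<zero>\<^bsub>K\<^esub>} \<subseteq> A"
  shows "free_ext K W g f = (\<Oplus>\<^bsub>W\<^esub>s\<in>A. f s \<odot>\<^bsub>W\<^esub> g s)"
proof -
  interpret module K W by fact
  show ?thesis unfolding free_ext_def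
    by (rule M.finsum_mono_neutral) (use assms in \<open>auto simp: free_module_carrier subset_iff\<close>)
qed

lemma linear_map_free_ext:
  assumes W: "module K W" and g: "\<And>s. s \<in> S \<Longrightarrow> g s \<in> carrier W"
  shows "linear_map K (free_module K S) W (free_ext K W g)"
proof -
  interpret module K W by fact
  interpret F: module K "free_module K S" using R.cring_axioms by (rule module_free_module)
  show ?thesis
  proof (rule linear_mapI)
    fix f assume "f \<in> carrier (free_module K S)"
    then show "free_ext K W g f \<in> carrier W"
      unfolding free_ext_def using g by (intro M.finsum_in) (auto simp: free_module_carrier)
  next
    fix f h assume fh: "f \<in> carrier (free_module K S)" "h \<in> carrier (free_module K S)"
    let ?A = "{s. f s \<noteq> \<zero>\<^bsub>K\<^esub>} \<union> {s. h s \<noteq> \<zero>\<^bsub>K\<^esub>}"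
    have A: "finite ?A" "?A \<subseteq> S" using fh by (auto simp: free_module_carrier)
    have K: "f s \<in> carrier K" "h s \<in> carrier K" for s using fh by (auto simp: free_module_carrier)
    have fh': "f \<oplus>\<^bsub>free_module K S\<^esub> h \<in> carrier (free_module K S)"
      using fh by (rule F.M.a_closed)
    have "free_ext K W g (f \<oplus>\<^bsub>free_module K S\<^esub> h)
       = (\<Oplus>\<^bsub>W\<^esub>s\<in>?A. (f \<oplus>\<^bsub>free_module K S\<^esub> h) s \<odot>\<^bsub>W\<^esub> g s)"
      by (rule free_ext_eq[OF W _ fh' A]) (use g in auto)
    also have "\<dots> = (\<Oplus>\<^bsub>W\<^esub>s\<in>?A. f s \<odot>\<^bsub>W\<^esub> g s \<oplus>\<^bsub>W\<^esub> h s \<odot>\<^bsub>W\<^esub> g s)"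
      by (rule finsum_cong_on) (use A K g in \<open>auto simp: smult_l_distr subset_iff\<close>)
    also have "\<dots> = (\<Oplus>\<^bsub>W\<^esub>s\<in>?A. f s \<odot>\<^bsub>W\<^esub> g s) \<oplus>\<^bsub>W\<^esub> (\<Oplus>\<^bsub>W\<^esub>s\<in>?A. h s \<odot>\<^bsub>W\<^esub> g s)"
      by (rule M.finsum_add) (use A K g in auto)
    also have "\<dots> = free_ext K W g f \<oplus>\<^bsub>W\<^esub> free_ext K W g h"
      using free_ext_eq[OF W g fh(1) A] free_ext_eq[OF W g fh(2) A] by simp
    finally show "free_ext K W g (f \<oplus>\<^bsub>free_module K S\<^esub> h) = free_ext K W g f \<oplus>\<^bsub>W\<^esub> free_ext K W g h" .
  next
    fix a f assume a: "a \<in> carrier K" and f: "f \<in> carrier (free_module K S)"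
    let ?A = "{s. f s \<noteq> \<zero>\<^bsub>K\<^esub>}"
    have A: "finite ?A" "?A \<subseteq> S" using f by (auto simp: free_module_carrier)
    have K: "f s \<in> carrier K" for s using f by (auto simp: free_module_carrier)
    have f': "a \<odot>\<^bsub>free_module K S\<^esub> f \<in> carrier (free_module K S)"
      using a f by (rule F.smult_closed)
    have "free_ext K W g (a \<odot>\<^bsub>free_module K S\<^esub> f) = (\<Oplus>\<^bsub>W\<^esub>s\<in>?A. (a \<odot>\<^bsub>free_module K S\<^esub> f) s \<odot>\<^bsub>W\<^esub> g s)"
      by (rule free_ext_eq[OF W _ f' A]) (use g a in auto)
    also have "\<dots> = (\<Oplus>\<^bsub>W\<^esub>s\<in>?A. a \<odot>\<^bsub>W\<^esub> (f s \<odot>\<^bsub>W\<^esub> g s))"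
      by (rule finsum_cong_on) (use A K a g in \<open>auto simp: smult_assoc1 subset_iff\<close>)
    also have "\<dots> = a \<odot>\<^bsub>W\<^esub> free_ext K W g f"
      unfolding free_ext_def by (rule finsum_smult_ldistr[symmetric]) (use A K a g in auto)
    finally show "free_ext K W g (a \<odot>\<^bsub>free_module K S\<^esub> f) = a \<odot>\<^bsub>W\<^esub> free_ext K W g f" .
  qed
qed

lemma free_ext_gen:
  assumes W: "module K W" and g: "g s \<in> carrier W"
  shows "free_ext K W g (free_gen K s) = g s"
proof -
  interpret module K W by fact
  have gen: "free_gen K s \<in> carrier (free_module K {s})"
    using R.cring_axioms by simp
  have "free_ext K W g (free_gen K s) = (\<Oplus>\<^bsub>W\<^esub>t\<in>{s}. free_gen K s t \<odot>\<^bsub>W\<^esub> g t)"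
    by (rule free_ext_eq[OF W _ gen]) (use g in \<open>auto simp: free_gen_def\<close>)
  then show ?thesis using g by (simp add: M.finsum_one free_gen_def)
qed

section \<open>Spans, kernels and quotient modules\<close>

lemma submodule_submodule_span:
  assumes "module K V" "A \<subseteq> carrier V"
  shows "submodule (submodule_span K V A) K V"
proof -
  interpret V: module K V by fact
  \<comment> \<open>The intersection defining the span lies inside the carrier only because the
    carrier is itself a member of the family.\<close>
  have carr: "carrier V \<in> {N. submodule N K V \<and> A \<subseteq> N}"
    using V.carrier_is_submodule assms(2) by simp
  show ?thesis
    unfolding submodule_span_def
  proof (rule V.submoduleI)
    show "\<zero>\<^bsub>V\<^esub> \<in> \<Inter>{N. submodule N K V \<and> A \<subseteq> N}"
      using subgroup.one_closed[OF submodule.axioms(1)] by fastforce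
    show "\<Inter>{N. submodule N K V \<and> A \<subseteq> N} \<subseteq> carrier V"
      using carr by (rule Inter_lower)
  qed (simp_all add: V.submoduleE(3,4,5))
qed

lemma submodule_span_superset: "A \<subseteq> submodule_span K V A"
  unfolding submodule_span_def by auto

lemma submodule_span_least: "submodule N K V \<Longrightarrow> A \<subseteq> N \<Longrightarrow> submodule_span K V A \<subseteq> N"
  unfolding submodule_span_def by auto

lemma submodule_kernel:
  assumes "module K V" "module K W" "linear_map K V W f"
  shows "submodule {x \<in> carrier V. f x = \<zero>\<^bsub>W\<^esub>} K V"
proof -
  interpret V: module K V by fact
  interpret W: module K W by fact
  show ?thesis
    by (rule V.submoduleI)
      (auto simp: linear_map_zero[OF assms] linear_map_neg[OF assms] linear_map_add[OF assms(3)]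
        linear_map_smult[OF assms(3)])
qed

text \<open>The submodule to which the spanning lemmas are applied: linear maps that agree on
  generators agree on all that the generators span.\<close>

lemma submodule_equalizer:
  assumes "module K V" "module K W" "linear_map K V W f" "linear_map K V W g"
  shows "submodule {x \<in> carrier V. f x = g x} K V"
proof -
  interpret V: module K V by fact
  interpret W: module K W by fact
  show ?thesis
    using assms by (intro V.submoduleI)
      (auto simp: linear_map_zero[OF assms(1,2)] linear_map_neg[OF assms(1,2)] linear_map_add
        linear_map_smult)
qed

lemma submodule_abelian_subgroup:
  assumes "module K V" "submodule N K V"
  shows "abelian_subgroup N V"
  by (rule abelian_subgroupI3)
    (use assms in \<open>auto intro: additive_subgroup.intro submodule.axioms(1)\<close>)

lemma quotient_module_simps [simp]:
  "carrier (quotient_module V N) = a_rcosets\<^bsub>V\<^esub> N"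
  "zero (quotient_module V N) = N"
  "add (quotient_module V N) = set_add V"
  by (auto simp: quotient_module_def)

lemma quotient_carrier:
  "X \<in> carrier (quotient_module V N) \<longleftrightarrow> (\<exists>x\<in>carrier V. X = N +>\<^bsub>V\<^esub> x)"
  by (auto simp: A_RCOSETS_def')

text \<open>The record defines scalar multiplication as a union over all representatives of a coset.
  Each of them contributes the same coset, so the union collapses.\<close>

lemma quotient_smult:
  assumes "module K V" "submodule N K V" "a \<in> carrier K" "x \<in> carrier V"
  shows "a \<odot>\<^bsub>quotient_module V N\<^esub> (N +>\<^bsub>V\<^esub> x) = N +>\<^bsub>V\<^esub> (a \<odot>\<^bsub>V\<^esub> x)"
proof -
  interpret V: module K V by fact
  interpret N: abelian_subgroup N V using assms submodule_abelian_subgroup by blast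
  have "N +>\<^bsub>V\<^esub> (a \<odot>\<^bsub>V\<^esub> y) = N +>\<^bsub>V\<^esub> (a \<odot>\<^bsub>V\<^esub> x)" if y: "y \<in> N +>\<^bsub>V\<^esub> x" for y
  proof (rule N.a_repr_independence'[symmetric])
    obtain n where n: "n \<in> N" "y = n \<oplus>\<^bsub>V\<^esub> x" using y by (auto simp: a_r_coset_def')
    then have "a \<odot>\<^bsub>V\<^esub> y = a \<odot>\<^bsub>V\<^esub> n \<oplus>\<^bsub>V\<^esub> a \<odot>\<^bsub>V\<^esub> x" "a \<odot>\<^bsub>V\<^esub> n \<in> N"
      using assms submodule.smult_closed[OF assms(2)] by (auto simp: V.smult_r_distr)
    then show "a \<odot>\<^bsub>V\<^esub> y \<in> N +>\<^bsub>V\<^esub> a \<odot>\<^bsub>V\<^esub> x" by (auto simp: a_r_coset_def')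
  qed (use assms in auto)
  moreover have "x \<in> N +>\<^bsub>V\<^esub> x" using assms(4) by (rule N.a_rcos_self)
  ultimately have "(\<Union>y\<in>N +>\<^bsub>V\<^esub> x. N +>\<^bsub>V\<^esub> (a \<odot>\<^bsub>V\<^esub> y)) = N +>\<^bsub>V\<^esub> (a \<odot>\<^bsub>V\<^esub> x)" by blast
  then show ?thesis by (simp add: quotient_module_def)
qed

lemma quotient_add:
  assumes "module K V" "submodule N K V" "x \<in> carrier V" "y \<in> carrier V"
  shows "(N +>\<^bsub>V\<^esub> x) \<oplus>\<^bsub>quotient_module V N\<^esub> (N +>\<^bsub>V\<^esub> y) = N +>\<^bsub>V\<^esub> (x \<oplus>\<^bsub>V\<^esub> y)"
  unfolding quotient_module_simps
  by (rule abelian_subgroup.a_rcos_sum[OF submodule_abelian_subgroup]) fact+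

lemma module_quotient_module:
  assumes "module K V" "submodule N K V"
  shows "module K (quotient_module V N)"
proof -
  interpret V: module K V by fact
  interpret N: abelian_subgroup N V using assms submodule_abelian_subgroup by blast
  \<comment> \<open>The zero of the record is the set \<open>N\<close>; it has to be recognised as
    the coset of zero before the coset rules apply to it.\<close>
  have zero: "N = N +>\<^bsub>V\<^esub> \<zero>\<^bsub>V\<^esub>" by (simp add: N.a_subset)
  show ?thesis
  proof (rule moduleI)
    show "abelian_group (quotient_module V N)"
    proof (rule abelian_groupI)
      fix X Y Z assume XY: "X \<in> carrier (quotient_module V N)" "Y \<in> carrier (quotient_module V N)"
      show "X \<oplus>\<^bsub>quotient_module V N\<^esub> Y \<in> carrier (quotient_module V N)"
        "X \<oplus>\<^bsub>quotient_module V N\<^esub> Y = Y \<oplus>\<^bsub>quotient_module V N\<^esub> X"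
        using XY unfolding quotient_carrier
        by (auto simp: quotient_add[OF assms] V.M.a_comm simp del: quotient_module_simps)
      show "X \<oplus>\<^bsub>quotient_module V N\<^esub> Y \<oplus>\<^bsub>quotient_module V N\<^esub> Z
          = X \<oplus>\<^bsub>quotient_module V N\<^esub> (Y \<oplus>\<^bsub>quotient_module V N\<^esub> Z)"
        if Z: "Z \<in> carrier (quotient_module V N)"
        using XY Z unfolding quotient_carrier
        by (auto simp: quotient_add[OF assms] V.M.a_assoc simp del: quotient_module_simps)
    next
      show "\<zero>\<^bsub>quotient_module V N\<^esub> \<in> carrier (quotient_module V N)"
        unfolding quotient_carrier quotient_module_simps(2) using zero by blast
      show "\<zero>\<^bsub>quotient_module V N\<^esub> \<oplus>\<^bsub>quotient_module V N\<^esub> X = X"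
        if "X \<in> carrier (quotient_module V N)" for X
        using that unfolding quotient_carrier quotient_module_simps(2)
        by (subst zero) (auto simp: quotient_add[OF assms] simp del: quotient_module_simps)
      show "\<exists>Y\<in>carrier (quotient_module V N). Y \<oplus>\<^bsub>quotient_module V N\<^esub> X = \<zero>\<^bsub>quotient_module V N\<^esub>"
        if X: "X \<in> carrier (quotient_module V N)" for X
      proof -
        obtain x where x: "x \<in> carrier V" "X = N +>\<^bsub>V\<^esub> x" using X unfolding quotient_carrier by blast
        then have "(N +>\<^bsub>V\<^esub> (\<ominus>\<^bsub>V\<^esub> x)) \<oplus>\<^bsub>quotient_module V N\<^esub> X = \<zero>\<^bsub>quotient_module V N\<^esub>"
          using zero[symmetric] by (simp add: quotient_add[OF assms] V.M.l_neg del: quotient_module_simps(1,3))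
        moreover have "N +>\<^bsub>V\<^esub> (\<ominus>\<^bsub>V\<^esub> x) \<in> carrier (quotient_module V N)"
          unfolding quotient_carrier using V.M.a_inv_closed[OF x(1)] by blast
        ultimately show ?thesis by (rule bexI)
      qed
    qed
  qed (auto simp: quotient_carrier quotient_add[OF assms] quotient_smult[OF assms]
      V.smult_l_distr V.smult_r_distr V.smult_assoc1 V.R.cring_axioms simp del: quotient_module_simps)
qed

lemma linear_map_quotient:
  assumes "module K V" "submodule N K V"
  shows "linear_map K V (quotient_module V N) (\<lambda>x. N +>\<^bsub>V\<^esub> x)"
  by (rule linear_mapI)
    (auto simp: quotient_carrier quotient_add[OF assms] quotient_smult[OF assms] simp del: quotient_module_simps)

text \<open>Both the tensor product and the tensor powers are of this form.\<close>

definition presented_module :: "'k ring \<Rightarrow> 's set \<Rightarrow> ('s \<Rightarrow> 'k) set \<Rightarrow> ('k, ('s \<Rightarrow> 'k) set) module" where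
  "presented_module K S A = quotient_module (free_module K S) (submodule_span K (free_module K S) A)"

definition presented_gen :: "'k ring \<Rightarrow> 's set \<Rightarrow> ('s \<Rightarrow> 'k) set \<Rightarrow> 's \<Rightarrow> ('s \<Rightarrow> 'k) set" where
  "presented_gen K S A s =
     submodule_span K (free_module K S) A +>\<^bsub>free_module K S\<^esub> free_gen K s"

context
  fixes K :: "'k ring" and S :: "'s set" and A :: "('s \<Rightarrow> 'k) set"
  assumes K: "cring K" and A: "A \<subseteq> carrier (free_module K S)"
begin

interpretation F: module K "free_module K S" using K by (rule module_free_module)

lemma span_submodule: "submodule (submodule_span K (free_module K S) A) K (free_module K S)"
  using F.module_axioms A by (rule submodule_submodule_span)

lemma module_presented_module: "module K (presented_module K S A)"
  unfolding presented_module_def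
  by (rule module_quotient_module[OF F.module_axioms span_submodule])

lemma presented_gen_in: "s \<in> S \<Longrightarrow> presented_gen K S A s \<in> carrier (presented_module K S A)"
  unfolding presented_module_def presented_gen_def using K
  by (auto simp: quotient_carrier simp del: quotient_module_simps)

lemma linear_map_presented:
  "linear_map K (free_module K S) (presented_module K S A)
     (\<lambda>f. submodule_span K (free_module K S) A +>\<^bsub>free_module K S\<^esub> f)"
  unfolding presented_module_def
  by (rule linear_map_quotient[OF F.module_axioms span_submodule])

lemma presented_relator:
  assumes "r \<in> A"
  shows "submodule_span K (free_module K S) A +>\<^bsub>free_module K S\<^esub> r = \<zero>\<^bsub>presented_module K S A\<^esub>"
  unfolding presented_module_def quotient_module_simps
  using assms submodule_span_superset[of A] submodule.axioms(1)[OF span_submodule] A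
  by (intro F.M.a_coset_join2) auto

text \<open>Both maps are pulled back along the quotient map to the free module, where their
  equaliser is a submodule containing all free generators.\<close>

lemma presented_module_agree:
  assumes "module K W" "linear_map K (presented_module K S A) W f"
    "linear_map K (presented_module K S A) W g"
    "\<And>s. s \<in> S \<Longrightarrow> f (presented_gen K S A s) = g (presented_gen K S A s)"
    "X \<in> carrier (presented_module K S A)"
  shows "f X = g X"
proof -
  let ?p = "\<lambda>f. submodule_span K (free_module K S) A +>\<^bsub>free_module K S\<^esub> f"
  obtain x where x: "x \<in> carrier (free_module K S)" "X = ?p x"
    using assms(5) unfolding presented_module_def quotient_carrier by blast
  have "x \<in> {x \<in> carrier (free_module K S). f (?p x) = g (?p x)}"
    by (rule free_module_span[OF K _ _ x(1)],
        rule submodule_equalizer[OF F.module_axioms assms(1)])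
      (use assms(4) K in \<open>auto simp: presented_gen_def intro: linear_map_comp[OF linear_map_presented] assms\<close>)
  then show ?thesis using x by simp
qed

context
  fixes W :: "('k, 'b) module" and g :: "'s \<Rightarrow> 'b"
  assumes W: "module K W" and g: "\<And>s. s \<in> S \<Longrightarrow> g s \<in> carrier W"
    and kill: "\<And>r. r \<in> A \<Longrightarrow> free_ext K W g r = \<zero>\<^bsub>W\<^esub>"
begin

interpretation W: module K W by (rule W)

text \<open>Here the choice in \<open>linear_ext\<close> becomes harmless: the kernel of
  \<open>free_ext\<close> contains the relators, hence their span, so \<open>free_ext\<close> is
  constant on each coset.\<close>

lemma linear_ext_coset:
  assumes f: "f \<in> carrier (free_module K S)"
  shows "linear_ext K W g (submodule_span K (free_module K S) A +>\<^bsub>free_module K S\<^esub> f) = free_ext K W g f"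
proof -
  let ?N = "submodule_span K (free_module K S) A"
  interpret N: abelian_subgroup ?N "free_module K S"
    using F.module_axioms span_submodule by (rule submodule_abelian_subgroup)
  note lin = linear_map_free_ext[where S=S, OF W g]
  have N: "?N \<subseteq> {f \<in> carrier (free_module K S). free_ext K W g f = \<zero>\<^bsub>W\<^esub>}"
    by (rule submodule_span_least[OF submodule_kernel[OF F.module_axioms W lin]])
      (use A kill in auto)
  have "free_ext K W g h = free_ext K W g f" if h: "h \<in> ?N +>\<^bsub>free_module K S\<^esub> f" for h
  proof -
    obtain n where n: "n \<in> ?N" "h = n \<oplus>\<^bsub>free_module K S\<^esub> f" using h by (auto simp: a_r_coset_def' simp del: free_module_simps)
    show ?thesis
      unfolding n(2) using linear_map_add[OF lin _ f, where x=n] N n(1) linear_map_closed[OF lin f]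
      by (auto simp del: free_module_simps)
  qed
  moreover have "(SOME h. h \<in> ?N +>\<^bsub>free_module K S\<^esub> f) \<in> ?N +>\<^bsub>free_module K S\<^esub> f"
    using N.a_rcos_self[OF f] some_in_eq by blast
  ultimately show ?thesis unfolding linear_ext_def free_ext_def Let_def by simp
qed

lemma linear_ext_presented_gen: "s \<in> S \<Longrightarrow> linear_ext K W g (presented_gen K S A s) = g s"
  unfolding presented_gen_def using K by (simp add: linear_ext_coset free_ext_gen W g)

lemma linear_map_linear_ext: "linear_map K (presented_module K S A) W (linear_ext K W g)"
proof (rule linear_mapI)
  note lin = linear_map_free_ext[where S=S, OF W g]
  note N = span_submodule
  fix X assume "X \<in> carrier (presented_module K S A)"
  then obtain x where x: "x \<in> carrier (free_module K S)"
    "X = submodule_span K (free_module K S) A +>\<^bsub>free_module K S\<^esub> x"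
    unfolding presented_module_def quotient_carrier by blast
  then show "linear_ext K W g X \<in> carrier W"
    using linear_map_closed[OF lin] by (simp add: linear_ext_coset)
  show "linear_ext K W g (X \<oplus>\<^bsub>presented_module K S A\<^esub> Y) = linear_ext K W g X \<oplus>\<^bsub>W\<^esub> linear_ext K W g Y"
    if Y: "Y \<in> carrier (presented_module K S A)" for Y
  proof -
    obtain y where y: "y \<in> carrier (free_module K S)"
      "Y = submodule_span K (free_module K S) A +>\<^bsub>free_module K S\<^esub> y"
      using Y unfolding presented_module_def quotient_carrier by blast
    show ?thesis
      using x(1) y(1) F.M.a_closed[OF x(1) y(1)]
      unfolding x(2) y(2) presented_module_def quotient_add[OF F.module_axioms N x(1) y(1)]
      by (simp add: linear_ext_coset linear_map_add[OF lin, simplified])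
  qed
  show "linear_ext K W g (a \<odot>\<^bsub>presented_module K S A\<^esub> X) = a \<odot>\<^bsub>W\<^esub> linear_ext K W g X"
    if a: "a \<in> carrier K" for a
    using x(1) F.smult_closed[OF a x(1)] a
    unfolding x(2) presented_module_def quotient_smult[OF F.module_axioms N a x(1)]
    by (simp add: linear_ext_coset linear_map_smult[OF lin, simplified])
qed

end

end

section \<open>Tensor products and tensor powers\<close>

lemma (in abelian_group) diff_eq_zero_iff:
  assumes "x \<in> carrier G" "y \<in> carrier G"
  shows "x \<ominus> y = \<zero> \<longleftrightarrow> x = y"
proof
  assume "x \<ominus> y = \<zero>"
  then have "\<ominus> (\<ominus> y) = x" using assms by (intro minus_equality) (auto simp: a_minus_def)
  then show "x = y" using assms by simp
qed (use assms in \<open>simp add: a_minus_def r_neg\<close>)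

text \<open>The left side has the shape of an additivity relator. The equivalence is used in both
  directions: a relator that dies in the quotient yields additivity of the generators, and
  additivity of \<open>g\<close> makes its extension kill the relator.\<close>

lemma (in abelian_group) diff_diff_eq_zero_iff:
  assumes "x \<in> carrier G" "y \<in> carrier G" "z \<in> carrier G"
  shows "x \<ominus> y \<ominus> z = \<zero> \<longleftrightarrow> x = y \<oplus> z"
proof -
  have "x \<ominus> y \<ominus> z = x \<ominus> (y \<oplus> z)"
    using assms by (simp add: a_minus_def minus_add a_assoc)
  then show ?thesis using assms by (simp add: diff_eq_zero_iff)
qed

lemma tensor_presented: "tensor K V W = presented_module K (carrier V \<times> carrier W) (tensor_relators K V W)"
  by (simp add: tensor_def presented_module_def Let_def)

lemma pure_tensor_presented:
  "pure_tensor K V W v w = presented_gen K (carrier V \<times> carrier W) (tensor_relators K V W) (v, w)"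
  by (simp add: pure_tensor_def presented_gen_def Let_def)

context
  fixes K :: "'k ring" and V :: "('k, 'a) module" and W :: "('k, 'b) module"
  assumes V: "module K V" and W: "module K W"
begin

interpretation V: module K V by (rule V)
interpretation W: module K W by (rule W)

interpretation F: module K "free_module K (carrier V \<times> carrier W)"
  using V.R.cring_axioms by (rule module_free_module)

lemma free_gen_pair [simp]:
  "v \<in> carrier V \<Longrightarrow> w \<in> carrier W \<Longrightarrow>
     free_gen K (v, w) \<in> carrier (free_module K (carrier V \<times> carrier W))"
  using V.R.cring_axioms by auto

lemma tensor_relatorsI:
  defines "F \<equiv> free_module K (carrier V \<times> carrier W)"
  shows "x \<in> carrier V \<Longrightarrow> x' \<in> carrier V \<Longrightarrow> y \<in> carrier W \<Longrightarrow>
      free_gen K (x \<oplus>\<^bsub>V\<^esub> x', y) \<ominus>\<^bsub>F\<^esub> free_gen K (x, y) \<ominus>\<^bsub>F\<^esub> free_gen K (x', y) \<in> tensor_relators K V W"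
    and "x \<in> carrier V \<Longrightarrow> y \<in> carrier W \<Longrightarrow> y' \<in> carrier W \<Longrightarrow>
      free_gen K (x, y \<oplus>\<^bsub>W\<^esub> y') \<ominus>\<^bsub>F\<^esub> free_gen K (x, y) \<ominus>\<^bsub>F\<^esub> free_gen K (x, y') \<in> tensor_relators K V W"
    and "a \<in> carrier K \<Longrightarrow> x \<in> carrier V \<Longrightarrow> y \<in> carrier W \<Longrightarrow>
      free_gen K (a \<odot>\<^bsub>V\<^esub> x, y) \<ominus>\<^bsub>F\<^esub> a \<odot>\<^bsub>F\<^esub> free_gen K (x, y) \<in> tensor_relators K V W"
    and "a \<in> carrier K \<Longrightarrow> x \<in> carrier V \<Longrightarrow> y \<in> carrier W \<Longrightarrow>
      free_gen K (x, a \<odot>\<^bsub>W\<^esub> y) \<ominus>\<^bsub>F\<^esub> a \<odot>\<^bsub>F\<^esub> free_gen K (x, y) \<in> tensor_relators K V W"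
  unfolding tensor_relators_def Let_def F_def by blast+

lemma tensor_relators_carrier:
  "tensor_relators K V W \<subseteq> carrier (free_module K (carrier V \<times> carrier W))"
  unfolding tensor_relators_def Let_def
  by (intro Un_least subsetI) (auto simp del: free_module_simps)

lemmas tensor_facts = V.R.cring_axioms tensor_relators_carrier

lemma module_tensor: "module K (tensor K V W)"
  unfolding tensor_presented using tensor_facts by (rule module_presented_module)

lemma pure_tensor_closed:
  "v \<in> carrier V \<Longrightarrow> w \<in> carrier W \<Longrightarrow> pure_tensor K V W v w \<in> carrier (tensor K V W)"
  unfolding tensor_presented pure_tensor_presented
  by (rule presented_gen_in[OF tensor_facts]) auto

text \<open>Relators become zero in the quotient and the quotient map is linear; reading off the two
  shapes of relator, three-term and two-term, gives additivity and homogeneity in either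
  argument.\<close>

lemma bilinear_pure_tensor: "bilinear_map K V W (tensor K V W) (pure_tensor K V W)"
proof -
  let ?F = "free_module K (carrier V \<times> carrier W)"
  let ?p = "\<lambda>f. submodule_span K ?F (tensor_relators K V W) +>\<^bsub>?F\<^esub> f"
  interpret T: module K "tensor K V W" by (rule module_tensor)
  have lin: "linear_map K ?F (tensor K V W) ?p"
    unfolding tensor_presented by (rule linear_map_presented[OF tensor_facts])
  have p: "?p (free_gen K (v, w)) = pure_tensor K V W v w" for v w
    by (simp add: pure_tensor_def Let_def)
  have zero: "?p r = \<zero>\<^bsub>tensor K V W\<^esub>" if "r \<in> tensor_relators K V W" for r
    unfolding tensor_presented by (rule presented_relator[OF tensor_facts that])
  have three: "pure_tensor K V W v w = pure_tensor K V W v' w' \<oplus>\<^bsub>tensor K V W\<^esub> pure_tensor K V W v'' w''"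
    if "free_gen K (v, w) \<ominus>\<^bsub>?F\<^esub> free_gen K (v', w') \<ominus>\<^bsub>?F\<^esub> free_gen K (v'', w'') \<in> tensor_relators K V W"
      "v \<in> carrier V" "v' \<in> carrier V" "v'' \<in> carrier V" "w \<in> carrier W" "w' \<in> carrier W" "w'' \<in> carrier W"
    for v v' v'' w w' w''
    using zero[OF that(1)] that(2-)
    by (simp add: linear_map_diff[OF F.module_axioms module_tensor lin] p pure_tensor_closed
        T.M.diff_diff_eq_zero_iff del: free_module_simps)
  have two: "pure_tensor K V W v w = a \<odot>\<^bsub>tensor K V W\<^esub> pure_tensor K V W v' w'"
    if "free_gen K (v, w) \<ominus>\<^bsub>?F\<^esub> a \<odot>\<^bsub>?F\<^esub> free_gen K (v', w') \<in> tensor_relators K V W"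
      "a \<in> carrier K" "v \<in> carrier V" "v' \<in> carrier V" "w \<in> carrier W" "w' \<in> carrier W"
    for v v' w w' a
    using zero[OF that(1)] that(2-)
    by (simp add: linear_map_diff[OF F.module_axioms module_tensor lin] p pure_tensor_closed
        linear_map_smult[OF lin] T.M.diff_eq_zero_iff del: free_module_simps)
  show ?thesis
    by (intro bilinear_mapI linear_mapI pure_tensor_closed three two tensor_relatorsI; simp)
qed

lemma tensor_agree:
  assumes "module K U" "linear_map K (tensor K V W) U f" "linear_map K (tensor K V W) U g"
    "\<And>v w. v \<in> carrier V \<Longrightarrow> w \<in> carrier W \<Longrightarrow> f (pure_tensor K V W v w) = g (pure_tensor K V W v w)"
    "X \<in> carrier (tensor K V W)"
  shows "f X = g X"
proof (rule presented_module_agree[OF tensor_facts assms(1), folded tensor_presented, OF assms(2,3) _ assms(5)])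
  fix s assume "s \<in> carrier V \<times> carrier W"
  then show "f (presented_gen K (carrier V \<times> carrier W) (tensor_relators K V W) s) =
      g (presented_gen K (carrier V \<times> carrier W) (tensor_relators K V W) s)"
    using assms(4) unfolding pure_tensor_presented by auto
qed

context
  fixes U :: "('k, 'c) module" and g :: "'a \<times> 'b \<Rightarrow> 'c"
  assumes U: "module K U" and g: "bilinear_map K V W U (\<lambda>v w. g (v, w))"
begin

interpretation U: module K U by (rule U)

text \<open>The converse of the bilinearity of pure tensors: bilinearity of \<open>g\<close> is what
  makes its extension vanish on every relator.\<close>

lemma tensor_relators_killed:
  assumes "r \<in> tensor_relators K V W"
  shows "free_ext K U g r = \<zero>\<^bsub>U\<^esub>"
proof -
  let ?F = "free_module K (carrier V \<times> carrier W)"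
  have cl: "g (v, w) \<in> carrier U" if "v \<in> carrier V" "w \<in> carrier W" for v w
    using bilinear_map_closed[OF g that] .
  then have lin: "linear_map K ?F U (free_ext K U g)"
    by (intro linear_map_free_ext U) auto
  have gen: "free_ext K U g (free_gen K (v, w)) = g (v, w)" if "v \<in> carrier V" "w \<in> carrier W" for v w
    using cl[OF that] by (rule free_ext_gen[OF U])
  note l = bilinear_map_left[OF g] and r = bilinear_map_right[OF g]
  \<comment> \<open>The first alternative must solve its goal completely and disposes of the
    additivity relators; the second handles the scalar ones.\<close>
  from assms show ?thesis unfolding tensor_relators_def Let_def
    by (elim UnE CollectE exE conjE)
      ((simp add: linear_map_diff[OF F.module_axioms U lin] gen cl linear_map_add[OF l] linear_map_add[OF r]
          U.M.diff_diff_eq_zero_iff del: free_module_simps; fail) |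
       simp add: linear_map_diff[OF F.module_axioms U lin] linear_map_smult[OF lin] gen cl
        linear_map_smult[OF l] linear_map_smult[OF r] U.M.diff_eq_zero_iff del: free_module_simps)+
qed

lemma linear_map_tensor_ext: "linear_map K (tensor K V W) U (linear_ext K U g)"
  unfolding tensor_presented
  using bilinear_map_closed[OF g] tensor_relators_killed
  by (intro linear_map_linear_ext[OF tensor_facts U]) auto

lemma tensor_ext_pure:
  "v \<in> carrier V \<Longrightarrow> w \<in> carrier W \<Longrightarrow> linear_ext K U g (pure_tensor K V W v w) = g (v, w)"
  unfolding pure_tensor_presented
  using bilinear_map_closed[OF g] tensor_relators_killed
  by (intro linear_ext_presented_gen[OF tensor_facts U]) auto

end

end

context
  fixes K :: "'k ring" and V :: "('k, 'a) module" and W :: "('k, 'b) module"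
    and V' :: "('k, 'c) module" and W' :: "('k, 'd) module"
    and f :: "'a \<Rightarrow> 'c" and g :: "'b \<Rightarrow> 'd"
  assumes mods: "module K V" "module K W" "module K V'" "module K W'"
    and lins: "linear_map K V V' f" "linear_map K W W' g"
begin

lemma bilinear_tensor_map:
  "bilinear_map K V W (tensor K V' W') (\<lambda>v w. (\<lambda>(v, w). pure_tensor K V' W' (f v) (g w)) (v, w))"
  unfolding prod.case by (rule bilinear_map_comp[OF bilinear_pure_tensor[OF mods(3,4)] lins])

lemma linear_tensor_map: "linear_map K (tensor K V W) (tensor K V' W') (tensor_map K V' W' f g)"
  unfolding tensor_map_def
  by (rule linear_map_tensor_ext[OF mods(1,2) module_tensor[OF mods(3,4)] bilinear_tensor_map])

lemma tensor_map_pure: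
  "v \<in> carrier V \<Longrightarrow> w \<in> carrier W \<Longrightarrow>
     tensor_map K V' W' f g (pure_tensor K V W v w) = pure_tensor K V' W' (f v) (g w)"
  unfolding tensor_map_def
  by (simp add: tensor_ext_pure[OF mods(1,2) module_tensor[OF mods(3,4)] bilinear_tensor_map])

end

text \<open>One function covers words of every length and nothing relates its values at different
  lengths, so it is exactly the data for a linear map out of the whole tensor coalgebra. At the
  empty word only closure is demanded.\<close>

definition multilinear_map :: "'k ring \<Rightarrow> ('k, 'v) module \<Rightarrow> ('k, 'b) module \<Rightarrow> ('v list \<Rightarrow> 'b) \<Rightarrow> bool" where
  "multilinear_map K R W g \<longleftrightarrow>
     (\<forall>xs. set xs \<subseteq> carrier R \<longrightarrow> g xs \<in> carrier W) \<and>
     (\<forall>us ws. set us \<subseteq> carrier R \<longrightarrow> set ws \<subseteq> carrier R \<longrightarrow> linear_map K R W (\<lambda>x. g (us @ [x] @ ws)))"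

lemma multilinear_map_closed:
  "multilinear_map K R W g \<Longrightarrow> set xs \<subseteq> carrier R \<Longrightarrow> g xs \<in> carrier W"
  by (simp add: multilinear_map_def)

lemma multilinear_map_slot:
  "multilinear_map K R W g \<Longrightarrow> set us \<subseteq> carrier R \<Longrightarrow> set ws \<subseteq> carrier R \<Longrightarrow>
     linear_map K R W (\<lambda>x. g (us @ [x] @ ws))"
  by (simp add: multilinear_map_def)

lemma multilinear_mapI:
  assumes "\<And>xs. set xs \<subseteq> carrier R \<Longrightarrow> g xs \<in> carrier W"
    "\<And>us ws. set us \<subseteq> carrier R \<Longrightarrow> set ws \<subseteq> carrier R \<Longrightarrow> linear_map K R W (\<lambda>x. g (us @ [x] @ ws))"
  shows "multilinear_map K R W g"
  using assms by (auto simp: multilinear_map_def)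

lemma multilinear_map_comp:
  "multilinear_map K R W g \<Longrightarrow> linear_map K W U f \<Longrightarrow> multilinear_map K R U (\<lambda>xs. f (g xs))"
  by (rule multilinear_mapI, rule linear_map_closed, assumption, rule multilinear_map_closed, assumption+,
      rule linear_map_comp[OF multilinear_map_slot])

lemma multilinear_map_sum:
  assumes "module K W" "\<And>i. i \<in> A \<Longrightarrow> multilinear_map K R W (g i)"
  shows "multilinear_map K R W (\<lambda>xs. finsum W (\<lambda>i. g i xs) A)"
proof -
  interpret W: module K W by fact
  show ?thesis
    by (intro multilinear_mapI linear_map_sum[OF assms(1)] W.M.finsum_in
        multilinear_map_slot[OF assms(2)] multilinear_map_closed[OF assms(2)])
qed

text \<open>The range of the summation may depend on the length of the word, but is constant in each slot.\<close>

lemma multilinear_map_length_sum: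
  assumes "module K W" "\<And>n i. i \<in> A n \<Longrightarrow> multilinear_map K R W (g n i)"
  shows "multilinear_map K R W (\<lambda>xs. finsum W (\<lambda>i. g (length xs) i xs) (A (length xs)))"
proof (rule multilinear_mapI)
  have *: "multilinear_map K R W (\<lambda>xs. finsum W (\<lambda>i. g n i xs) (A n))" for n
    using assms by (rule multilinear_map_sum)
  show "finsum W (\<lambda>i. g (length xs) i xs) (A (length xs)) \<in> carrier W" if "set xs \<subseteq> carrier R" for xs
    using * that by (rule multilinear_map_closed)
  show "linear_map K R W (\<lambda>x. finsum W (\<lambda>i. g (length (us @ [x] @ ws)) i (us @ [x] @ ws)) (A (length (us @ [x] @ ws))))"
    if "set us \<subseteq> carrier R" "set ws \<subseteq> carrier R" for us ws
    using multilinear_map_slot[OF * that, of "length us + Suc (length ws)"] by simp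
qed

text \<open>A single slot lies entirely before or entirely behind a fixed cut, so multilinearity in
  each half separately is enough.\<close>

lemma multilinear_map_split:
  assumes "\<And>xs. set xs \<subseteq> carrier R \<Longrightarrow> multilinear_map K R W (b xs)"
    "\<And>ys. set ys \<subseteq> carrier R \<Longrightarrow> multilinear_map K R W (\<lambda>xs. b xs ys)"
  shows "multilinear_map K R W (\<lambda>w. b (take i w) (drop i w))"
proof (rule multilinear_mapI)
  have sub: "set (take i w) \<subseteq> carrier R" "set (drop i w) \<subseteq> carrier R"
    if "set w \<subseteq> carrier R" for w i
    using that set_take_subset set_drop_subset by fastforce+
  show "b (take i w) (drop i w) \<in> carrier W" if "set w \<subseteq> carrier R" for w
    using multilinear_map_closed[OF assms(1)] sub that by blast
  fix us ws assume s: "set us \<subseteq> carrier R" "set ws \<subseteq> carrier R"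
  show "linear_map K R W (\<lambda>x. b (take i (us @ [x] @ ws)) (drop i (us @ [x] @ ws)))"
  proof (cases "i \<le> length us")
    case True
    then show ?thesis
      using multilinear_map_slot[OF assms(1)[OF sub(1)[OF s(1)]] sub(2)[OF s(1)] s(2), of i i] by simp
  next
    case False
    \<comment> \<open>The cut falls behind the slot, which stays in the left part together with the
      first \<open>j\<close> letters of \<open>ws\<close>.\<close>
    then obtain j where "i - length us = Suc j" by (metis Suc_diff_Suc linorder_not_le)
    then show ?thesis
      using multilinear_map_slot[OF assms(2)[OF sub(2)[OF s(2)]] s(1) sub(1)[OF s(2)], of j j] False by simp
  qed
qed

section \<open>Tensor powers as presented modules\<close>

lemma tensor_power_presented: "tensor_power K R n = presented_module K (words R n) (power_relators K R n)"
  by (simp add: tensor_power_def presented_module_def Let_def)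

lemma pure_word_presented:
  "pure_word K R xs = presented_gen K (words R (length xs)) (power_relators K R (length xs)) xs"
  by (simp add: pure_word_def presented_gen_def Let_def)

context
  fixes K :: "'k ring" and R :: "('k, 'v) module"
  assumes R: "module K R"
begin

interpretation R: module K R by (rule R)

interpretation F: module K "free_module K (words R n)" for n
  using R.R.cring_axioms by (rule module_free_module)

lemma free_gen_word [simp]:
  "xs \<in> words R n \<Longrightarrow> free_gen K xs \<in> carrier (free_module K (words R n))"
  using R.R.cring_axioms by auto

lemma power_relatorsI:
  defines "F \<equiv> \<lambda>n. free_module K (words R n)"
  shows "x \<in> carrier R \<Longrightarrow> y \<in> carrier R \<Longrightarrow> set us \<subseteq> carrier R \<Longrightarrow> set ws \<subseteq> carrier R \<Longrightarrow>
      length us + 1 + length ws = n \<Longrightarrow>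
      free_gen K (us @ [x \<oplus>\<^bsub>R\<^esub> y] @ ws) \<ominus>\<^bsub>F n\<^esub> free_gen K (us @ [x] @ ws) \<ominus>\<^bsub>F n\<^esub> free_gen K (us @ [y] @ ws)
        \<in> power_relators K R n"
    and "a \<in> carrier K \<Longrightarrow> x \<in> carrier R \<Longrightarrow> set us \<subseteq> carrier R \<Longrightarrow> set ws \<subseteq> carrier R \<Longrightarrow>
      length us + 1 + length ws = n \<Longrightarrow>
      free_gen K (us @ [a \<odot>\<^bsub>R\<^esub> x] @ ws) \<ominus>\<^bsub>F n\<^esub> a \<odot>\<^bsub>F n\<^esub> free_gen K (us @ [x] @ ws) \<in> power_relators K R n"
  unfolding power_relators_def Let_def F_def by blast+

lemma power_relators_carrier: "power_relators K R n \<subseteq> carrier (free_module K (words R n))"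
  unfolding power_relators_def Let_def
  by (intro Un_least subsetI; elim CollectE exE conjE; hypsubst;
      intro F.M.minus_closed F.smult_closed free_gen_word) (auto simp: words_def)

lemmas power_facts = R.R.cring_axioms power_relators_carrier

lemma module_tensor_power: "module K (tensor_power K R n)"
  unfolding tensor_power_presented using power_facts by (rule module_presented_module)

lemma pure_word_closed:
  "xs \<in> words R n \<Longrightarrow> pure_word K R xs \<in> carrier (tensor_power K R n)"
  unfolding tensor_power_presented pure_word_presented
  using presented_gen_in[OF power_facts, of xs n] by (simp add: words_def)

text \<open>As for two-fold tensors, the vanishing of the relators is read as linearity, here in the
  slot between \<open>us\<close> and \<open>ws\<close>.\<close>

lemma linear_map_pure_word:
  assumes us: "set us \<subseteq> carrier R" and ws: "set ws \<subseteq> carrier R" and n: "length us + 1 + length ws = n"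
  shows "linear_map K R (tensor_power K R n) (\<lambda>x. pure_word K R (us @ [x] @ ws))"
proof -
  let ?F = "free_module K (words R n)"
  let ?p = "\<lambda>f. submodule_span K ?F (power_relators K R n) +>\<^bsub>?F\<^esub> f"
  interpret T: module K "tensor_power K R n" by (rule module_tensor_power)
  have lin: "linear_map K ?F (tensor_power K R n) ?p"
    unfolding tensor_power_presented by (rule linear_map_presented[OF power_facts])
  have w: "us @ [x] @ ws \<in> words R n" if "x \<in> carrier R" for x
    using assms that by (auto simp: words_def)
  have p: "?p (free_gen K xs) = pure_word K R xs" if "xs \<in> words R n" for xs
    using that by (simp add: pure_word_def words_def Let_def)
  have zero: "?p r = \<zero>\<^bsub>tensor_power K R n\<^esub>" if "r \<in> power_relators K R n" for r
    unfolding tensor_power_presented by (rule presented_relator[OF power_facts that])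
  have three: "pure_word K R x = pure_word K R x' \<oplus>\<^bsub>tensor_power K R n\<^esub> pure_word K R x''"
    if "free_gen K x \<ominus>\<^bsub>?F\<^esub> free_gen K x' \<ominus>\<^bsub>?F\<^esub> free_gen K x'' \<in> power_relators K R n"
      "x \<in> words R n" "x' \<in> words R n" "x'' \<in> words R n"
    for x x' x''
    using zero[OF that(1)] that(2-)
    by (simp add: linear_map_diff[OF F.module_axioms module_tensor_power lin] p pure_word_closed
        T.M.diff_diff_eq_zero_iff del: free_module_simps)
  have two: "pure_word K R x = a \<odot>\<^bsub>tensor_power K R n\<^esub> pure_word K R x'"
    if "free_gen K x \<ominus>\<^bsub>?F\<^esub> a \<odot>\<^bsub>?F\<^esub> free_gen K x' \<in> power_relators K R n"
      "a \<in> carrier K" "x \<in> words R n" "x' \<in> words R n" for x x' a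
    using zero[OF that(1)] that(2-)
    by (simp add: linear_map_diff[OF F.module_axioms module_tensor_power lin] p pure_word_closed
        linear_map_smult[OF lin] T.M.diff_eq_zero_iff del: free_module_simps)
  show ?thesis
  proof (rule linear_mapI)
    fix x y assume xy: "x \<in> carrier R" "y \<in> carrier R"
    show "pure_word K R (us @ [x \<oplus>\<^bsub>R\<^esub> y] @ ws)
        = pure_word K R (us @ [x] @ ws) \<oplus>\<^bsub>tensor_power K R n\<^esub> pure_word K R (us @ [y] @ ws)"
      by (rule three[OF power_relatorsI(1)]) (use assms xy in \<open>auto simp: words_def\<close>)
  next
    fix a x assume ax: "a \<in> carrier K" "x \<in> carrier R"
    show "pure_word K R (us @ [a \<odot>\<^bsub>R\<^esub> x] @ ws) = a \<odot>\<^bsub>tensor_power K R n\<^esub> pure_word K R (us @ [x] @ ws)"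
      by (rule two[OF power_relatorsI(2)]) (use assms ax in \<open>auto simp: words_def\<close>)
  qed (rule pure_word_closed[OF w])
qed

lemma tensor_power_agree:
  assumes "module K U" "linear_map K (tensor_power K R n) U f" "linear_map K (tensor_power K R n) U g"
    "\<And>xs. xs \<in> words R n \<Longrightarrow> f (pure_word K R xs) = g (pure_word K R xs)"
    "X \<in> carrier (tensor_power K R n)"
  shows "f X = g X"
proof (rule presented_module_agree[OF power_facts assms(1), folded tensor_power_presented, OF assms(2,3) _ assms(5)])
  fix xs assume xs: "xs \<in> words R n"
  then have "length xs = n" by (simp add: words_def)
  then show "f (presented_gen K (words R n) (power_relators K R n) xs) =
      g (presented_gen K (words R n) (power_relators K R n) xs)"
    using assms(4)[OF xs] unfolding pure_word_presented by simp
qed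

context
  fixes W :: "('k, 'c) module" and g :: "'v list \<Rightarrow> 'c"
  assumes W: "module K W" and g: "multilinear_map K R W g"
begin

interpretation W: module K W by (rule W)

lemma power_relators_killed:
  assumes "r \<in> power_relators K R n"
  shows "free_ext K W g r = \<zero>\<^bsub>W\<^esub>"
proof -
  let ?F = "free_module K (words R n)"
  have cl: "g xs \<in> carrier W" if "xs \<in> words R n" for xs
    using multilinear_map_closed[OF g] that by (auto simp: words_def)
  then have lin: "linear_map K ?F W (free_ext K W g)"
    by (intro linear_map_free_ext W) auto
  have gen: "free_ext K W g (free_gen K xs) = g xs" if "xs \<in> words R n" for xs
    using cl[OF that] by (rule free_ext_gen[OF W])
  have wI: "us @ [x] @ ws \<in> words R n" if "set us \<subseteq> carrier R" "set ws \<subseteq> carrier R" "x \<in> carrier R"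
    "length us + 1 + length ws = n" for us x ws
    using that by (auto simp: words_def)
  note s = multilinear_map_slot[OF g]
  from assms consider
      (add) us x y ws where "r = free_gen K (us @ [x \<oplus>\<^bsub>R\<^esub> y] @ ws) \<ominus>\<^bsub>?F\<^esub> free_gen K (us @ [x] @ ws)
          \<ominus>\<^bsub>?F\<^esub> free_gen K (us @ [y] @ ws)"
        "x \<in> carrier R" "y \<in> carrier R" "set us \<subseteq> carrier R" "set ws \<subseteq> carrier R" "length us + 1 + length ws = n"
    | (smult) us a x ws where "r = free_gen K (us @ [a \<odot>\<^bsub>R\<^esub> x] @ ws) \<ominus>\<^bsub>?F\<^esub> a \<odot>\<^bsub>?F\<^esub> free_gen K (us @ [x] @ ws)"
        "a \<in> carrier K" "x \<in> carrier R" "set us \<subseteq> carrier R" "set ws \<subseteq> carrier R" "length us + 1 + length ws = n"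
    unfolding power_relators_def Let_def by blast
  then show ?thesis
  proof cases
    case add
    note w = wI[OF add(4,5) _ add(6)]
    show ?thesis unfolding add(1)
      using w[OF add(2)] w[OF add(3)] w[of "x \<oplus>\<^bsub>R\<^esub> y"] add linear_map_add[OF s[OF add(4,5)] add(2,3)]
      by (simp add: linear_map_diff[OF F.module_axioms W lin] gen cl W.M.diff_diff_eq_zero_iff
          del: free_module_simps append.simps)
  next
    case smult
    note w = wI[OF smult(4,5) _ smult(6)]
    show ?thesis unfolding smult(1)
      using w[OF smult(3)] w[of "a \<odot>\<^bsub>R\<^esub> x"] smult linear_map_smult[OF s[OF smult(4,5)] smult(2,3)]
      by (simp add: linear_map_diff[OF F.module_axioms W lin] linear_map_smult[OF lin] gen cl
          W.M.diff_eq_zero_iff del: free_module_simps append.simps)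
  qed
qed

lemma linear_map_power_ext: "linear_map K (tensor_power K R n) W (linear_ext K W g)"
  unfolding tensor_power_presented
  using multilinear_map_closed[OF g] power_relators_killed
  by (intro linear_map_linear_ext[OF power_facts W]) (auto simp: words_def)

lemma power_ext_word: "set xs \<subseteq> carrier R \<Longrightarrow> linear_ext K W g (pure_word K R xs) = g xs"
  unfolding pure_word_presented
  using multilinear_map_closed[OF g] power_relators_killed
  by (intro linear_ext_presented_gen[OF power_facts W]) (auto simp: words_def)

end

end

section \<open>The tensor coalgebra as a graded space\<close>

lemma direct_sum_simps [simp]:
  "zero (direct_sum V) = (\<lambda>n. \<zero>\<^bsub>V n\<^esub>)"
  "add (direct_sum V) = (\<lambda>s t n. s n \<oplus>\<^bsub>V n\<^esub> t n)"
  "smult (direct_sum V) = (\<lambda>a t n. a \<odot>\<^bsub>V n\<^esub> t n)"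
  by (auto simp: direct_sum_def)

lemma direct_sum_carrier:
  "t \<in> carrier (direct_sum V) \<longleftrightarrow> (\<forall>n. t n \<in> carrier (V n)) \<and> finite {n. t n \<noteq> \<zero>\<^bsub>V n\<^esub>}"
  by (auto simp: direct_sum_def)

definition direct_sum_inj :: "(nat \<Rightarrow> ('k, 'a) module) \<Rightarrow> nat \<Rightarrow> 'a \<Rightarrow> nat \<Rightarrow> 'a" where
  "direct_sum_inj V n x = (\<lambda>m. if m = n then x else \<zero>\<^bsub>V m\<^esub>)"

context
  fixes K :: "'k ring" and V :: "nat \<Rightarrow> ('k, 'a) module"
  assumes V: "\<And>n. module K (V n)"
begin

interpretation V: module K "V n" for n by (rule V)

lemma module_direct_sum: "module K (direct_sum V)"
proof (rule moduleI)
  show "abelian_group (direct_sum V)"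
  proof (rule abelian_groupI)
    fix s t assume st: "s \<in> carrier (direct_sum V)" "t \<in> carrier (direct_sum V)"
    have "{n. s n \<oplus>\<^bsub>V n\<^esub> t n \<noteq> \<zero>\<^bsub>V n\<^esub>} \<subseteq> {n. s n \<noteq> \<zero>\<^bsub>V n\<^esub>} \<union> {n. t n \<noteq> \<zero>\<^bsub>V n\<^esub>}" by auto
    then have "finite {n. s n \<oplus>\<^bsub>V n\<^esub> t n \<noteq> \<zero>\<^bsub>V n\<^esub>}"
      by (rule finite_subset) (use st in \<open>auto simp: direct_sum_carrier\<close>)
    then show "s \<oplus>\<^bsub>direct_sum V\<^esub> t \<in> carrier (direct_sum V)"
      using st by (auto simp: direct_sum_carrier)
  next
    fix t assume t: "t \<in> carrier (direct_sum V)"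
    have "{n. \<ominus>\<^bsub>V n\<^esub> t n \<noteq> \<zero>\<^bsub>V n\<^esub>} \<subseteq> {n. t n \<noteq> \<zero>\<^bsub>V n\<^esub>}" by auto
    then have "(\<lambda>n. \<ominus>\<^bsub>V n\<^esub> t n) \<in> carrier (direct_sum V)"
      using t by (auto simp: direct_sum_carrier intro: finite_subset)
    moreover have "(\<lambda>n. \<ominus>\<^bsub>V n\<^esub> t n) \<oplus>\<^bsub>direct_sum V\<^esub> t = \<zero>\<^bsub>direct_sum V\<^esub>"
      using t by (auto simp: direct_sum_carrier V.M.l_neg)
    ultimately show "\<exists>y\<in>carrier (direct_sum V). y \<oplus>\<^bsub>direct_sum V\<^esub> t = \<zero>\<^bsub>direct_sum V\<^esub>" by blast
  qed (auto simp: direct_sum_carrier V.M.a_ac)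
  fix a t assume t: "a \<in> carrier K" "t \<in> carrier (direct_sum V)"
  then have "{n. a \<odot>\<^bsub>V n\<^esub> t n \<noteq> \<zero>\<^bsub>V n\<^esub>} \<subseteq> {n. t n \<noteq> \<zero>\<^bsub>V n\<^esub>}" by auto
  then show "a \<odot>\<^bsub>direct_sum V\<^esub> t \<in> carrier (direct_sum V)"
    using t by (auto simp: direct_sum_carrier intro: finite_subset)
qed (auto simp: direct_sum_carrier V.smult_l_distr V.smult_r_distr V.smult_assoc1 V.R.cring_axioms)

interpretation T: module K "direct_sum V" by (rule module_direct_sum)

lemma linear_map_inj: "linear_map K (V n) (direct_sum V) (direct_sum_inj V n)"
proof (rule linear_mapI)
  fix x assume "x \<in> carrier (V n)"
  moreover have "{m. direct_sum_inj V n x m \<noteq> \<zero>\<^bsub>V m\<^esub>} \<subseteq> {n}" by (auto simp: direct_sum_inj_def)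
  ultimately show "direct_sum_inj V n x \<in> carrier (direct_sum V)"
    by (auto simp: direct_sum_carrier intro: finite_subset) (auto simp: direct_sum_inj_def)
qed (auto simp: direct_sum_inj_def)

text \<open>The same dismantling as for free modules, one component at a time.\<close>

lemma direct_sum_span:
  assumes N: "submodule N K (direct_sum V)" "\<And>n x. x \<in> carrier (V n) \<Longrightarrow> direct_sum_inj V n x \<in> N"
    and t: "t \<in> carrier (direct_sum V)"
  shows "t \<in> N"
proof -
  have zero: "(\<lambda>n. \<zero>\<^bsub>V n\<^esub>) \<in> N"
    using subgroup.one_closed[OF submodule.axioms(1)[OF N(1)]] by simp
  have "finite A \<Longrightarrow> (\<And>t. t \<in> carrier (direct_sum V) \<Longrightarrow> {n. t n \<noteq> \<zero>\<^bsub>V n\<^esub>} \<subseteq> A \<Longrightarrow> t \<in> N)" for A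
  proof (induction A rule: finite_induct)
    case empty
    then have "t = (\<lambda>n. \<zero>\<^bsub>V n\<^esub>)" by auto
    then show ?case using zero by simp
  next
    case (insert a A)
    let ?s = "t(a := \<zero>\<^bsub>V a\<^esub>)"
    have t: "t n \<in> carrier (V n)" for n using insert by (auto simp: direct_sum_carrier)
    have "{n. ?s n \<noteq> \<zero>\<^bsub>V n\<^esub>} \<subseteq> {n. t n \<noteq> \<zero>\<^bsub>V n\<^esub>}" by auto
    then have "?s \<in> carrier (direct_sum V)"
      using insert.prems(1) unfolding direct_sum_carrier by (auto intro: finite_subset)
    moreover have "{n. ?s n \<noteq> \<zero>\<^bsub>V n\<^esub>} \<subseteq> A" using insert by auto
    ultimately have "?s \<in> N" by (rule insert.IH)
    then have "?s \<oplus>\<^bsub>direct_sum V\<^esub> direct_sum_inj V a (t a) \<in> N"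
      using T.submoduleE(5)[OF N(1)] N(2) t by blast
    moreover have "?s \<oplus>\<^bsub>direct_sum V\<^esub> direct_sum_inj V a (t a) = t"
      using t by (auto simp: direct_sum_inj_def)
    ultimately show ?case by metis
  qed
  then show ?thesis using t by (auto simp: direct_sum_carrier)
qed

lemma direct_sum_agree:
  assumes "module K W" "linear_map K (direct_sum V) W f" "linear_map K (direct_sum V) W g"
    "\<And>n x. x \<in> carrier (V n) \<Longrightarrow> f (direct_sum_inj V n x) = g (direct_sum_inj V n x)"
    "t \<in> carrier (direct_sum V)"
  shows "f t = g t"
proof -
  have "t \<in> {t \<in> carrier (direct_sum V). f t = g t}"
    by (rule direct_sum_span[OF submodule_equalizer[OF module_direct_sum assms(1-3)] _ assms(5)])
      (use assms(4) linear_map_closed[OF linear_map_inj] in auto)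
  then show ?thesis by simp
qed

context
  fixes W :: "('k, 'c) module" and L :: "'a \<Rightarrow> 'c"
  assumes W: "module K W" and L: "\<And>n. linear_map K (V n) W L"
begin

interpretation W: module K W by (rule W)

text \<open>\<open>L\<close> sends zero components to zero, so the support may be enlarged; this
  again supplies a common range for two families. One \<open>L\<close> serves all summands, just as
  \<open>tc_ext\<close> uses one \<open>linear_ext\<close> for all word lengths.\<close>

lemma direct_sum_ext_eq:
  assumes "t \<in> carrier (direct_sum V)" "finite A" "{n. t n \<noteq> \<zero>\<^bsub>V n\<^esub>} \<subseteq> A"
  shows "(\<Oplus>\<^bsub>W\<^esub>n\<in>{n. t n \<noteq> \<zero>\<^bsub>V n\<^esub>}. L (t n)) = (\<Oplus>\<^bsub>W\<^esub>n\<in>A. L (t n))"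
  by (rule W.M.finsum_mono_neutral)
    (use assms linear_map_closed[OF L] in \<open>auto simp: direct_sum_carrier linear_map_zero[OF V W L]\<close>)

lemma linear_map_direct_sum_ext:
  "linear_map K (direct_sum V) W (\<lambda>t. \<Oplus>\<^bsub>W\<^esub>n\<in>{n. t n \<noteq> \<zero>\<^bsub>V n\<^esub>}. L (t n))"
proof (rule linear_mapI)
  fix t assume "t \<in> carrier (direct_sum V)"
  then show "(\<Oplus>\<^bsub>W\<^esub>n\<in>{n. t n \<noteq> \<zero>\<^bsub>V n\<^esub>}. L (t n)) \<in> carrier W"
    using linear_map_closed[OF L] by (intro W.M.finsum_in) (auto simp: direct_sum_carrier)
next
  fix s t assume st: "s \<in> carrier (direct_sum V)" "t \<in> carrier (direct_sum V)"
  let ?A = "{n. s n \<noteq> \<zero>\<^bsub>V n\<^esub>} \<union> {n. t n \<noteq> \<zero>\<^bsub>V n\<^esub>}"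
  have A: "finite ?A" and c: "s n \<in> carrier (V n)" "t n \<in> carrier (V n)" for n
    using st by (auto simp: direct_sum_carrier)
  have sub: "{n. (s \<oplus>\<^bsub>direct_sum V\<^esub> t) n \<noteq> \<zero>\<^bsub>V n\<^esub>} \<subseteq> ?A" by auto
  have "(\<Oplus>\<^bsub>W\<^esub>n\<in>?A. L ((s \<oplus>\<^bsub>direct_sum V\<^esub> t) n)) = (\<Oplus>\<^bsub>W\<^esub>n\<in>?A. L (s n) \<oplus>\<^bsub>W\<^esub> L (t n))"
    by (rule finsum_cong_on) (simp add: linear_map_add[OF L] c)
  also have "\<dots> = (\<Oplus>\<^bsub>W\<^esub>n\<in>?A. L (s n)) \<oplus>\<^bsub>W\<^esub> (\<Oplus>\<^bsub>W\<^esub>n\<in>?A. L (t n))"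
    by (rule W.M.finsum_add) (use c linear_map_closed[OF L] in auto)
  finally show "(\<Oplus>\<^bsub>W\<^esub>n\<in>{n. (s \<oplus>\<^bsub>direct_sum V\<^esub> t) n \<noteq> \<zero>\<^bsub>V n\<^esub>}. L ((s \<oplus>\<^bsub>direct_sum V\<^esub> t) n))
     = (\<Oplus>\<^bsub>W\<^esub>n\<in>{n. s n \<noteq> \<zero>\<^bsub>V n\<^esub>}. L (s n)) \<oplus>\<^bsub>W\<^esub> (\<Oplus>\<^bsub>W\<^esub>n\<in>{n. t n \<noteq> \<zero>\<^bsub>V n\<^esub>}. L (t n))"
    using direct_sum_ext_eq[OF T.M.a_closed[OF st] A sub] direct_sum_ext_eq[OF st(1) A] direct_sum_ext_eq[OF st(2) A]
    by simp
next
  fix a t assume a: "a \<in> carrier K" and t: "t \<in> carrier (direct_sum V)"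
  let ?A = "{n. t n \<noteq> \<zero>\<^bsub>V n\<^esub>}"
  have A: "finite ?A" and c: "t n \<in> carrier (V n)" for n
    using t by (auto simp: direct_sum_carrier)
  have sub: "{n. (a \<odot>\<^bsub>direct_sum V\<^esub> t) n \<noteq> \<zero>\<^bsub>V n\<^esub>} \<subseteq> ?A" using a by auto
  have "(\<Oplus>\<^bsub>W\<^esub>n\<in>?A. L ((a \<odot>\<^bsub>direct_sum V\<^esub> t) n)) = (\<Oplus>\<^bsub>W\<^esub>n\<in>?A. a \<odot>\<^bsub>W\<^esub> L (t n))"
    by (rule finsum_cong_on) (simp add: linear_map_smult[OF L] c a)
  also have "\<dots> = a \<odot>\<^bsub>W\<^esub> (\<Oplus>\<^bsub>W\<^esub>n\<in>?A. L (t n))"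
    by (rule W.finsum_smult_ldistr[symmetric]) (use c linear_map_closed[OF L] A a in auto)
  finally show "(\<Oplus>\<^bsub>W\<^esub>n\<in>{n. (a \<odot>\<^bsub>direct_sum V\<^esub> t) n \<noteq> \<zero>\<^bsub>V n\<^esub>}. L ((a \<odot>\<^bsub>direct_sum V\<^esub> t) n))
     = a \<odot>\<^bsub>W\<^esub> (\<Oplus>\<^bsub>W\<^esub>n\<in>{n. t n \<noteq> \<zero>\<^bsub>V n\<^esub>}. L (t n))"
    using direct_sum_ext_eq[OF T.smult_closed[OF a t] A sub] by simp
qed

lemma direct_sum_ext_inj:
  assumes "x \<in> carrier (V n)"
  shows "(\<Oplus>\<^bsub>W\<^esub>m\<in>{m. direct_sum_inj V n x m \<noteq> \<zero>\<^bsub>V m\<^esub>}. L (direct_sum_inj V n x m)) = L x"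
proof -
  have "(\<Oplus>\<^bsub>W\<^esub>m\<in>{m. direct_sum_inj V n x m \<noteq> \<zero>\<^bsub>V m\<^esub>}. L (direct_sum_inj V n x m))
      = (\<Oplus>\<^bsub>W\<^esub>m\<in>{n}. L (direct_sum_inj V n x m))"
    using linear_map_closed[OF linear_map_inj assms] by (rule direct_sum_ext_eq) (auto simp: direct_sum_inj_def)
  then show ?thesis
    using linear_map_closed[OF L assms] by (simp add: W.M.finsum_one direct_sum_inj_def)
qed

end

end

section \<open>Words in the tensor coalgebra and linear extension from words\<close>

abbreviation tc_inj :: "'k ring \<Rightarrow> ('k, 'v) module \<Rightarrow> nat \<Rightarrow> ('v list \<Rightarrow> 'k) set \<Rightarrow> ('k, 'v) tc" where
  "tc_inj K R \<equiv> direct_sum_inj (tensor_power K R)"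

lemma tc_inj_pure_word: "tc_inj K R (length xs) (pure_word K R xs) = tc_word K R xs"
  by (auto simp: direct_sum_inj_def tc_word_def)

context
  fixes K :: "'k ring" and R :: "('k, 'v) module"
  assumes R: "module K R"
begin

lemma module_tensor_coalg: "module K (tensor_coalg K R)"
  unfolding tensor_coalg_def by (rule module_direct_sum[OF module_tensor_power[OF R]])

lemma linear_map_tc_inj: "linear_map K (tensor_power K R n) (tensor_coalg K R) (tc_inj K R n)"
  unfolding tensor_coalg_def by (rule linear_map_inj[OF module_tensor_power[OF R]])

lemma multilinear_tc_word: "multilinear_map K R (tensor_coalg K R) (tc_word K R)"
proof (rule multilinear_mapI)
  show "tc_word K R xs \<in> carrier (tensor_coalg K R)" if "set xs \<subseteq> carrier R" for xs
    using linear_map_closed[OF linear_map_tc_inj pure_word_closed[OF R]] that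
    by (simp add: words_def flip: tc_inj_pure_word)
  show "linear_map K R (tensor_coalg K R) (\<lambda>x. tc_word K R (us @ [x] @ ws))"
    if "set us \<subseteq> carrier R" "set ws \<subseteq> carrier R" for us ws
    using linear_map_comp[OF linear_map_pure_word[OF R that refl] linear_map_tc_inj]
    by (simp flip: tc_inj_pure_word)
qed

text \<open>The test on which most identities below rest: linear maps on the tensor coalgebra are
  compared on words, by passing from the direct sum to its components and from these to their
  generators.\<close>

lemma tc_agree:
  assumes "module K W" "linear_map K (tensor_coalg K R) W f" "linear_map K (tensor_coalg K R) W g"
    "\<And>xs. set xs \<subseteq> carrier R \<Longrightarrow> f (tc_word K R xs) = g (tc_word K R xs)"
    "t \<in> carrier (tensor_coalg K R)"
  shows "f t = g t"
proof (rule direct_sum_agree[OF module_tensor_power[OF R] assms(1)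
      assms(2,3)[unfolded tensor_coalg_def] _ assms(5)[unfolded tensor_coalg_def]])
  fix n x assume x: "x \<in> carrier (tensor_power K R n)"
  show "f (tc_inj K R n x) = g (tc_inj K R n x)"
    by (rule tensor_power_agree[OF R assms(1) linear_map_comp[OF linear_map_tc_inj assms(2)]
          linear_map_comp[OF linear_map_tc_inj assms(3)] _ x])
      (use assms(4) in \<open>auto simp: words_def tc_inj_pure_word\<close>)
qed

lemma linear_map_tc_ext:
  assumes "module K W" "multilinear_map K R W g"
  shows "linear_map K (tensor_coalg K R) W (tc_ext K R W g)"
  unfolding tensor_coalg_def tc_ext_def
  by (rule linear_map_direct_sum_ext[OF module_tensor_power[OF R] assms(1) linear_map_power_ext[OF R assms]])

lemma tc_ext_word:
  assumes "module K W" "multilinear_map K R W g" "set xs \<subseteq> carrier R"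
  shows "tc_ext K R W g (tc_word K R xs) = g xs"
  unfolding tc_ext_def
  using direct_sum_ext_inj[where V="tensor_power K R" and n="length xs", OF module_tensor_power[OF R] assms(1)
      linear_map_power_ext[OF R assms(1,2)] pure_word_closed[OF R, of xs "length xs"]] assms(3) power_ext_word[OF R assms]
  by (simp add: words_def tc_inj_pure_word)

end

section \<open>The tensor coalgebra\<close>

text \<open>Nested extensions, as in \<open>tensor_assoc\<close> and
  \<open>tensor_square_mult\<close>, need the inner extension to depend linearly on the outer
  argument. Because of the choice in \<open>linear_ext\<close> this is not read off the defining
  sum; both sides are linear in the tensor argument and are compared on pure tensors.\<close>

lemma bilinear_tensor_ext:
  assumes X: "module K X" and V: "module K V" and W: "module K W" and U: "module K U"
    and g: "\<And>x. x \<in> carrier X \<Longrightarrow> bilinear_map K V W U (\<lambda>v w. g x (v, w))"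
    and gx: "\<And>v w. v \<in> carrier V \<Longrightarrow> w \<in> carrier W \<Longrightarrow> linear_map K X U (\<lambda>x. g x (v, w))"
  shows "bilinear_map K X (tensor K V W) U (\<lambda>x. linear_ext K U (g x))"
proof -
  interpret X: module K X by fact
  interpret U: module K U by fact
  note lin = linear_map_tensor_ext[OF V W U g]
  note val = tensor_ext_pure[OF V W U g]
  note agree = tensor_agree[OF V W U]
  show ?thesis
  proof (rule bilinear_mapI[OF lin linear_mapI])
    fix t x assume t: "t \<in> carrier (tensor K V W)" and x: "x \<in> carrier X"
    show "linear_ext K U (g x) t \<in> carrier U"
      using linear_map_closed[OF lin[OF x] t] .
    show "linear_ext K U (g (x \<oplus>\<^bsub>X\<^esub> y)) t = linear_ext K U (g x) t \<oplus>\<^bsub>U\<^esub> linear_ext K U (g y) t"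
      if y: "y \<in> carrier X" for y
      by (rule agree[OF lin[OF X.M.a_closed[OF x y]] linear_map_plus[OF U lin[OF x] lin[OF y]] _ t])
        (simp add: val x y linear_map_add[OF gx])
    show "linear_ext K U (g (a \<odot>\<^bsub>X\<^esub> x)) t = a \<odot>\<^bsub>U\<^esub> linear_ext K U (g x) t"
      if a: "a \<in> carrier K" for a
      by (rule agree[OF lin[OF X.smult_closed[OF a x]] linear_map_scale[OF U lin[OF x] a] _ t])
        (simp add: val x a linear_map_smult[OF gx])
  qed
qed

lemma module_self_module:
  assumes "cring K"
  shows "module K (self_module K)"
proof -
  interpret cring K by fact
  show ?thesis
    by (rule moduleI)
      (auto simp: self_module_def l_distr r_distr m_assoc a_ac r_neg assms intro!: abelian_groupI bexI[of _ "\<ominus>\<^bsub>K\<^esub> _"])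
qed

lemma self_module_simps [simp]:
  "carrier (self_module K) = carrier K" "zero (self_module K) = zero K" "add (self_module K) = add K"
  "smult (self_module K) = mult K"
  by (simp_all add: self_module_def)

lemma linear_map_self_scale:
  assumes "module K V" "linear_map K W (self_module K) f" "v \<in> carrier V"
  shows "linear_map K W V (\<lambda>x. f x \<odot>\<^bsub>V\<^esub> v)"
proof -
  interpret V: module K V by fact
  show ?thesis
    using linear_map_closed[OF assms(2)] assms
    by (intro linear_mapI)
      (auto simp: linear_map_add[OF assms(2)] linear_map_smult[OF assms(2)]
        V.smult_l_distr V.smult_assoc1)
qed

lemma multilinear_map_plus:
  assumes "module K W" "multilinear_map K R W f" "multilinear_map K R W g"
  shows "multilinear_map K R W (\<lambda>xs. f xs \<oplus>\<^bsub>W\<^esub> g xs)"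
proof -
  interpret W: module K W by fact
  show ?thesis
    by (intro multilinear_mapI W.M.a_closed linear_map_plus[OF assms(1)] multilinear_map_slot[OF assms(2)]
        multilinear_map_slot[OF assms(3)] multilinear_map_closed[OF assms(2)] multilinear_map_closed[OF assms(3)])
qed

text \<open>Filling a slot does not change the length of the word, so the parameter is constant in
  every slot.\<close>

lemma multilinear_map_length:
  assumes "\<And>n. multilinear_map K R W (g n)"
  shows "multilinear_map K R W (\<lambda>xs. g (length xs) xs)"
proof (rule multilinear_mapI)
  fix us ws assume s: "set us \<subseteq> carrier R" "set ws \<subseteq> carrier R"
  show "linear_map K R W (\<lambda>x. g (length (us @ [x] @ ws)) (us @ [x] @ ws))"
    using multilinear_map_slot[OF assms s, of "length us + Suc (length ws)"] by simp
qed (rule multilinear_map_closed[OF assms])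

text \<open>A word with a slot is never empty, so the value at the empty word may be any element of
  the target.\<close>

lemma multilinear_map_if_Nil:
  assumes "u \<in> carrier W" "multilinear_map K R W g"
  shows "multilinear_map K R W (\<lambda>xs. if xs = [] then u else g xs)"
  using assms by (auto simp: multilinear_map_def)

lemma multilinear_map_const_zero:
  assumes "module K W"
  shows "multilinear_map K R W (\<lambda>xs. \<zero>\<^bsub>W\<^esub>)"
  using assms by (auto simp: multilinear_map_def linear_map_const_zero abelian_monoid.zero_closed)

section \<open>The tensor coalgebra of a fixed space together with its tensor square\<close>

locale tensor_space =
  fixes K :: "'k ring" and R :: "('k, 'v) module"
  assumes module_R: "module K R"
begin

abbreviation "T \<equiv> tensor_coalg K R"
abbreviation "TT \<equiv> tensor K T T"
abbreviation "word \<equiv> tc_word K R"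
abbreviation "over_R xs \<equiv> set xs \<subseteq> carrier R"
abbreviation "\<Delta> \<equiv> deconcatenation K R"
abbreviation "\<epsilon> \<equiv> tc_counit K R"
abbreviation pt :: "('k, 'v) tc \<Rightarrow> ('k, 'v) tc \<Rightarrow> (('k, 'v) tc \<times> ('k, 'v) tc \<Rightarrow> 'k) set" (infixl "\<boxtimes>" 68)
  where "s \<boxtimes> t \<equiv> pure_tensor K T T s t"

lemmas module_T = module_tensor_coalg[OF module_R]
lemmas module_TT = module_tensor[OF module_T module_T]

sublocale R: module K R by (rule module_R)
sublocale T: module K T by (rule module_T)
sublocale TT: module K TT by (rule module_TT)

lemmas module_self = module_self_module[OF R.R.cring_axioms]

lemmas word_multilinear = multilinear_tc_word[OF module_R]
lemmas word_closed [simp, intro] = multilinear_map_closed[OF word_multilinear]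
lemmas T_agree = tc_agree[OF module_R]
lemmas ext_linear = linear_map_tc_ext[OF module_R]
lemmas ext_word = tc_ext_word[OF module_R]
lemmas pt_bilinear = bilinear_pure_tensor[OF module_T module_T]
lemmas pt_closed [simp, intro] = bilinear_map_closed[OF pt_bilinear]
lemmas TT_agree = tensor_agree[OF module_T module_T]
lemmas TT_ext_linear = linear_map_tensor_ext[OF module_T module_T]
lemmas TT_ext_pure = tensor_ext_pure[OF module_T module_T]

lemma over_R_take [simp]: "over_R xs \<Longrightarrow> over_R (take i xs)"
  by (meson order_trans set_take_subset)

lemma over_R_drop [simp]: "over_R xs \<Longrightarrow> over_R (drop i xs)"
  by (meson order_trans set_drop_subset)

text \<open>The counterpart of \<open>bilinear_tensor_ext\<close> for extension from words: the
  dependence on the parameter is compared on words.\<close>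

lemma bilinear_ext:
  assumes X: "module K X" and U: "module K U"
    and g: "\<And>x. x \<in> carrier X \<Longrightarrow> multilinear_map K R U (g x)"
    and gx: "\<And>xs. over_R xs \<Longrightarrow> linear_map K X U (\<lambda>x. g x xs)"
  shows "bilinear_map K X T U (\<lambda>x. tc_ext K R U (g x))"
proof -
  interpret X: module K X by fact
  interpret U: module K U by fact
  note lin = ext_linear[OF U g]
  note val = ext_word[OF U g]
  note agree = T_agree[OF U]
  show ?thesis
  proof (rule bilinear_mapI[OF lin linear_mapI])
    fix t x assume t: "t \<in> carrier T" and x: "x \<in> carrier X"
    show "tc_ext K R U (g x) t \<in> carrier U"
      using linear_map_closed[OF lin[OF x] t] .
    show "tc_ext K R U (g (x \<oplus>\<^bsub>X\<^esub> y)) t = tc_ext K R U (g x) t \<oplus>\<^bsub>U\<^esub> tc_ext K R U (g y) t"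
      if y: "y \<in> carrier X" for y
      by (rule agree[OF lin[OF X.M.a_closed[OF x y]] linear_map_plus[OF U lin[OF x] lin[OF y]] _ t])
        (simp add: val x y linear_map_add[OF gx])
    show "tc_ext K R U (g (a \<odot>\<^bsub>X\<^esub> x)) t = a \<odot>\<^bsub>U\<^esub> tc_ext K R U (g x) t"
      if a: "a \<in> carrier K" for a
      by (rule agree[OF lin[OF X.smult_closed[OF a x]] linear_map_scale[OF U lin[OF x] a] _ t])
        (simp add: val x a linear_map_smult[OF gx])
  qed
qed

definition ext2 :: "('v list \<Rightarrow> 'v list \<Rightarrow> ('k, 'v) tc) \<Rightarrow> ('k, 'v) tc \<Rightarrow> ('k, 'v) tc \<Rightarrow> ('k, 'v) tc" where
  "ext2 P s t = tc_ext K R T (\<lambda>xs. tc_ext K R T (P xs) t) s"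

context
  fixes P :: "'v list \<Rightarrow> 'v list \<Rightarrow> ('k, 'v) tc"
  assumes P1: "\<And>xs. over_R xs \<Longrightarrow> multilinear_map K R T (P xs)"
    and P2: "\<And>ys. over_R ys \<Longrightarrow> multilinear_map K R T (\<lambda>xs. P xs ys)"
begin

text \<open>Extension in the second argument keeps multilinearity in the first; this is what makes
  the outer extension in \<open>ext2\<close> take the intended values on words.\<close>

lemma multilinear_ext:
  assumes t: "t \<in> carrier T"
  shows "multilinear_map K R T (\<lambda>xs. tc_ext K R T (P xs) t)"
proof (rule multilinear_mapI)
  show "tc_ext K R T (P xs) t \<in> carrier T" if "over_R xs" for xs
    using linear_map_closed[OF ext_linear[OF module_T P1[OF that]] t] .
  fix us ws assume s: "over_R us" "over_R ws"
  have "bilinear_map K R T T (\<lambda>x. tc_ext K R T (P (us @ [x] @ ws)))"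
    by (rule bilinear_ext[OF module_R module_T P1 multilinear_map_slot[OF P2 s]]) (use s in auto)
  then show "linear_map K R T (\<lambda>x. tc_ext K R T (P (us @ [x] @ ws)) t)"
    using t by (rule bilinear_map_left)
qed

lemma bilinear_ext2: "bilinear_map K T T T (ext2 P)"
proof -
  have "bilinear_map K T T T (\<lambda>t s. ext2 P s t)"
    unfolding ext2_def
    by (rule bilinear_ext[OF module_T module_T multilinear_ext ext_linear[OF module_T P1]])
  then show ?thesis by (auto simp: bilinear_map_def)
qed

lemma ext2_word: "over_R xs \<Longrightarrow> over_R ys \<Longrightarrow> ext2 P (word xs) (word ys) = P xs ys"
  unfolding ext2_def by (simp add: ext_word[OF module_T] multilinear_ext P1)

end

lemma T_agree2:
  assumes U: "module K U" and f: "bilinear_map K T T U f" and g: "bilinear_map K T T U g"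
    and eq: "\<And>xs ys. over_R xs \<Longrightarrow> over_R ys \<Longrightarrow> f (word xs) (word ys) = g (word xs) (word ys)"
    and s: "s \<in> carrier T" and t: "t \<in> carrier T"
  shows "f s t = g s t"
proof (rule T_agree[OF U bilinear_map_left[OF f t] bilinear_map_left[OF g t] _ s])
  fix xs assume xs: "over_R xs"
  show "f (word xs) t = g (word xs) t"
    by (rule T_agree[OF U bilinear_map_right[OF f] bilinear_map_right[OF g] _ t]) (use eq xs in auto)
qed

subsection \<open>Deconcatenation and counit\<close>

text \<open>Each fixed cut is bilinear in the two pieces, and the range of cuts depends on the
  length of the word alone.\<close>

lemma deconcatenation_multilinear:
  "multilinear_map K R TT (\<lambda>xs. \<Oplus>\<^bsub>TT\<^esub>i\<in>{0..length xs}. word (take i xs) \<boxtimes> word (drop i xs))"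
proof (rule multilinear_map_length_sum[OF module_TT, where A="\<lambda>n. {0..n}"])
  show "multilinear_map K R TT (\<lambda>xs. word (take i xs) \<boxtimes> word (drop i xs))" for i
  proof (rule multilinear_map_split)
    show "multilinear_map K R TT (\<lambda>ys. word xs \<boxtimes> word ys)" if "over_R xs" for xs
      using that by (intro multilinear_map_comp[OF word_multilinear] bilinear_map_right[OF pt_bilinear]) auto
    show "multilinear_map K R TT (\<lambda>xs. word xs \<boxtimes> word ys)" if "over_R ys" for ys
      using that by (intro multilinear_map_comp[OF word_multilinear] bilinear_map_left[OF pt_bilinear]) auto
  qed
qed

lemma \<Delta>_linear: "linear_map K T TT \<Delta>"
  unfolding deconcatenation_def Let_def by (rule ext_linear[OF module_TT deconcatenation_multilinear])

lemmas \<Delta>_closed [simp, intro] = linear_map_closed[OF \<Delta>_linear]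

lemma \<Delta>_word: "over_R xs \<Longrightarrow> \<Delta> (word xs) = (\<Oplus>\<^bsub>TT\<^esub>i\<in>{..length xs}. word (take i xs) \<boxtimes> word (drop i xs))"
  unfolding deconcatenation_def Let_def
  by (subst ext_word[OF module_TT deconcatenation_multilinear]) (simp_all add: atLeast0AtMost)

lemma \<Delta>_one: "\<Delta> (word []) = word [] \<boxtimes> word []"
  by (simp add: \<Delta>_word TT.M.finsum_one)

lemma linear_\<Delta>_word:
  assumes "module K U" "linear_map K TT U f" "over_R xs"
  shows "f (\<Delta> (word xs)) = (\<Oplus>\<^bsub>U\<^esub>i\<in>{..length xs}. f (word (take i xs) \<boxtimes> word (drop i xs)))"
  using assms(3) by (simp add: \<Delta>_word linear_map_finsum[OF module_TT assms(1,2)])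

lemma \<epsilon>_linear: "linear_map K T (self_module K) \<epsilon>"
  and \<epsilon>_word: "over_R xs \<Longrightarrow> \<epsilon> (word xs) = (if xs = [] then \<one>\<^bsub>K\<^esub> else \<zero>\<^bsub>K\<^esub>)"
proof -
  have *: "multilinear_map K R (self_module K) (\<lambda>xs. if xs = [] then \<one>\<^bsub>K\<^esub> else \<zero>\<^bsub>K\<^esub>)"
    using multilinear_map_if_Nil[OF _ multilinear_map_const_zero[OF module_self], of "\<one>\<^bsub>K\<^esub>" R]
    unfolding self_module_simps by simp
  show "linear_map K T (self_module K) \<epsilon>"
    unfolding tc_counit_def by (rule ext_linear[OF module_self *])
  show "over_R xs \<Longrightarrow> \<epsilon> (word xs) = (if xs = [] then \<one>\<^bsub>K\<^esub> else \<zero>\<^bsub>K\<^esub>)"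
    unfolding tc_counit_def by (rule ext_word[OF module_self *])
qed

lemma \<epsilon>_closed [simp, intro]: "t \<in> carrier T \<Longrightarrow> \<epsilon> t \<in> carrier K"
  using linear_map_closed[OF \<epsilon>_linear] by simp

text \<open>On a word both sides are sums over two successive cuts, the second one in the left piece
  or in the right piece; \<open>finsum_triangle\<close> matches the two indexings.\<close>

lemma coassociative:
  assumes "t \<in> carrier T"
  shows "tensor_assoc K T T T (tensor_map K TT T \<Delta> (\<lambda>y. y) (\<Delta> t)) = tensor_map K T TT (\<lambda>y. y) \<Delta> (\<Delta> t)"
proof -
  let ?L = "tensor K TT T" and ?U = "tensor K T TT"
  have U: "module K ?U" by (rule module_tensor[OF module_T module_TT])
  interpret U: module K ?U by (rule U)
  interpret L: module K ?L by (rule module_tensor[OF module_TT module_T])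
  let ?u = "\<lambda>u v w. pure_tensor K T TT u (v \<boxtimes> w)"
  note ub = bilinear_pure_tensor[OF module_T module_TT]
  have u_cl: "?u u v w \<in> carrier ?U" if "u \<in> carrier T" "v \<in> carrier T" "w \<in> carrier T" for u v w
    using that by (intro bilinear_map_closed[OF ub]) auto
  have u1: "linear_map K T ?U (\<lambda>u. ?u u v w)" if "v \<in> carrier T" "w \<in> carrier T" for v w
    using that by (intro bilinear_map_left[OF ub]) auto
  have u2: "linear_map K T ?U (\<lambda>v. ?u u v w)" if "u \<in> carrier T" "w \<in> carrier T" for u w
    using that by (intro linear_map_comp[OF bilinear_map_left[OF pt_bilinear] bilinear_map_right[OF ub]]) auto
  have u3: "linear_map K T ?U (\<lambda>w. ?u u v w)" if "u \<in> carrier T" "v \<in> carrier T" for u v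
    using that by (intro linear_map_comp[OF bilinear_map_right[OF pt_bilinear] bilinear_map_right[OF ub]]) auto
  have b2: "bilinear_map K T T ?U (\<lambda>u v. case (u, v) of (u, v) \<Rightarrow> ?u u v w)" if "w \<in> carrier T" for w
    unfolding prod.case by (intro bilinear_mapI u1 u2 that)
  have "bilinear_map K T TT ?U (\<lambda>w. linear_ext K ?U (\<lambda>(u, v). ?u u v w))"
    by (rule bilinear_tensor_ext[OF module_T module_T module_T U b2]) (auto intro: u3)
  \<comment> \<open>\<open>bilinear_tensor_ext\<close> puts the parameter first, here the third
    tensor factor; exchanging the arguments gives the form in which \<open>tensor_assoc\<close> is
    written.\<close>
  then have b1: "bilinear_map K TT T ?U (\<lambda>t w. case (t, w) of (t, w) \<Rightarrow> linear_ext K ?U (\<lambda>(u, v). ?u u v w) t)"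
    by (auto simp: bilinear_map_def)
  have assoc_lin: "linear_map K ?L ?U (tensor_assoc K T T T)"
    unfolding tensor_assoc_def Let_def by (rule linear_map_tensor_ext[OF module_TT module_T U b1])
  have assoc_val: "tensor_assoc K T T T (pure_tensor K TT T (u \<boxtimes> v) w) = ?u u v w"
    if "u \<in> carrier T" "v \<in> carrier T" "w \<in> carrier T" for u v w
    unfolding tensor_assoc_def Let_def
    using that by (simp add: tensor_ext_pure[OF module_TT module_T U b1] TT_ext_pure[OF U b2])
  note lm = linear_tensor_map[OF module_T module_T module_TT module_T \<Delta>_linear linear_map_ident]
  note rm = linear_tensor_map[OF module_T module_T module_T module_TT linear_map_ident \<Delta>_linear]
  note lv = tensor_map_pure[OF module_T module_T module_TT module_T \<Delta>_linear linear_map_ident]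
  note rv = tensor_map_pure[OF module_T module_T module_T module_TT linear_map_ident \<Delta>_linear]
  note Lb = bilinear_pure_tensor[OF module_TT module_T]
  show ?thesis
  proof (rule T_agree[OF U _ _ _ assms, where f="\<lambda>t. tensor_assoc K T T T (tensor_map K TT T \<Delta> (\<lambda>y. y) (\<Delta> t))"])
    fix xs assume xs: "over_R xs"
    let ?n = "length xs"
    have "tensor_assoc K T T T (tensor_map K TT T \<Delta> (\<lambda>y. y) (\<Delta> (word xs)))
        = (\<Oplus>\<^bsub>?U\<^esub>a\<in>{..?n}. tensor_assoc K T T T (pure_tensor K TT T (\<Delta> (word (take a xs))) (word (drop a xs))))"
      using xs by (subst linear_\<Delta>_word[OF U linear_map_comp[OF lm assoc_lin]]) (simp_all add: lv)
    also have "\<dots> = (\<Oplus>\<^bsub>?U\<^esub>a\<in>{..?n}. \<Oplus>\<^bsub>?U\<^esub>i\<in>{..a}.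
        ?u (word (take i xs)) (word (drop i (take a xs))) (word (drop a xs)))"
    proof (rule finsum_cong_on)
      fix a assume a: "a \<in> {..?n}"
      have l: "linear_map K TT ?U (\<lambda>X. tensor_assoc K T T T (pure_tensor K TT T X (word (drop a xs))))"
        using xs by (intro linear_map_comp[OF bilinear_map_left[OF Lb] assoc_lin]) auto
      show "tensor_assoc K T T T (pure_tensor K TT T (\<Delta> (word (take a xs))) (word (drop a xs))) =
        (\<Oplus>\<^bsub>?U\<^esub>i\<in>{..a}. ?u (word (take i xs)) (word (drop i (take a xs))) (word (drop a xs)))"
        using xs a by (subst linear_\<Delta>_word[OF U l]) (auto simp: assoc_val min_def intro!: finsum_cong_on)
    qed
    also have "\<dots> = (\<Oplus>\<^bsub>?U\<^esub>i\<in>{..?n}. \<Oplus>\<^bsub>?U\<^esub>k\<in>{..?n - i}.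
        ?u (word (take i xs)) (word (drop i (take (i + k) xs))) (word (drop (i + k) xs)))"
      by (rule U.M.finsum_triangle) (use xs in \<open>auto intro!: u_cl\<close>)
    also have "\<dots> = (\<Oplus>\<^bsub>?U\<^esub>i\<in>{..?n}. pure_tensor K T TT (word (take i xs)) (\<Delta> (word (drop i xs))))"
    proof (rule finsum_cong_on)
      fix i assume "i \<in> {..?n}"
      have l: "linear_map K TT ?U (\<lambda>X. pure_tensor K T TT (word (take i xs)) X)"
        using xs by (intro bilinear_map_right[OF ub]) auto
      show "(\<Oplus>\<^bsub>?U\<^esub>k\<in>{..?n - i}. ?u (word (take i xs)) (word (drop i (take (i + k) xs))) (word (drop (i + k) xs)))
          = pure_tensor K T TT (word (take i xs)) (\<Delta> (word (drop i xs)))"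
        using xs by (subst linear_\<Delta>_word[OF U l]) (auto simp: drop_take add.commute)
    qed
    also have "\<dots> = tensor_map K T TT (\<lambda>y. y) \<Delta> (\<Delta> (word xs))"
      using xs by (subst linear_\<Delta>_word[OF U rm]) (simp_all add: rv)
    finally show "tensor_assoc K T T T (tensor_map K TT T \<Delta> (\<lambda>y. y) (\<Delta> (word xs))) =
       tensor_map K T TT (\<lambda>y. y) \<Delta> (\<Delta> (word xs))" .
  qed (intro linear_map_comp[OF linear_map_comp[OF \<Delta>_linear lm] assoc_lin] linear_map_comp[OF \<Delta>_linear rm])+
qed

text \<open>The counit vanishes on nonempty words, so only the cut at one end of the word
  survives.\<close>

lemma counital:
  assumes "t \<in> carrier T"
  shows "linear_ext K T (\<lambda>(y, z). \<epsilon> y \<odot>\<^bsub>T\<^esub> z) (\<Delta> t) = t"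
    and "linear_ext K T (\<lambda>(y, z). \<epsilon> z \<odot>\<^bsub>T\<^esub> y) (\<Delta> t) = t"
proof -
  have b1: "bilinear_map K T T T (\<lambda>y z. case (y, z) of (y, z) \<Rightarrow> \<epsilon> y \<odot>\<^bsub>T\<^esub> z)"
    unfolding prod.case
    by (intro bilinear_mapI linear_map_self_scale[OF module_T \<epsilon>_linear] linear_map_scale[OF module_T linear_map_ident]) auto
  then have b2: "bilinear_map K T T T (\<lambda>y z. case (y, z) of (y, z) \<Rightarrow> \<epsilon> z \<odot>\<^bsub>T\<^esub> y)"
    by (auto simp: bilinear_map_def)
  note l1 = TT_ext_linear[OF module_T b1] and l2 = TT_ext_linear[OF module_T b2]
  show "linear_ext K T (\<lambda>(y, z). \<epsilon> y \<odot>\<^bsub>T\<^esub> z) (\<Delta> t) = t"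
  proof (rule T_agree[OF module_T linear_map_comp[OF \<Delta>_linear l1] linear_map_ident _ assms])
    fix xs assume xs: "over_R xs"
    show "linear_ext K T (\<lambda>(y, z). \<epsilon> y \<odot>\<^bsub>T\<^esub> z) (\<Delta> (word xs)) = word xs"
      unfolding linear_\<Delta>_word[OF module_T l1 xs] using xs
      by (subst T.M.finsum_delta[where a=0]) (auto simp: TT_ext_pure[OF module_T b1] \<epsilon>_word)
  qed
  show "linear_ext K T (\<lambda>(y, z). \<epsilon> z \<odot>\<^bsub>T\<^esub> y) (\<Delta> t) = t"
  proof (rule T_agree[OF module_T linear_map_comp[OF \<Delta>_linear l2] linear_map_ident _ assms])
    fix xs assume xs: "over_R xs"
    show "linear_ext K T (\<lambda>(y, z). \<epsilon> z \<odot>\<^bsub>T\<^esub> y) (\<Delta> (word xs)) = word xs"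
      unfolding linear_\<Delta>_word[OF module_T l2 xs] using xs
      by (subst T.M.finsum_delta[where a="length xs"]) (auto simp: TT_ext_pure[OF module_T b2] \<epsilon>_word)
  qed
qed

lemma coalgebra_T: "coalgebra K T \<Delta> \<epsilon>"
  unfolding coalgebra_def using module_T \<Delta>_linear \<epsilon>_linear coassociative counital by blast

subsection \<open>Projection to the primitive elements\<close>

definition proj :: "('k, 'v) tc \<Rightarrow> 'v" where
  "proj = tc_ext K R R (\<lambda>xs. if length xs = 1 then hd xs else \<zero>\<^bsub>R\<^esub>)"

lemma proj_linear: "linear_map K T R proj"
  and proj_word: "over_R xs \<Longrightarrow> proj (word xs) = (if length xs = 1 then hd xs else \<zero>\<^bsub>R\<^esub>)"
proof -
  have *: "multilinear_map K R R (\<lambda>xs. if length xs = 1 then hd xs else \<zero>\<^bsub>R\<^esub>)"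
  proof (rule multilinear_mapI)
    fix us ws assume "over_R us" "over_R ws"
    show "linear_map K R R (\<lambda>x. if length (us @ [x] @ ws) = 1 then hd (us @ [x] @ ws) else \<zero>\<^bsub>R\<^esub>)"
      by (cases "us = [] \<and> ws = []") (auto simp: linear_map_ident linear_map_const_zero module_R)
  next
    fix xs assume "over_R xs"
    then show "(if length xs = 1 then hd xs else \<zero>\<^bsub>R\<^esub>) \<in> carrier R"
      by (cases xs) auto
  qed
  show "linear_map K T R proj"
    unfolding proj_def by (rule ext_linear[OF module_R *])
  show "over_R xs \<Longrightarrow> proj (word xs) = (if length xs = 1 then hd xs else \<zero>\<^bsub>R\<^esub>)"
    unfolding proj_def by (rule ext_word[OF module_R *])
qed

lemmas proj_closed [simp, intro] = linear_map_closed[OF proj_linear]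

definition prep :: "'v \<Rightarrow> ('k, 'v) tc \<Rightarrow> ('k, 'v) tc" where
  "prep x = tc_ext K R T (\<lambda>xs. word (x # xs))"

lemma word_Cons_multilinear:
  assumes "x \<in> carrier R"
  shows "multilinear_map K R T (\<lambda>xs. word (x # xs))"
proof (rule multilinear_mapI)
  fix us ws assume "over_R us" "over_R ws"
  then show "linear_map K R T (\<lambda>y. word (x # us @ [y] @ ws))"
    using multilinear_map_slot[OF word_multilinear, of "x # us" ws] assms by simp
qed (use assms in auto)

lemma prep_bilinear: "bilinear_map K R T T prep"
  unfolding prep_def
proof (rule bilinear_ext[OF module_R module_T word_Cons_multilinear])
  show "linear_map K R T (\<lambda>x. word (x # xs))" if "over_R xs" for xs
    using multilinear_map_slot[OF word_multilinear, of "[]" xs] that by simp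
qed

lemmas prep_closed [simp, intro] = bilinear_map_closed[OF prep_bilinear]

lemma prep_word: "x \<in> carrier R \<Longrightarrow> over_R xs \<Longrightarrow> prep x (word xs) = word (x # xs)"
  unfolding prep_def by (rule ext_word[OF module_T word_Cons_multilinear])

lemma prep_zero [simp]: "t \<in> carrier T \<Longrightarrow> prep \<zero>\<^bsub>R\<^esub> t = \<zero>\<^bsub>T\<^esub>"
  using linear_map_zero[OF module_R module_T bilinear_map_left[OF prep_bilinear]] .

definition reassemble :: "(('k, 'v) tc \<times> ('k, 'v) tc \<Rightarrow> 'k) set \<Rightarrow> ('k, 'v) tc" where
  "reassemble = linear_ext K T (\<lambda>(u, v). prep (proj u) v)"

lemma reassemble_bilinear: "bilinear_map K T T T (\<lambda>u v. case (u, v) of (u, v) \<Rightarrow> prep (proj u) v)"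
  unfolding prod.case by (rule bilinear_map_comp[OF prep_bilinear proj_linear linear_map_ident])

lemma reassemble_linear: "linear_map K TT T reassemble"
  unfolding reassemble_def by (rule TT_ext_linear[OF module_T reassemble_bilinear])

lemma reassemble_pt: "u \<in> carrier T \<Longrightarrow> v \<in> carrier T \<Longrightarrow> reassemble (u \<boxtimes> v) = prep (proj u) v"
  unfolding reassemble_def by (simp add: TT_ext_pure[OF module_T reassemble_bilinear])

text \<open>Cofreeness: an element is recovered from its coproduct by splitting off
  the first letter, so a coalgebra morphism into \<open>T\<close> is determined recursively by its projection.\<close>

lemma reassemble_\<Delta>:
  assumes "t \<in> carrier T"
  shows "t = \<epsilon> t \<odot>\<^bsub>T\<^esub> word [] \<oplus>\<^bsub>T\<^esub> reassemble (\<Delta> t)"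
proof (rule T_agree[OF module_T linear_map_ident linear_map_plus[OF module_T
        linear_map_self_scale[OF module_T \<epsilon>_linear] linear_map_comp[OF \<Delta>_linear reassemble_linear]] _ assms])
  fix xs assume xs: "over_R xs"
  show "word xs = \<epsilon> (word xs) \<odot>\<^bsub>T\<^esub> word [] \<oplus>\<^bsub>T\<^esub> reassemble (\<Delta> (word xs))"
  proof (cases xs)
    case Nil
    then show ?thesis by (simp add: \<Delta>_one reassemble_pt proj_word \<epsilon>_word)
  next
    case (Cons x ys)
    have "prep x (word ys) = word xs" using xs Cons by (simp add: prep_word)
    \<comment> \<open>Only the cut after the first letter has a left piece of length one; all other
      left pieces project to zero.\<close>
    then have "reassemble (\<Delta> (word xs)) = word xs"
      unfolding linear_\<Delta>_word[OF module_T reassemble_linear xs] using xs Cons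
      by (subst T.M.finsum_delta[where a=1]) (auto simp: reassemble_pt proj_word min_def)
    then show ?thesis using xs Cons by (simp add: \<epsilon>_word)
  qed
qed simp

definition prep2 :: "'v \<Rightarrow> (('k, 'v) tc \<times> ('k, 'v) tc \<Rightarrow> 'k) set \<Rightarrow> (('k, 'v) tc \<times> ('k, 'v) tc \<Rightarrow> 'k) set" where
  "prep2 x = tensor_map K T T (prep x) (\<lambda>t. t)"

lemma prep2_linear: "x \<in> carrier R \<Longrightarrow> linear_map K TT TT (prep2 x)"
  unfolding prep2_def
  by (rule linear_tensor_map[OF module_T module_T module_T module_T bilinear_map_right[OF prep_bilinear] linear_map_ident])

lemma prep2_pt: "x \<in> carrier R \<Longrightarrow> s \<in> carrier T \<Longrightarrow> t \<in> carrier T \<Longrightarrow> prep2 x (s \<boxtimes> t) = prep x s \<boxtimes> t"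
  unfolding prep2_def
  by (rule tensor_map_pure[OF module_T module_T module_T module_T bilinear_map_right[OF prep_bilinear] linear_map_ident])

text \<open>The cut before the new letter gives the first term; every other cut keeps that letter at
  the head of the left factor. This has the form of a Hochschild one-cocycle identity and carries
  the inductive proof that the recursively defined product is compatible with \<Delta>.\<close>

lemma \<Delta>_prep:
  assumes x: "x \<in> carrier R" and t: "t \<in> carrier T"
  shows "\<Delta> (prep x t) = word [] \<boxtimes> prep x t \<oplus>\<^bsub>TT\<^esub> prep2 x (\<Delta> t)"
proof (rule T_agree[OF module_TT _ _ _ t])
  note p = bilinear_map_right[OF prep_bilinear x]
  show "linear_map K T TT (\<lambda>t. \<Delta> (prep x t))"
    by (rule linear_map_comp[OF p \<Delta>_linear])
  show "linear_map K T TT (\<lambda>t. word [] \<boxtimes> prep x t \<oplus>\<^bsub>TT\<^esub> prep2 x (\<Delta> t))"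
    by (intro linear_map_plus[OF module_TT] linear_map_comp[OF p bilinear_map_right[OF pt_bilinear]]
        linear_map_comp[OF \<Delta>_linear prep2_linear] x) simp
  fix xs assume xs: "over_R xs"
  have "\<Delta> (prep x (word xs)) = (\<Oplus>\<^bsub>TT\<^esub>i\<in>{..Suc (length xs)}. word (take i (x # xs)) \<boxtimes> word (drop i (x # xs)))"
    using xs x by (simp add: prep_word \<Delta>_word)
  also have "\<dots> = word [] \<boxtimes> word (x # xs) \<oplus>\<^bsub>TT\<^esub> (\<Oplus>\<^bsub>TT\<^esub>i\<in>{..length xs}. word (x # take i xs) \<boxtimes> word (drop i xs))"
    using xs x by (subst TT.M.finsum_atMost_Suc_shift) (auto intro!: pt_closed word_closed over_R_take over_R_drop simp del: take_Suc_Cons drop_Suc_Cons simp: take_Cons' drop_Cons')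
  also have "(\<Oplus>\<^bsub>TT\<^esub>i\<in>{..length xs}. word (x # take i xs) \<boxtimes> word (drop i xs)) = prep2 x (\<Delta> (word xs))"
    unfolding linear_\<Delta>_word[OF module_TT prep2_linear[OF x] xs]
    using xs x by (intro finsum_cong_on) (simp add: prep2_pt prep_word)
  finally show "\<Delta> (prep x (word xs)) = word [] \<boxtimes> prep x (word xs) \<oplus>\<^bsub>TT\<^esub> prep2 x (\<Delta> (word xs))"
    using xs x by (simp add: prep_word)
qed

lemma \<epsilon>_prep:
  assumes x: "x \<in> carrier R" and t: "t \<in> carrier T"
  shows "\<epsilon> (prep x t) = \<zero>\<^bsub>K\<^esub>"
proof -
  have "\<epsilon> (prep x t) = \<zero>\<^bsub>self_module K\<^esub>"
    by (rule T_agree[OF module_self linear_map_comp[OF bilinear_map_right[OF prep_bilinear x] \<epsilon>_linear]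
          linear_map_const_zero[OF module_self] _ t])
      (use x in \<open>simp add: prep_word \<epsilon>_word\<close>)
  then show ?thesis by simp
qed

text \<open>Prepending a letter reaches degree one only from the empty word, whose coefficient is
  what the counit reads.\<close>

lemma proj_prep:
  assumes x: "x \<in> carrier R" and t: "t \<in> carrier T"
  shows "proj (prep x t) = \<epsilon> t \<odot>\<^bsub>R\<^esub> x"
  by (rule T_agree[OF module_R linear_map_comp[OF bilinear_map_right[OF prep_bilinear x] proj_linear]
        linear_map_self_scale[OF module_R \<epsilon>_linear x] _ t])
    (use x in \<open>auto simp: prep_word proj_word \<epsilon>_word\<close>)

end

section \<open>Recursion over pairs of words\<close>

text \<open>The indices are the cut positions, ends included, of two words of lengths
  \<open>p\<close> and \<open>q\<close>.\<close>

definition dsum :: "('a, 'm) ring_scheme \<Rightarrow> nat \<Rightarrow> nat \<Rightarrow> (nat \<Rightarrow> nat \<Rightarrow> 'a) \<Rightarrow> 'a" where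
  "dsum G p q f = (\<Oplus>\<^bsub>G\<^esub>i\<in>{..p}. \<Oplus>\<^bsub>G\<^esub>j\<in>{..q}. f i j)"

lemma dsum_cong:
  "(\<And>i j. i \<le> p \<Longrightarrow> j \<le> q \<Longrightarrow> f i j = g i j) \<Longrightarrow> dsum G p q f = dsum G p q g"
  unfolding dsum_def by (intro finsum_cong_on) auto

context abelian_monoid
begin

lemma dsum_closed [intro, simp]:
  "(\<And>i j. i \<le> p \<Longrightarrow> j \<le> q \<Longrightarrow> f i j \<in> carrier G) \<Longrightarrow> dsum G p q f \<in> carrier G"
  unfolding dsum_def by auto

lemma dsum_add:
  assumes "\<And>i j. i \<le> p \<Longrightarrow> j \<le> q \<Longrightarrow> f i j \<in> carrier G" "\<And>i j. i \<le> p \<Longrightarrow> j \<le> q \<Longrightarrow> g i j \<in> carrier G"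
  shows "dsum G p q (\<lambda>i j. f i j \<oplus> g i j) = dsum G p q f \<oplus> dsum G p q g"
proof -
  have "dsum G p q (\<lambda>i j. f i j \<oplus> g i j) = (\<Oplus>i\<in>{..p}. (\<Oplus>j\<in>{..q}. f i j) \<oplus> (\<Oplus>j\<in>{..q}. g i j))"
    unfolding dsum_def by (intro finsum_cong_on finsum_add) (use assms in auto)
  also have "\<dots> = dsum G p q f \<oplus> dsum G p q g"
    unfolding dsum_def by (intro finsum_add) (use assms in auto)
  finally show ?thesis .
qed

lemma dsum_eq_zero: "(\<And>i j. i \<le> p \<Longrightarrow> j \<le> q \<Longrightarrow> f i j = \<zero>) \<Longrightarrow> dsum G p q f = \<zero>"
  unfolding dsum_def by (intro finsum_eq_zero) auto

lemma dsum_delta: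
  assumes "a \<le> p" "b \<le> q" "f a b \<in> carrier G" "\<And>i j. i \<le> p \<Longrightarrow> j \<le> q \<Longrightarrow> (i, j) \<noteq> (a, b) \<Longrightarrow> f i j = \<zero>"
  shows "dsum G p q f = f a b"
proof -
  have in_cl: "f i j \<in> carrier G" if "i \<le> p" "j \<le> q" for i j
    using assms that by (cases "(i, j) = (a, b)") auto
  have "dsum G p q f = (\<Oplus>j\<in>{..q}. f a j)"
    unfolding dsum_def by (rule finsum_delta) (use assms in_cl in \<open>auto intro!: finsum_eq_zero\<close>)
  also have "\<dots> = f a b" by (rule finsum_delta) (use assms in_cl in auto)
  finally show ?thesis .
qed

lemma dsum_zero_right:
  "(\<And>i. i \<le> p \<Longrightarrow> f i 0 \<in> carrier G) \<Longrightarrow> dsum G p 0 f = (\<Oplus>i\<in>{..p}. f i 0)"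
  unfolding dsum_def by (intro finsum_cong_on) (simp add: finsum_one)

text \<open>\<open>finsum_triangle\<close> in both coordinates at once: two words are cut twice, and
  the second pair of cuts is recounted from the first one.\<close>

lemma dsum_triangle:
  assumes cl: "\<And>a b i j. i \<le> a \<Longrightarrow> a \<le> p \<Longrightarrow> j \<le> b \<Longrightarrow> b \<le> q \<Longrightarrow> f i j a b \<in> carrier G"
  shows "dsum G p q (\<lambda>a b. dsum G a b (\<lambda>i j. f i j a b))
       = dsum G p q (\<lambda>i j. dsum G (p - i) (q - j) (\<lambda>k l. f i j (i + k) (j + l)))"
proof -
  have "dsum G p q (\<lambda>a b. dsum G a b (\<lambda>i j. f i j a b))
      = (\<Oplus>a\<in>{..p}. \<Oplus>i\<in>{..a}. \<Oplus>b\<in>{..q}. \<Oplus>j\<in>{..b}. f i j a b)"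
    unfolding dsum_def by (intro finsum_cong_on finsum_swap) (use cl in auto)
  also have "\<dots> = (\<Oplus>a\<in>{..p}. \<Oplus>i\<in>{..a}. \<Oplus>j\<in>{..q}. \<Oplus>l\<in>{..q - j}. f i j a (j + l))"
    by (intro finsum_cong_on finsum_triangle) (use cl in auto)
  also have "\<dots> = (\<Oplus>i\<in>{..p}. \<Oplus>k\<in>{..p - i}. \<Oplus>j\<in>{..q}. \<Oplus>l\<in>{..q - j}. f i j (i + k) (j + l))"
    by (rule finsum_triangle) (use cl in auto)
  also have "\<dots> = dsum G p q (\<lambda>i j. dsum G (p - i) (q - j) (\<lambda>k l. f i j (i + k) (j + l)))"
    unfolding dsum_def by (intro finsum_cong_on finsum_swap) (use cl in auto)
  finally show ?thesis .
qed

lemma finsum_dsum_swap: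
  assumes "finite A" "\<And>a i j. a \<in> A \<Longrightarrow> i \<le> p \<Longrightarrow> j \<le> q \<Longrightarrow> f a i j \<in> carrier G"
  shows "(\<Oplus>a\<in>A. dsum G p q (f a)) = dsum G p q (\<lambda>i j. \<Oplus>a\<in>A. f a i j)"
proof -
  have "(\<Oplus>a\<in>A. dsum G p q (f a)) = (\<Oplus>i\<in>{..p}. \<Oplus>a\<in>A. \<Oplus>j\<in>{..q}. f a i j)"
    unfolding dsum_def by (intro finsum_swap) (use assms in auto)
  also have "\<dots> = dsum G p q (\<lambda>i j. \<Oplus>a\<in>A. f a i j)"
    unfolding dsum_def by (intro finsum_cong_on finsum_swap) (use assms in auto)
  finally show ?thesis .
qed

end

lemma linear_map_dsum:
  assumes "module K V" "module K W" "linear_map K V W f"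
    "\<And>i j. i \<le> p \<Longrightarrow> j \<le> q \<Longrightarrow> g i j \<in> carrier V"
  shows "f (dsum V p q g) = dsum W p q (\<lambda>i j. f (g i j))"
proof -
  interpret V: module K V by fact
  show ?thesis unfolding dsum_def
  proof (subst linear_map_finsum[OF assms(1-3)])
    show "(\<Oplus>\<^bsub>W\<^esub>i\<in>{..p}. f (\<Oplus>\<^bsub>V\<^esub>j\<in>{..q}. g i j)) = (\<Oplus>\<^bsub>W\<^esub>i\<in>{..p}. \<Oplus>\<^bsub>W\<^esub>j\<in>{..q}. f (g i j))"
      by (intro finsum_cong_on linear_map_finsum[OF assms(1-3)]) (use assms(4) in auto)
  qed (use assms(4) in auto)
qed

text \<open>An abstraction with two uses. With \<open>prep\<close> acting and coefficients in
  \<open>R\<close> the solution is the product of two words; with the product itself acting and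
  coefficients in \<open>T\<close> it yields the antipode.\<close>

locale word_recursion = tensor_space K R for K :: "'k ring" and R :: "('k, 'v) module" +
  fixes V :: "('k, 'a) module" and act :: "'a \<Rightarrow> ('k, 'v) tc \<Rightarrow> ('k, 'v) tc" and h :: "'v list \<Rightarrow> 'v list \<Rightarrow> 'a"
  assumes module_V: "module K V"
    and act_bilinear: "bilinear_map K V T T act"
    and h_right: "\<And>xs. over_R xs \<Longrightarrow> multilinear_map K R V (h xs)"
    and h_left: "\<And>ys. over_R ys \<Longrightarrow> multilinear_map K R V (\<lambda>xs. h xs ys)"
    and h_Nil: "h [] [] = \<zero>\<^bsub>V\<^esub>"
begin

lemmas act_closed [simp, intro] = bilinear_map_closed[OF act_bilinear]
lemmas act_left = bilinear_map_left[OF act_bilinear]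
lemmas act_right = bilinear_map_right[OF act_bilinear]

lemma h_closed [simp, intro]: "over_R xs \<Longrightarrow> over_R ys \<Longrightarrow> h xs ys \<in> carrier V"
  using multilinear_map_closed[OF h_right] .

lemma act_zero [simp]: "t \<in> carrier T \<Longrightarrow> act \<zero>\<^bsub>V\<^esub> t = \<zero>\<^bsub>T\<^esub>"
  using linear_map_zero[OF module_V module_T act_left] .

text \<open>The nested conditionals have the shape of \<open>multilinear_map_if_Nil\<close> in
  either variable.\<close>

definition unit_at :: "'v list \<Rightarrow> 'v list \<Rightarrow> ('k, 'v) tc" where
  "unit_at xs ys = (if xs = [] then if ys = [] then word [] else \<zero>\<^bsub>T\<^esub> else \<zero>\<^bsub>T\<^esub>)"

definition step :: "('v list \<Rightarrow> 'v list \<Rightarrow> ('k, 'v) tc) \<Rightarrow> 'v list \<Rightarrow> 'v list \<Rightarrow> ('k, 'v) tc" where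
  "step F xs ys = unit_at xs ys \<oplus>\<^bsub>T\<^esub> dsum T (length xs) (length ys)
     (\<lambda>i j. act (h (take i xs) (take j ys)) (F (drop i xs) (drop j ys)))"

text \<open>The cut that takes nothing calls the recursion on the same pair of words and is harmless
  only because \<open>h [] []\<close> is zero, so termination is not syntactic. Iterating
  \<open>step\<close> avoids the issue, and \<open>n\<close> iterations later turn out to collect
  the concatenations of at most \<open>n\<close> operations.\<close>

primrec approx :: "nat \<Rightarrow> 'v list \<Rightarrow> 'v list \<Rightarrow> ('k, 'v) tc" where
  "approx 0 = unit_at"
| "approx (Suc n) = step (approx n)"

text \<open>Every cut with a possibly nonzero coefficient removes at least one letter, so the total
  length bounds the number of iterations required.\<close>

definition solution :: "'v list \<Rightarrow> 'v list \<Rightarrow> ('k, 'v) tc" where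
  "solution xs ys = approx (length xs + length ys) xs ys"

lemma unit_at_closed [simp, intro]: "unit_at xs ys \<in> carrier T"
  by (auto simp: unit_at_def)

lemma step_closed:
  "(\<And>xs ys. over_R xs \<Longrightarrow> over_R ys \<Longrightarrow> F xs ys \<in> carrier T) \<Longrightarrow> over_R xs \<Longrightarrow> over_R ys \<Longrightarrow>
     step F xs ys \<in> carrier T"
  unfolding step_def by auto

lemma approx_closed [simp, intro]: "over_R xs \<Longrightarrow> over_R ys \<Longrightarrow> approx n xs ys \<in> carrier T"
  by (induction n arbitrary: xs ys) (auto intro: step_closed)

lemma solution_closed [simp, intro]: "over_R xs \<Longrightarrow> over_R ys \<Longrightarrow> solution xs ys \<in> carrier T"
  by (simp add: solution_def)

text \<open>As \<open>h [] [] = 0\<close>, the recursion only calls itself on smaller pairs of words.\<close>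

lemma step_cong:
  assumes xs: "over_R xs" and ys: "over_R ys"
    and F: "\<And>xs ys. over_R xs \<Longrightarrow> over_R ys \<Longrightarrow> F xs ys \<in> carrier T"
    and G: "\<And>xs ys. over_R xs \<Longrightarrow> over_R ys \<Longrightarrow> G xs ys \<in> carrier T"
    and eq: "\<And>us vs. over_R us \<Longrightarrow> over_R vs \<Longrightarrow> length us + length vs < length xs + length ys \<Longrightarrow> F us vs = G us vs"
  shows "step F xs ys = step G xs ys"
  unfolding step_def
proof (rule arg_cong[where f="\<lambda>t. unit_at xs ys \<oplus>\<^bsub>T\<^esub> t"], rule dsum_cong)
  fix i j assume ij: "i \<le> length xs" "j \<le> length ys"
  show "act (h (take i xs) (take j ys)) (F (drop i xs) (drop j ys))
      = act (h (take i xs) (take j ys)) (G (drop i xs) (drop j ys))"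
  proof (cases "i = 0 \<and> j = 0")
    case True
    then show ?thesis using F G xs ys by (simp add: h_Nil)
  next
    case False
    then show ?thesis using eq[of "drop i xs" "drop j ys"] xs ys ij by auto
  qed
qed

lemma approx_stable:
  assumes "over_R xs" "over_R ys" "length xs + length ys \<le> n" "length xs + length ys \<le> m"
  shows "approx n xs ys = approx m xs ys"
  using assms
proof (induction "length xs + length ys" arbitrary: xs ys n m rule: less_induct)
  case less
  have base: "approx (Suc k) xs ys = approx 0 xs ys" if "length xs + length ys = 0" for k
    using that by (simp add: step_def h_Nil T.M.dsum_eq_zero)
  have key: "approx (Suc k) xs ys = approx (Suc l) xs ys" if "length xs + length ys \<le> Suc k" "length xs + length ys \<le> Suc l" for k l
    unfolding approx.simps
    by (rule step_cong[OF less.prems(1,2)]) (use less.hyps that in auto)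
  let ?s = "length xs + length ys"
  have "approx n xs ys = approx (Suc ?s) xs ys" if "?s \<le> n" for n
  proof (cases n)
    case 0
    then show ?thesis using base[of ?s] that by simp
  next
    case (Suc k)
    then show ?thesis using key[of k ?s] that by simp
  qed
  then show ?case using less.prems(3,4) by metis
qed

lemma solution_step:
  assumes "over_R xs" "over_R ys"
  shows "solution xs ys = step solution xs ys"
proof -
  have "solution xs ys = step (approx (length xs + length ys)) xs ys"
    unfolding solution_def using approx_stable[OF assms, of "length xs + length ys" "Suc (length xs + length ys)"] by simp
  also have "\<dots> = step solution xs ys"
    by (rule step_cong[OF assms]) (auto simp: solution_def intro: approx_stable)
  finally show ?thesis .
qed

text \<open>Well founded by total length, like \<open>approx_stable\<close>. It identifies a given
  product with the one rebuilt from its braces.\<close>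

lemma solution_unique:
  assumes F: "\<And>xs ys. over_R xs \<Longrightarrow> over_R ys \<Longrightarrow> F xs ys \<in> carrier T"
    and eq: "\<And>xs ys. over_R xs \<Longrightarrow> over_R ys \<Longrightarrow> F xs ys = step F xs ys"
    and "over_R xs" "over_R ys"
  shows "F xs ys = solution xs ys"
  using assms(3,4)
proof (induction "length xs + length ys" arbitrary: xs ys rule: less_induct)
  case less
  have "F xs ys = step F xs ys" by (rule eq[OF less.prems])
  also have "\<dots> = step solution xs ys"
    by (rule step_cong[OF less.prems F]) (use less.hyps in auto)
  finally show ?case using solution_step[OF less.prems] by simp
qed

lemma unit_at_multilinear:
  shows "multilinear_map K R T (\<lambda>xs. unit_at xs ys)" and "multilinear_map K R T (unit_at xs)"
  unfolding unit_at_def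
  by (intro multilinear_map_if_Nil multilinear_map_const_zero module_T, simp)
    (cases "xs = []"; auto intro!: multilinear_map_if_Nil multilinear_map_const_zero module_T)

text \<open>At fixed cuts each word is shared between \<open>h\<close> and the previous iterate, so
  \<open>multilinear_map_split\<close> applies to one word while the other is held fixed.\<close>

lemma approx_multilinear:
  "(\<forall>ys. over_R ys \<longrightarrow> multilinear_map K R T (\<lambda>xs. approx n xs ys)) \<and>
   (\<forall>xs. over_R xs \<longrightarrow> multilinear_map K R T (approx n xs))"
proof (induction n)
  case 0
  show ?case by (simp add: unit_at_multilinear)
next
  case (Suc n)
  note IH = Suc.IH[THEN conjunct1, rule_format] Suc.IH[THEN conjunct2, rule_format]
  have split1: "multilinear_map K R T (\<lambda>xs. act (h (take i xs) us) (approx n (drop i xs) vs))"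
    if "over_R us" "over_R vs" for us vs i
  proof (rule multilinear_map_split[where b="\<lambda>xs xs'. act (h xs us) (approx n xs' vs)"])
    show "multilinear_map K R T (\<lambda>xs'. act (h xs us) (approx n xs' vs))" if "over_R xs" for xs
      by (rule multilinear_map_comp[OF IH(1) act_right]) (use that \<open>over_R us\<close> \<open>over_R vs\<close> in auto)
    show "multilinear_map K R T (\<lambda>xs. act (h xs us) (approx n xs' vs))" if "over_R xs'" for xs'
      by (rule multilinear_map_comp[OF h_left act_left]) (use that \<open>over_R us\<close> \<open>over_R vs\<close> in auto)
  qed
  have split2: "multilinear_map K R T (\<lambda>ys. act (h us (take j ys)) (approx n vs (drop j ys)))"
    if "over_R us" "over_R vs" for us vs j
  proof (rule multilinear_map_split[where b="\<lambda>ys ys'. act (h us ys) (approx n vs ys')"])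
    show "multilinear_map K R T (\<lambda>ys'. act (h us ys) (approx n vs ys'))" if "over_R ys" for ys
      by (rule multilinear_map_comp[OF IH(2) act_right]) (use that \<open>over_R us\<close> \<open>over_R vs\<close> in auto)
    show "multilinear_map K R T (\<lambda>ys. act (h us ys) (approx n vs ys'))" if "over_R ys'" for ys'
      by (rule multilinear_map_comp[OF h_right act_left]) (use that \<open>over_R us\<close> \<open>over_R vs\<close> in auto)
  qed
  have "multilinear_map K R T (\<lambda>xs. approx (Suc n) xs ys)" if "over_R ys" for ys
    unfolding approx.simps step_def dsum_def
    by (intro multilinear_map_plus[OF module_T unit_at_multilinear(1)] multilinear_map_length_sum[OF module_T, where A="\<lambda>n. {..n}"]
        multilinear_map_sum[OF module_T] split1) (use that in auto)
  moreover have "multilinear_map K R T (approx (Suc n) xs)" if "over_R xs" for xs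
    unfolding approx.simps step_def dsum_def
    by (intro multilinear_map_plus[OF module_T unit_at_multilinear(2)] multilinear_map_sum[OF module_T]
        multilinear_map_length_sum[OF module_T, where A="\<lambda>n. {..n}"] split2) (use that in auto)
  ultimately show ?case by blast
qed

lemma solution_left: "over_R ys \<Longrightarrow> multilinear_map K R T (\<lambda>xs. solution xs ys)"
  unfolding solution_def by (rule multilinear_map_length) (simp add: approx_multilinear)

lemma solution_right: "over_R xs \<Longrightarrow> multilinear_map K R T (solution xs)"
  unfolding solution_def by (rule multilinear_map_length) (simp add: approx_multilinear)

end

section \<open>Bialgebra structures on the tensor coalgebra\<close>

text \<open>The algebra record differs from the tensor coalgebra only in its product and unit. These
  rules and the following ones rewrite linear notions over the algebra to the same notions over the
  underlying space.\<close>

lemma tc_algebra_simps [simp]: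
  "carrier (tc_algebra K R star) = carrier (tensor_coalg K R)"
  "zero (tc_algebra K R star) = zero (tensor_coalg K R)"
  "add (tc_algebra K R star) = add (tensor_coalg K R)"
  "smult (tc_algebra K R star) = smult (tensor_coalg K R)"
  "mult (tc_algebra K R star) = star"
  "one (tc_algebra K R star) = tc_word K R []"
  by (simp_all add: tc_algebra_def)

lemma finsum_tc_algebra [simp]: "finsum (tc_algebra K R star) = finsum (tensor_coalg K R)"
  by (simp add: finsum_def)

lemma linear_ext_tc_algebra [simp]:
  "linear_ext K (tc_algebra K R star) = linear_ext K (tensor_coalg K R)"
  by (intro ext) (simp add: linear_ext_def)

lemma linear_map_tc_algebra [simp]:
  "linear_map K V (tc_algebra K R star) = linear_map K V (tensor_coalg K R)"
  "linear_map K (tc_algebra K R star) W = linear_map K (tensor_coalg K R) W"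
  by (intro ext, simp add: linear_map_def)+

lemma tensor_tc_algebra [simp]:
  "tensor K (tc_algebra K R star) W = tensor K (tensor_coalg K R) W"
  "tensor K V (tc_algebra K R star) = tensor K V (tensor_coalg K R)"
  by (simp_all add: tensor_def tensor_relators_def)

lemma pure_tensor_tc_algebra [simp]:
  "pure_tensor K (tc_algebra K R star) W = pure_tensor K (tensor_coalg K R) W"
  "pure_tensor K V (tc_algebra K R star) = pure_tensor K V (tensor_coalg K R)"
  by (intro ext, simp add: pure_tensor_def tensor_relators_def)+

lemma tensor_map_tc_algebra [simp]:
  "tensor_map K (tc_algebra K R star) W = tensor_map K (tensor_coalg K R) W"
  "tensor_map K V (tc_algebra K R star) = tensor_map K V (tensor_coalg K R)"
  by (intro ext, simp add: tensor_map_def)+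

lemma tensor_assoc_tc_algebra [simp]:
  "tensor_assoc K (tc_algebra K R star) (tc_algebra K R star) (tc_algebra K R star)
     = tensor_assoc K (tensor_coalg K R) (tensor_coalg K R) (tensor_coalg K R)"
  by (intro ext) (simp add: tensor_assoc_def)

lemma abelian_group_tc_algebra [simp]:
  "abelian_group (tc_algebra K R star) \<longleftrightarrow> abelian_group (tensor_coalg K R)"
  by (simp add: abelian_group_def abelian_monoid_def abelian_group_axioms_def)

lemma module_tc_algebra [simp]: "module K (tc_algebra K R star) \<longleftrightarrow> module K (tensor_coalg K R)"
  by (simp add: module_def module_axioms_def)

lemma coalgebra_tc_algebra [simp]: "coalgebra K (tc_algebra K R star) = coalgebra K (tensor_coalg K R)"
  by (intro ext) (simp add: coalgebra_def)

section \<open>Bilinear products on the tensor coalgebra and the product of its tensor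
  square\<close>

locale tensor_product = tensor_space K R for K :: "'k ring" and R :: "('k, 'v) module" +
  fixes star :: "('k, 'v) tc \<Rightarrow> ('k, 'v) tc \<Rightarrow> ('k, 'v) tc"
  assumes star_bilinear: "bilinear_map K T T T star"
begin

lemmas star_closed [simp, intro] = bilinear_map_closed[OF star_bilinear]
lemmas star_left = bilinear_map_left[OF star_bilinear]
lemmas star_right = bilinear_map_right[OF star_bilinear]

abbreviation "tsm \<equiv> tensor_square_mult K (tc_algebra K R star)"

lemma tsm_inner:
  assumes "a \<in> carrier T" "b \<in> carrier T"
  shows "bilinear_map K T T TT (\<lambda>c d. case (c, d) of (c, d) \<Rightarrow> star a c \<boxtimes> star b d)"
  unfolding prod.case by (rule bilinear_map_comp[OF pt_bilinear star_right star_right]) fact+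

lemma tsm_inner':
  assumes "c \<in> carrier T" "d \<in> carrier T"
  shows "bilinear_map K T T TT (\<lambda>a b. star a c \<boxtimes> star b d)"
  by (rule bilinear_map_comp[OF pt_bilinear star_left star_left]) fact+

text \<open>The product of the tensor square is a nested extension; linearity of the inner extension
  in \<open>a\<close> and in \<open>b\<close> is what lets the outer one be evaluated on pure
  tensors.\<close>

lemma tsm_outer:
  assumes Y: "Y \<in> carrier TT"
  shows "bilinear_map K T T TT
    (\<lambda>a b. case (a, b) of (a, b) \<Rightarrow> linear_ext K TT (\<lambda>(c, d). star a c \<boxtimes> star b d) Y)"
  unfolding prod.case
proof (rule bilinear_mapI)
  fix a assume a: "a \<in> carrier T"
  have "bilinear_map K T TT TT (\<lambda>b. linear_ext K TT (\<lambda>(c, d). star a c \<boxtimes> star b d))"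
    by (rule bilinear_tensor_ext[OF module_T module_T module_T module_TT tsm_inner[OF a]])
      (use bilinear_map_right[OF tsm_inner' a] in auto)
  then show "linear_map K T TT (\<lambda>b. linear_ext K TT (\<lambda>(c, d). star a c \<boxtimes> star b d) Y)"
    using Y by (rule bilinear_map_left)
next
  fix b assume b: "b \<in> carrier T"
  have "bilinear_map K T TT TT (\<lambda>a. linear_ext K TT (\<lambda>(c, d). star a c \<boxtimes> star b d))"
    by (rule bilinear_tensor_ext[OF module_T module_T module_T module_TT tsm_inner[OF _ b]])
      (use bilinear_map_left[OF tsm_inner' b] in auto)
  then show "linear_map K T TT (\<lambda>a. linear_ext K TT (\<lambda>(c, d). star a c \<boxtimes> star b d) Y)"
    using Y by (rule bilinear_map_left)
qed

lemma tsm_bilinear: "bilinear_map K TT TT TT tsm"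
proof -
  have "bilinear_map K TT TT TT
    (\<lambda>Y X. linear_ext K TT (\<lambda>(a, b). linear_ext K TT (\<lambda>(c, d). star a c \<boxtimes> star b d) Y) X)"
    by (rule bilinear_tensor_ext[OF module_TT module_T module_T module_TT tsm_outer])
      (auto intro: TT_ext_linear[OF module_TT tsm_inner])
  moreover have "tsm = (\<lambda>X Y. linear_ext K TT (\<lambda>(a, b). linear_ext K TT (\<lambda>(c, d). star a c \<boxtimes> star b d) Y) X)"
    by (intro ext) (simp add: tensor_square_mult_def Let_def)
  ultimately show ?thesis
    by (auto simp: bilinear_map_def)
qed

lemma tsm_pt:
  assumes "a \<in> carrier T" "b \<in> carrier T" "c \<in> carrier T" "d \<in> carrier T"
  shows "tsm (a \<boxtimes> b) (c \<boxtimes> d) = star a c \<boxtimes> star b d"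
  using assms by (simp add: tensor_square_mult_def Let_def TT_ext_pure[OF module_TT tsm_outer] TT_ext_pure[OF module_TT tsm_inner])

lemma tsm_\<Delta>_word:
  assumes "over_R xs" "over_R ys"
  shows "tsm (\<Delta> (word xs)) (\<Delta> (word ys)) = dsum TT (length xs) (length ys)
    (\<lambda>i j. star (word (take i xs)) (word (take j ys)) \<boxtimes> star (word (drop i xs)) (word (drop j ys)))"
proof -
  note l = bilinear_map_left[OF tsm_bilinear \<Delta>_closed[OF word_closed[OF assms(2)]]]
  show ?thesis
    unfolding linear_\<Delta>_word[OF module_TT l assms(1)] dsum_def
  proof (intro finsum_cong_on)
    fix i
    have "linear_map K TT TT (tsm (word (take i xs) \<boxtimes> word (drop i xs)))"
      using assms by (intro bilinear_map_right[OF tsm_bilinear]) auto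
    from linear_\<Delta>_word[OF module_TT this assms(2)] show
      "tsm (word (take i xs) \<boxtimes> word (drop i xs)) (\<Delta> (word ys)) = (\<Oplus>\<^bsub>TT\<^esub>j\<in>{..length ys}.
        star (word (take i xs)) (word (take j ys)) \<boxtimes> star (word (drop i xs)) (word (drop j ys)))"
      using assms by (simp add: tsm_pt)
  qed
qed

end

text \<open>Associativity is postponed to \<open>star_monoid\<close>: a product built from braces
  satisfies these axioms at once, and associativity is then deduced from the multibrace relations by
  means of this locale.\<close>

locale star_bialgebra = tensor_product K R star for K :: "'k ring" and R :: "('k, 'v) module" and star +
  assumes \<Delta>_star: "\<And>s t. s \<in> carrier T \<Longrightarrow> t \<in> carrier T \<Longrightarrow> \<Delta> (star s t) = tsm (\<Delta> s) (\<Delta> t)"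
    and \<epsilon>_star: "\<And>s t. s \<in> carrier T \<Longrightarrow> t \<in> carrier T \<Longrightarrow> \<epsilon> (star s t) = \<epsilon> s \<otimes>\<^bsub>K\<^esub> \<epsilon> t"
    and star_one_left: "\<And>t. t \<in> carrier T \<Longrightarrow> star (word []) t = t"
    and star_one_right: "\<And>t. t \<in> carrier T \<Longrightarrow> star t (word []) = t"
begin

definition brace :: "'v list \<Rightarrow> 'v list \<Rightarrow> 'v" where
  "brace xs ys = proj (star (word xs) (word ys))"

lemma brace_right: "over_R xs \<Longrightarrow> multilinear_map K R R (brace xs)"
  unfolding brace_def by (intro multilinear_map_comp[OF word_multilinear] linear_map_comp[OF star_right proj_linear]) auto

lemma brace_left: "over_R ys \<Longrightarrow> multilinear_map K R R (\<lambda>xs. brace xs ys)"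
  unfolding brace_def by (intro multilinear_map_comp[OF word_multilinear] linear_map_comp[OF star_left proj_linear]) auto

lemma brace_Nil_left: "over_R ys \<Longrightarrow> brace [] ys = (if length ys = 1 then hd ys else \<zero>\<^bsub>R\<^esub>)"
  by (simp add: brace_def star_one_left proj_word)

lemma brace_Nil_right: "over_R xs \<Longrightarrow> brace xs [] = (if length xs = 1 then hd xs else \<zero>\<^bsub>R\<^esub>)"
  by (simp add: brace_def star_one_right proj_word)

sublocale braces: word_recursion K R R prep brace
  by unfold_locales
    (auto simp: module_R prep_bilinear brace_right brace_left brace_Nil_left)

text \<open>\<open>reassemble_\<Delta>\<close> applied to the product is the recursion: the counit
  gives \<open>unit_at\<close>, and multiplicativity of \<Delta> gives the sum over cuts, with
  \<open>brace\<close> as projection of the left factor.\<close>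

lemma star_words:
  assumes "over_R xs" "over_R ys"
  shows "star (word xs) (word ys) = braces.solution xs ys"
proof (rule braces.solution_unique[OF _ _ assms, where F="\<lambda>xs ys. star (word xs) (word ys)"])
  fix xs ys assume xy: "over_R xs" "over_R ys"
  then have cl: "star (word xs) (word ys) \<in> carrier T" by auto
  have "\<epsilon> (star (word xs) (word ys)) \<odot>\<^bsub>T\<^esub> word [] = braces.unit_at xs ys"
    using xy by (simp add: \<epsilon>_star \<epsilon>_word braces.unit_at_def)
  moreover have "reassemble (\<Delta> (star (word xs) (word ys))) = dsum T (length xs) (length ys)
      (\<lambda>i j. prep (brace (take i xs) (take j ys)) (star (word (drop i xs)) (word (drop j ys))))"
    using xy
    by (simp add: \<Delta>_star tsm_\<Delta>_word linear_map_dsum[OF module_TT module_T reassemble_linear] reassemble_pt brace_def)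
  ultimately show "star (word xs) (word ys) = braces.step (\<lambda>xs ys. star (word xs) (word ys)) xs ys"
    using reassemble_\<Delta>[OF cl] by (simp add: braces.step_def)
qed auto

text \<open>Both bracketings of a triple product are coalgebra morphisms \<open>T \<otimes> T \<otimes> T \<rightarrow> T\<close>, hence they
  agree as soon as their projections to \<open>R\<close> do.\<close>

lemma star_assoc_words:
  assumes proj_eq: "\<And>xs ys zs. over_R xs \<Longrightarrow> over_R ys \<Longrightarrow> over_R zs \<Longrightarrow>
      proj (star (star (word xs) (word ys)) (word zs)) = proj (star (word xs) (star (word ys) (word zs)))"
    and "over_R xs" "over_R ys" "over_R zs"
  shows "star (star (word xs) (word ys)) (word zs) = star (word xs) (star (word ys) (word zs))"
  using assms(2-)
proof (induction "length xs + length ys + length zs" arbitrary: xs ys zs rule: less_induct)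
  case less
  define f where "f xs ys zs = star (star (word xs) (word ys)) (word zs)" for xs ys zs
  define g where "g xs ys zs = star (word xs) (star (word ys) (word zs))" for xs ys zs
  note o = less.prems
  have f: "f xs ys zs \<in> carrier T" and g: "g xs ys zs \<in> carrier T"
    if "over_R xs" "over_R ys" "over_R zs" for xs ys zs
    using that by (auto simp: f_def g_def)
  let ?t = "\<lambda>F i j k. prep (proj (F (take i xs) (take j ys) (take k zs))) (F (drop i xs) (drop j ys) (drop k zs))"
  have \<Delta>w: "\<Delta> (word ws) = (\<Oplus>\<^bsub>TT\<^esub>k\<in>{..length ws}. word (take k ws) \<boxtimes> word (drop k ws))" if "over_R ws" for ws
    using that by (rule \<Delta>_word)
  \<comment> \<open>\<open>fin1\<close> and \<open>fin2\<close> expand the coproducts of the two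
    bracketings into triple sums over the cuts of the three words.\<close>
  have fin1: "reassemble (tsm (dsum TT p q F) (\<Delta> (word zs)))
     = dsum T p q (\<lambda>i j. \<Oplus>\<^bsub>T\<^esub>k\<in>{..length zs}. reassemble (tsm (F i j) (word (take k zs) \<boxtimes> word (drop k zs))))"
    if F: "\<And>i j. i \<le> p \<Longrightarrow> j \<le> q \<Longrightarrow> F i j \<in> carrier TT" for p q F
  proof -
    have 1: "linear_map K TT T (\<lambda>X. reassemble (tsm X (\<Delta> (word zs))))"
      using o by (intro linear_map_comp[OF bilinear_map_left[OF tsm_bilinear] reassemble_linear]) auto
    show ?thesis
    proof (subst linear_map_dsum[OF module_TT module_T 1 F], assumption, assumption, rule dsum_cong)
      fix i j assume ij: "i \<le> p" "j \<le> q"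
      have 2: "linear_map K TT T (\<lambda>Y. reassemble (tsm (F i j) Y))"
        using F[OF ij] by (intro linear_map_comp[OF bilinear_map_right[OF tsm_bilinear] reassemble_linear])
      show "reassemble (tsm (F i j) (\<Delta> (word zs)))
        = (\<Oplus>\<^bsub>T\<^esub>k\<in>{..length zs}. reassemble (tsm (F i j) (word (take k zs) \<boxtimes> word (drop k zs))))"
        by (rule linear_\<Delta>_word[OF module_T 2 o(3)])
    qed
  qed
  have fin2: "reassemble (tsm (\<Delta> (word xs)) (dsum TT p q F))
     = (\<Oplus>\<^bsub>T\<^esub>i\<in>{..length xs}. dsum T p q (\<lambda>j k. reassemble (tsm (word (take i xs) \<boxtimes> word (drop i xs)) (F j k))))"
    if F: "\<And>i j. i \<le> p \<Longrightarrow> j \<le> q \<Longrightarrow> F i j \<in> carrier TT" for p q F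
  proof -
    have 1: "linear_map K TT T (\<lambda>X. reassemble (tsm X (dsum TT p q F)))"
      using F by (intro linear_map_comp[OF bilinear_map_left[OF tsm_bilinear] reassemble_linear]) auto
    show ?thesis
    proof (subst linear_\<Delta>_word[OF module_T 1 o(1)], rule finsum_cong_on)
      fix i
      have 2: "linear_map K TT T (\<lambda>Y. reassemble (tsm (word (take i xs) \<boxtimes> word (drop i xs)) Y))"
        using o by (intro linear_map_comp[OF bilinear_map_right[OF tsm_bilinear] reassemble_linear]) auto
      show "reassemble (tsm (word (take i xs) \<boxtimes> word (drop i xs)) (dsum TT p q F))
        = dsum T p q (\<lambda>j k. reassemble (tsm (word (take i xs) \<boxtimes> word (drop i xs)) (F j k)))"
        by (rule linear_map_dsum[OF module_TT module_T 2 F])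
    qed
  qed
  have "f xs ys zs = \<epsilon> (f xs ys zs) \<odot>\<^bsub>T\<^esub> word [] \<oplus>\<^bsub>T\<^esub> reassemble (\<Delta> (f xs ys zs))"
    by (rule reassemble_\<Delta>) (use f o in auto)
  also have "reassemble (\<Delta> (f xs ys zs)) = dsum T (length xs) (length ys) (\<lambda>i j. \<Oplus>\<^bsub>T\<^esub>k\<in>{..length zs}. ?t f i j k)"
    using o by (simp add: f_def \<Delta>_star tsm_\<Delta>_word fin1 tsm_pt reassemble_pt)
  \<comment> \<open>Termwise, the left factors have equal projections by assumption and the right
    factors agree by induction. At the cut 0, 0, 0 the right factors are the full products, but the
    left factor there projects to zero.\<close>
  also have "\<dots> = dsum T (length xs) (length ys) (\<lambda>i j. \<Oplus>\<^bsub>T\<^esub>k\<in>{..length zs}. ?t g i j k)"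
  proof (intro dsum_cong finsum_cong_on)
    fix i j k assume ijk: "i \<le> length xs" "j \<le> length ys" "k \<in> {..length zs}"
    have "proj (f (take i xs) (take j ys) (take k zs)) = proj (g (take i xs) (take j ys) (take k zs))"
      unfolding f_def g_def using o by (intro proj_eq) auto
    moreover have "f (drop i xs) (drop j ys) (drop k zs) = g (drop i xs) (drop j ys) (drop k zs)"
      if "i + j + k > 0"
      unfolding f_def g_def using o ijk that by (intro less.hyps) auto
    moreover have "proj (g [] [] []) = \<zero>\<^bsub>R\<^esub>"
      unfolding g_def by (simp add: star_one_left proj_word)
    ultimately show "?t f i j k = ?t g i j k"
      using f[OF o] g[OF o] by (cases "i + j + k > 0") auto
  qed
  \<comment> \<open>Only the grouping of the triple sum changes, to the one produced by
    \<open>fin2\<close>.\<close>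
  also have "\<dots> = (\<Oplus>\<^bsub>T\<^esub>i\<in>{..length xs}. dsum T (length ys) (length zs) (\<lambda>j k. ?t g i j k))"
    by (simp add: dsum_def)
  also have "\<dots> = reassemble (\<Delta> (g xs ys zs))"
    using o by (simp add: g_def \<Delta>_star tsm_\<Delta>_word fin2 tsm_pt reassemble_pt)
  also have "\<epsilon> (f xs ys zs) = \<epsilon> (g xs ys zs)"
    using o by (simp add: f_def g_def \<epsilon>_star R.R.m_assoc)
  also have "\<epsilon> (g xs ys zs) \<odot>\<^bsub>T\<^esub> word [] \<oplus>\<^bsub>T\<^esub> reassemble (\<Delta> (g xs ys zs)) = g xs ys zs"
    by (rule reassemble_\<Delta>[symmetric]) (use g o in auto)
  finally show ?case by (simp add: f_def g_def)
qed

lemma star_assoc: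
  assumes proj_eq: "\<And>xs ys zs. over_R xs \<Longrightarrow> over_R ys \<Longrightarrow> over_R zs \<Longrightarrow>
      proj (star (star (word xs) (word ys)) (word zs)) = proj (star (word xs) (star (word ys) (word zs)))"
    and r: "r \<in> carrier T" and s: "s \<in> carrier T" and t: "t \<in> carrier T"
  shows "star (star r s) t = star r (star s t)"
proof (rule T_agree[OF module_T _ _ _ t, where f="star (star r s)"])
  fix zs assume zs: "over_R zs"
  show "star (star r s) (word zs) = star r (star s (word zs))"
  proof (rule T_agree2[OF module_T _ _ _ r s])
    show "bilinear_map K T T T (\<lambda>r s. star (star r s) (word zs))"
      by (rule linear_bilinear_comp[OF star_bilinear star_left]) (use zs in auto)
    show "bilinear_map K T T T (\<lambda>r s. star r (star s (word zs)))"
      by (rule bilinear_map_comp[OF star_bilinear linear_map_ident star_left]) (use zs in auto)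
  qed (rule star_assoc_words[OF proj_eq _ _ zs])
qed (use r s in \<open>auto intro: star_right linear_map_comp[OF star_right star_right]\<close>)

end

lemma (in abelian_group) add_left_imp_eq:
  assumes "x \<oplus> y = x \<oplus> z" "x \<in> carrier G" "y \<in> carrier G" "z \<in> carrier G"
  shows "y = z"
  using assms by (simp add: a_comm[of x])

locale star_monoid = star_bialgebra K R star for K :: "'k ring" and R :: "('k, 'v) module" and star +
  assumes assoc: "\<And>r s t. r \<in> carrier T \<Longrightarrow> s \<in> carrier T \<Longrightarrow> t \<in> carrier T \<Longrightarrow>
    star (star r s) t = star r (star s t)"
begin

subsection \<open>The antipode\<close>

text \<open>Convolution of endomorphisms of \<open>T\<close>, kept at the level of functions on
  words, where it is a finite sum over cuts.\<close>

definition conv :: "('v list \<Rightarrow> ('k, 'v) tc) \<Rightarrow> ('v list \<Rightarrow> ('k, 'v) tc) \<Rightarrow> 'v list \<Rightarrow> ('k, 'v) tc" where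
  "conv f g xs = (\<Oplus>\<^bsub>T\<^esub>i\<in>{..length xs}. star (f (take i xs)) (g (drop i xs)))"

text \<open>The unit of convolution: the counit followed by the unit of the algebra, evaluated on
  words.\<close>

definition conv_unit :: "'v list \<Rightarrow> ('k, 'v) tc" where
  "conv_unit xs = (if xs = [] then word [] else \<zero>\<^bsub>T\<^esub>)"

text \<open>This is \<open>conv_unit\<close> minus the identity. As it vanishes at the empty word,
  its \<open>n\<close>-th convolution power vanishes on words shorter than \<open>n\<close>, so the
  geometric series that inverts the identity is finite on each word.\<close>

definition neg_word :: "'v list \<Rightarrow> ('k, 'v) tc" where
  "neg_word xs = (if xs = [] then \<zero>\<^bsub>T\<^esub> else \<ominus>\<^bsub>T\<^esub> word xs)"

lemma conv_unit_closed [simp, intro]: "conv_unit xs \<in> carrier T"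
  by (simp add: conv_unit_def)

lemma neg_word_closed [simp, intro]: "over_R xs \<Longrightarrow> neg_word xs \<in> carrier T"
  by (simp add: neg_word_def)

abbreviation "closed f \<equiv> \<forall>xs. over_R xs \<longrightarrow> f xs \<in> carrier T"

lemma conv_closed [simp, intro]: "closed f \<Longrightarrow> closed g \<Longrightarrow> over_R xs \<Longrightarrow> conv f g xs \<in> carrier T"
  unfolding conv_def by auto

lemma star_zero [simp]:
  "t \<in> carrier T \<Longrightarrow> star \<zero>\<^bsub>T\<^esub> t = \<zero>\<^bsub>T\<^esub>" "t \<in> carrier T \<Longrightarrow> star t \<zero>\<^bsub>T\<^esub> = \<zero>\<^bsub>T\<^esub>"
  using linear_map_zero[OF module_T module_T star_left] linear_map_zero[OF module_T module_T star_right] by auto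

lemma conv_unit_left: "closed f \<Longrightarrow> over_R xs \<Longrightarrow> conv conv_unit f xs = f xs"
  unfolding conv_def
  by (subst T.M.finsum_delta[where a=0]) (auto simp: conv_unit_def star_one_left)

lemma conv_unit_right: "closed f \<Longrightarrow> over_R xs \<Longrightarrow> conv f conv_unit xs = f xs"
  unfolding conv_def
  by (subst T.M.finsum_delta[where a="length xs"]) (auto simp: conv_unit_def star_one_right)

lemma conv_plus_left:
  assumes "closed f" "closed g" "closed k" "over_R xs"
  shows "conv (\<lambda>xs. f xs \<oplus>\<^bsub>T\<^esub> g xs) k xs = conv f k xs \<oplus>\<^bsub>T\<^esub> conv g k xs"
proof -
  have "conv (\<lambda>xs. f xs \<oplus>\<^bsub>T\<^esub> g xs) k xs
      = (\<Oplus>\<^bsub>T\<^esub>i\<in>{..length xs}. star (f (take i xs)) (k (drop i xs)) \<oplus>\<^bsub>T\<^esub> star (g (take i xs)) (k (drop i xs)))"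
    unfolding conv_def by (rule finsum_cong_on) (use assms in \<open>simp add: linear_map_add[OF star_left]\<close>)
  also have "\<dots> = conv f k xs \<oplus>\<^bsub>T\<^esub> conv g k xs"
    unfolding conv_def by (rule T.M.finsum_add) (use assms in auto)
  finally show ?thesis .
qed

lemma conv_plus_right:
  assumes "closed f" "closed g" "closed k" "over_R xs"
  shows "conv k (\<lambda>xs. f xs \<oplus>\<^bsub>T\<^esub> g xs) xs = conv k f xs \<oplus>\<^bsub>T\<^esub> conv k g xs"
proof -
  have "conv k (\<lambda>xs. f xs \<oplus>\<^bsub>T\<^esub> g xs) xs
      = (\<Oplus>\<^bsub>T\<^esub>i\<in>{..length xs}. star (k (take i xs)) (f (drop i xs)) \<oplus>\<^bsub>T\<^esub> star (k (take i xs)) (g (drop i xs)))"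
    unfolding conv_def by (rule finsum_cong_on) (use assms in \<open>simp add: linear_map_add[OF star_right]\<close>)
  also have "\<dots> = conv k f xs \<oplus>\<^bsub>T\<^esub> conv k g xs"
    unfolding conv_def by (rule T.M.finsum_add) (use assms in auto)
  finally show ?thesis .
qed

lemma conv_cong:
  "(\<And>i. i \<le> length xs \<Longrightarrow> f (take i xs) = f' (take i xs)) \<Longrightarrow>
   (\<And>i. i \<le> length xs \<Longrightarrow> g (drop i xs) = g' (drop i xs)) \<Longrightarrow> conv f g xs = conv f' g' xs"
  unfolding conv_def by (intro finsum_cong_on) auto

text \<open>Associativity of the product combined with coassociativity, the latter in the form of
  \<open>finsum_triangle\<close>.\<close>

lemma conv_assoc:
  assumes f: "closed f" and g: "closed g" and k: "closed k" and xs: "over_R xs"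
  shows "conv (conv f g) k xs = conv f (conv g k) xs"
proof -
  let ?n = "length xs"
  have "conv (conv f g) k xs = (\<Oplus>\<^bsub>T\<^esub>a\<in>{..?n}. \<Oplus>\<^bsub>T\<^esub>i\<in>{..a}.
      star (f (take i xs)) (star (g (drop i (take a xs))) (k (drop a xs))))"
    unfolding conv_def[of "conv f g"]
  proof (rule finsum_cong_on)
    fix a assume a: "a \<in> {..?n}"
    have "star (conv f g (take a xs)) (k (drop a xs))
        = (\<Oplus>\<^bsub>T\<^esub>i\<in>{..length (take a xs)}. star (star (f (take i (take a xs))) (g (drop i (take a xs)))) (k (drop a xs)))"
      unfolding conv_def
      by (rule linear_map_finsum[OF module_T module_T star_left]) (use f g k xs in auto)
    also have "\<dots> = (\<Oplus>\<^bsub>T\<^esub>i\<in>{..a}. star (f (take i xs)) (star (g (drop i (take a xs))) (k (drop a xs))))"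
      by (rule finsum_cong_on') (use a f g k xs in \<open>auto simp: assoc min_def\<close>)
    finally show "star (conv f g (take a xs)) (k (drop a xs)) = \<dots>" .
  qed
  also have "\<dots> = (\<Oplus>\<^bsub>T\<^esub>i\<in>{..?n}. \<Oplus>\<^bsub>T\<^esub>j\<in>{..?n - i}.
      star (f (take i xs)) (star (g (drop i (take (i + j) xs))) (k (drop (i + j) xs))))"
    by (rule T.M.finsum_triangle) (use f g k xs in auto)
  also have "\<dots> = conv f (conv g k) xs"
    unfolding conv_def[of f "conv g k"]
  proof (rule finsum_cong_on)
    fix i assume i: "i \<in> {..?n}"
    have "star (f (take i xs)) (conv g k (drop i xs)) = (\<Oplus>\<^bsub>T\<^esub>j\<in>{..length (drop i xs)}.
        star (f (take i xs)) (star (g (take j (drop i xs))) (k (drop j (drop i xs)))))"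
      unfolding conv_def
      by (rule linear_map_finsum[OF module_T module_T star_right]) (use f g k xs in auto)
    then show "(\<Oplus>\<^bsub>T\<^esub>j\<in>{..?n - i}. star (f (take i xs)) (star (g (drop i (take (i + j) xs))) (k (drop (i + j) xs))))
        = star (f (take i xs)) (conv g k (drop i xs))"
      by (simp add: drop_take add.commute)
  qed
  finally show ?thesis .
qed

lemma neg_word_multilinear: "multilinear_map K R T neg_word"
  unfolding neg_word_def
  by (intro multilinear_map_if_Nil multilinear_map_comp[OF word_multilinear]
      linear_map_uminus[OF module_T linear_map_ident]) simp

text \<open>The recursion over pairs is reused for single words: the second word stays empty, and
  the coefficient is zero whenever it is not.\<close>

sublocale anti: word_recursion K R T star "\<lambda>xs ys. if ys = [] then neg_word xs else \<zero>\<^bsub>T\<^esub>"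
proof
  show "multilinear_map K R T (\<lambda>xs. if ys = [] then neg_word xs else \<zero>\<^bsub>T\<^esub>)" for ys
    by (cases "ys = []") (simp_all add: neg_word_multilinear multilinear_map_const_zero module_T)
qed (auto intro!: star_bilinear module_T multilinear_map_if_Nil multilinear_map_const_zero simp: neg_word_def[of "[]"])

definition antipode_word :: "'v list \<Rightarrow> ('k, 'v) tc" where
  "antipode_word xs = anti.solution xs []"

lemma antipode_word_multilinear: "multilinear_map K R T antipode_word"
  unfolding antipode_word_def by (rule anti.solution_left) simp

lemma antipode_word_closed [simp, intro]: "over_R xs \<Longrightarrow> antipode_word xs \<in> carrier T"
  using antipode_word_multilinear by (rule multilinear_map_closed)

text \<open>The fixed-point equation S = e + d S of the geometric series with ratio d =
  \<open>neg_word\<close>, for convolution.\<close>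

lemma antipode_word_rec:
  assumes xs: "over_R xs"
  shows "antipode_word xs = conv_unit xs \<oplus>\<^bsub>T\<^esub> conv neg_word antipode_word xs"
proof -
  have "antipode_word xs = anti.step anti.solution xs []"
    unfolding antipode_word_def using xs by (rule anti.solution_step) simp
  also have "\<dots> = conv_unit xs \<oplus>\<^bsub>T\<^esub> conv neg_word antipode_word xs"
    using xs by (simp add: anti.step_def anti.unit_at_def conv_unit_def conv_def antipode_word_def T.M.dsum_zero_right)
  finally show ?thesis .
qed

text \<open>The recursion is one-sided, whereas an antipode has to be a two-sided inverse. Writing S
  = e + d S, the claim S d = d S reduces to d (S d) = d (d S). The left factor d vanishes at the
  empty word, so there the claim is used on shorter words only.\<close>

lemma antipode_word_commute:
  "over_R xs \<Longrightarrow> conv antipode_word neg_word xs = conv neg_word antipode_word xs"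
proof (induction "length xs" arbitrary: xs rule: less_induct)
  case less
  let ?S = antipode_word and ?d = neg_word
  note xs = less.prems
  have rec: "?S (take i xs) = conv_unit (take i xs) \<oplus>\<^bsub>T\<^esub> conv ?d ?S (take i xs)"
    "?S (drop i xs) = conv_unit (drop i xs) \<oplus>\<^bsub>T\<^esub> conv ?d ?S (drop i xs)" for i
    using xs by (simp_all flip: antipode_word_rec)
  have "conv ?S ?d xs = conv (\<lambda>xs. conv_unit xs \<oplus>\<^bsub>T\<^esub> conv ?d ?S xs) ?d xs"
    by (rule conv_cong) (use rec in auto)
  also have "\<dots> = ?d xs \<oplus>\<^bsub>T\<^esub> conv (conv ?d ?S) ?d xs"
    using xs by (subst conv_plus_left) (auto simp: conv_unit_left)
  also have "conv (conv ?d ?S) ?d xs = conv ?d (conv ?S ?d) xs"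
    using xs by (intro conv_assoc) auto
  also have "\<dots> = conv ?d (conv ?d ?S) xs"
    unfolding conv_def[of ?d "conv _ _"]
  proof (rule finsum_cong_on)
    fix i assume i: "i \<in> {..length xs}"
    show "star (?d (take i xs)) (conv ?S ?d (drop i xs)) = star (?d (take i xs)) (conv ?d ?S (drop i xs))"
    proof (cases "i = 0 \<or> xs = []")
      case True
      then have "?d (take i xs) = \<zero>\<^bsub>T\<^esub>" by (auto simp: neg_word_def)
      then show ?thesis using xs by simp
    next
      case False
      then show ?thesis using less.hyps[of "drop i xs"] i xs by auto
    qed
  qed
  also have "?d xs \<oplus>\<^bsub>T\<^esub> conv ?d (conv ?d ?S) xs = conv ?d (\<lambda>xs. conv_unit xs \<oplus>\<^bsub>T\<^esub> conv ?d ?S xs) xs"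
    using xs by (subst conv_plus_right) (auto simp: conv_unit_right)
  also have "\<dots> = conv ?d ?S xs"
    by (rule conv_cong) (use rec in auto)
  finally show ?case .
qed

text \<open>With d + id = e one gets S d + S id = S, and S = e + S d by the recursion and
  commutation; cancelling S d leaves S id = e. The other side cancels d S in the same way.\<close>

lemma antipode_word_inverse:
  assumes xs: "over_R xs"
  shows "conv antipode_word word xs = conv_unit xs" "conv word antipode_word xs = conv_unit xs"
proof -
  let ?S = antipode_word and ?d = neg_word
  have dw: "?d ys \<oplus>\<^bsub>T\<^esub> word ys = conv_unit ys" if "over_R ys" for ys
    using that by (auto simp: neg_word_def conv_unit_def T.M.l_neg)
  have "conv ?S ?d xs \<oplus>\<^bsub>T\<^esub> conv ?S word xs = conv ?S (\<lambda>ys. ?d ys \<oplus>\<^bsub>T\<^esub> word ys) xs"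
    using xs by (subst conv_plus_right) auto
  also have "\<dots> = conv ?S conv_unit xs"
    by (rule conv_cong) (use xs dw in auto)
  also have "\<dots> = conv ?S ?d xs \<oplus>\<^bsub>T\<^esub> conv_unit xs"
    using xs antipode_word_rec[OF xs] by (simp add: conv_unit_right antipode_word_commute T.M.a_comm)
  finally show "conv ?S word xs = conv_unit xs"
    by (rule T.M.add_left_imp_eq) (use xs in auto)
  have "conv ?d ?S xs \<oplus>\<^bsub>T\<^esub> conv word ?S xs = conv (\<lambda>ys. ?d ys \<oplus>\<^bsub>T\<^esub> word ys) ?S xs"
    using xs by (subst conv_plus_left) auto
  also have "\<dots> = conv conv_unit ?S xs"
    by (rule conv_cong) (use xs dw in auto)
  also have "\<dots> = conv ?d ?S xs \<oplus>\<^bsub>T\<^esub> conv_unit xs"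
    using xs antipode_word_rec[OF xs] by (simp add: conv_unit_left T.M.a_comm)
  finally show "conv word ?S xs = conv_unit xs"
    by (rule T.M.add_left_imp_eq) (use xs in auto)
qed

definition antipode :: "('k, 'v) tc \<Rightarrow> ('k, 'v) tc" where
  "antipode = tc_ext K R T antipode_word"

lemma antipode_linear: "linear_map K T T antipode"
  unfolding antipode_def by (rule ext_linear[OF module_T antipode_word_multilinear])

lemma antipode_on_word: "over_R xs \<Longrightarrow> antipode (word xs) = antipode_word xs"
  unfolding antipode_def by (rule ext_word[OF module_T antipode_word_multilinear])

lemma antipode_inverse:
  assumes t: "t \<in> carrier T"
  shows "linear_ext K T (\<lambda>(y, z). star (antipode y) z) (\<Delta> t) = \<epsilon> t \<odot>\<^bsub>T\<^esub> word []"
    and "linear_ext K T (\<lambda>(y, z). star y (antipode z)) (\<Delta> t) = \<epsilon> t \<odot>\<^bsub>T\<^esub> word []"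
proof -
  note e = linear_map_self_scale[OF module_T \<epsilon>_linear word_closed[of "[]"], simplified]
  have e_word: "\<epsilon> (word xs) \<odot>\<^bsub>T\<^esub> word [] = conv_unit xs" if "over_R xs" for xs
    using that by (simp add: \<epsilon>_word conv_unit_def)
  have b1: "bilinear_map K T T T (\<lambda>y z. case (y, z) of (y, z) \<Rightarrow> star (antipode y) z)"
    unfolding prod.case by (rule bilinear_map_comp[OF star_bilinear antipode_linear linear_map_ident])
  have b2: "bilinear_map K T T T (\<lambda>y z. case (y, z) of (y, z) \<Rightarrow> star y (antipode z))"
    unfolding prod.case by (rule bilinear_map_comp[OF star_bilinear linear_map_ident antipode_linear])
  note l1 = TT_ext_linear[OF module_T b1] and l2 = TT_ext_linear[OF module_T b2]
  show "linear_ext K T (\<lambda>(y, z). star (antipode y) z) (\<Delta> t) = \<epsilon> t \<odot>\<^bsub>T\<^esub> word []"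
  proof (rule T_agree[OF module_T linear_map_comp[OF \<Delta>_linear l1] e _ t])
    fix xs assume xs: "over_R xs"
    show "linear_ext K T (\<lambda>(y, z). star (antipode y) z) (\<Delta> (word xs)) = \<epsilon> (word xs) \<odot>\<^bsub>T\<^esub> word []"
      unfolding linear_\<Delta>_word[OF module_T l1 xs] e_word[OF xs] antipode_word_inverse(1)[OF xs, symmetric] conv_def
      by (rule finsum_cong_on) (use xs in \<open>simp add: TT_ext_pure[OF module_T b1] antipode_on_word\<close>)
  qed
  show "linear_ext K T (\<lambda>(y, z). star y (antipode z)) (\<Delta> t) = \<epsilon> t \<odot>\<^bsub>T\<^esub> word []"
  proof (rule T_agree[OF module_T linear_map_comp[OF \<Delta>_linear l2] e _ t])
    fix xs assume xs: "over_R xs"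
    show "linear_ext K T (\<lambda>(y, z). star y (antipode z)) (\<Delta> (word xs)) = \<epsilon> (word xs) \<odot>\<^bsub>T\<^esub> word []"
      unfolding linear_\<Delta>_word[OF module_T l2 xs] e_word[OF xs] antipode_word_inverse(2)[OF xs, symmetric] conv_def
      by (rule finsum_cong_on) (use xs in \<open>simp add: TT_ext_pure[OF module_T b2] antipode_on_word\<close>)
  qed
qed

lemma unital_algebra: "unital_algebra K (tc_algebra K R star)"
  unfolding unital_algebra_def
proof (intro conjI ballI)
  show "ring (tc_algebra K R star)"
    by (rule ringI)
      (auto intro!: monoidI simp: T.M.abelian_group_axioms star_one_left star_one_right assoc
        linear_map_add[OF star_left] linear_map_add[OF star_right])
qed (auto simp: module_T linear_map_smult[OF star_left] linear_map_smult[OF star_right])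

lemma hopf_algebra: "hopf_algebra K (tc_algebra K R star) \<Delta> \<epsilon>"
  unfolding hopf_algebra_def bialgebra_def
  using unital_algebra coalgebra_T antipode_linear antipode_inverse
  by (auto simp: \<Delta>_one \<epsilon>_word \<Delta>_star \<epsilon>_star)

end

lemma (in tensor_space) star_monoid_if_hopf_algebra:
  assumes "hopf_algebra K (tc_algebra K R star) \<Delta> \<epsilon>"
  shows "star_monoid K R star"
proof -
  have bi: "bialgebra K (tc_algebra K R star) \<Delta> \<epsilon>"
    using assms by (simp add: hopf_algebra_def)
  then have "unital_algebra K (tc_algebra K R star)" by (simp add: bialgebra_def)
  then have A: "ring (tc_algebra K R star)"
    and sm: "\<And>a x y. a \<in> carrier K \<Longrightarrow> x \<in> carrier T \<Longrightarrow> y \<in> carrier T \<Longrightarrow>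
        star (a \<odot>\<^bsub>T\<^esub> x) y = a \<odot>\<^bsub>T\<^esub> star x y \<and> star x (a \<odot>\<^bsub>T\<^esub> y) = a \<odot>\<^bsub>T\<^esub> star x y"
    by (auto simp: unital_algebra_def)
  interpret A: ring "tc_algebra K R star" by (rule A)
  have "bilinear_map K T T T star"
    using A.m_closed A.l_distr A.r_distr sm by (intro bilinear_mapI linear_mapI) auto
  then show ?thesis
    using bi A.m_assoc A.l_one A.r_one module_R
    by unfold_locales (auto simp: bialgebra_def)
qed

section \<open>Multibrace algebras\<close>

lemma weak_compositions_0: "weak_compositions n 0 = (if n = 0 then {[]} else {})"
  by (auto simp: weak_compositions_def)

lemma weak_compositions_Suc:
  "weak_compositions n (Suc l) = (\<Union>i\<in>{..n}. (#) i ` weak_compositions (n - i) l)"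
proof (intro equalityI subsetI)
  fix ks assume "ks \<in> weak_compositions n (Suc l)"
  then show "ks \<in> (\<Union>i\<in>{..n}. (#) i ` weak_compositions (n - i) l)"
    by (cases ks) (auto simp: weak_compositions_def intro!: bexI[of _ "hd ks"])
qed (auto simp: weak_compositions_def)

lemma finite_weak_compositions [simp]: "finite (weak_compositions n l)"
  by (induction l arbitrary: n) (auto simp: weak_compositions_0 weak_compositions_Suc)

text \<open>The first part is split off; compositions with different first parts are distinct, so
  the union is disjoint.\<close>

lemma (in abelian_monoid) finsum_weak_compositions_Suc:
  assumes "\<And>ks. ks \<in> weak_compositions n (Suc l) \<Longrightarrow> f ks \<in> carrier G"
  shows "finsum G f (weak_compositions n (Suc l)) = (\<Oplus>i\<in>{..n}. \<Oplus>ks\<in>weak_compositions (n - i) l. f (i # ks))"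
proof -
  have cl: "f (i # ks) \<in> carrier G" if "i \<le> n" "ks \<in> weak_compositions (n - i) l" for i ks
    using assms that by (auto simp: weak_compositions_Suc)
  have "finsum G f (weak_compositions n (Suc l))
      = (\<Oplus>i\<in>{..n}. finsum G f ((#) i ` weak_compositions (n - i) l))"
    unfolding weak_compositions_Suc
    by (rule add.finprod_UN_disjoint) (auto simp: pairwise_def disjnt_def intro: cl)
  also have "\<dots> = (\<Oplus>i\<in>{..n}. \<Oplus>ks\<in>weak_compositions (n - i) l. f (i # ks))"
    by (intro finsum_cong_on finsum_reindex) (auto intro: cl)
  finally show ?thesis .
qed

text \<open>The link between the recursion and the explicit sums of the multibrace relations, which
  are phrased through \<open>mb_concat\<close> for a pair \<open>A\<close>. The coefficient function
  \<open>h\<close> and \<open>A\<close> are tied together on words over \<open>R\<close>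
  only.\<close>

locale brace_recursion = word_recursion K R R "tensor_space.prep K R" h
  for K :: "'k ring" and R :: "('k, 'v) module" and h +
  fixes A :: "('k, 'v) mb"
  assumes A: "\<And>xs ys. over_R xs \<Longrightarrow> over_R ys \<Longrightarrow> mb_apply K A xs ys = h xs ys"
begin

lemma mb_concat_closed: "over_R xs \<Longrightarrow> over_R ys \<Longrightarrow> over_R (mb_concat K A ks ls xs ys)"
proof (induction ks arbitrary: ls xs ys)
  case (Cons k ks)
  note IH = Cons.IH and prems = Cons.prems
  show ?case
  proof (cases ls)
    case (Cons l ls')
    have "over_R (mb_concat K A ks ls' (drop k xs) (drop l ys))"
      by (rule IH) (use prems in auto)
    moreover have "mb_apply K A (take k xs) (take l ys) \<in> carrier R"
      using prems by (subst A) auto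
    ultimately show ?thesis unfolding Cons by simp
  qed simp
qed simp

text \<open>The concatenations of exactly \<open>l\<close> operations, that is, the part of the
  product in tensor degree \<open>l\<close>.\<close>

definition layer :: "nat \<Rightarrow> 'v list \<Rightarrow> 'v list \<Rightarrow> ('k, 'v) tc" where
  "layer l xs ys = (\<Oplus>\<^bsub>T\<^esub>ks\<in>weak_compositions (length xs) l. \<Oplus>\<^bsub>T\<^esub>ls\<in>weak_compositions (length ys) l.
     word (mb_concat K A ks ls xs ys))"

lemma layer_closed [simp, intro]: "over_R xs \<Longrightarrow> over_R ys \<Longrightarrow> layer l xs ys \<in> carrier T"
  unfolding layer_def by (intro T.M.finsum_in word_closed mb_concat_closed)

lemma layer_0: "layer 0 xs ys = unit_at xs ys"
  by (auto simp: layer_def weak_compositions_0 unit_at_def T.M.finsum_one)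

text \<open>Splitting off the first operation of a concatenation means splitting off the first parts
  of both compositions.\<close>

lemma layer_Suc:
  assumes xs: "over_R xs" and ys: "over_R ys"
  shows "layer (Suc l) xs ys = dsum T (length xs) (length ys)
     (\<lambda>i j. prep (h (take i xs) (take j ys)) (layer l (drop i xs) (drop j ys)))"
proof -
  let ?p = "length xs" and ?q = "length ys"
  let ?w = "\<lambda>i j ks ls. word (h (take i xs) (take j ys) # mb_concat K A ks ls (drop i xs) (drop j ys))"
  have cl: "?w i j ks ls \<in> carrier T" for i j ks ls
    using xs ys mb_concat_closed[of "drop i xs" "drop j ys" ks ls] by (intro word_closed) auto
  have cl': "word (mb_concat K A ks ls xs ys) \<in> carrier T" for ks ls
    using xs ys by (intro word_closed mb_concat_closed)
  have "layer (Suc l) xs ys = (\<Oplus>\<^bsub>T\<^esub>i\<in>{..?p}. \<Oplus>\<^bsub>T\<^esub>ks\<in>weak_compositions (?p - i) l.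
      \<Oplus>\<^bsub>T\<^esub>j\<in>{..?q}. \<Oplus>\<^bsub>T\<^esub>ls\<in>weak_compositions (?q - j) l. ?w i j ks ls)"
    unfolding layer_def using xs ys
    by (simp add: T.M.finsum_weak_compositions_Suc cl' A cong: finsum_cong_on)
  \<comment> \<open>The two first parts are moved outside the sums over the remaining parts.\<close>
  also have "\<dots> = (\<Oplus>\<^bsub>T\<^esub>i\<in>{..?p}. \<Oplus>\<^bsub>T\<^esub>j\<in>{..?q}. \<Oplus>\<^bsub>T\<^esub>ks\<in>weak_compositions (?p - i) l.
      \<Oplus>\<^bsub>T\<^esub>ls\<in>weak_compositions (?q - j) l. ?w i j ks ls)"
    by (intro finsum_cong_on T.M.finsum_swap) (use cl in auto)
  also have "\<dots> = dsum T ?p ?q (\<lambda>i j. prep (h (take i xs) (take j ys)) (layer l (drop i xs) (drop j ys)))"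
    unfolding dsum_def
  proof (intro finsum_cong_on)
    fix i j
    have lin: "linear_map K T T (prep (h (take i xs) (take j ys)))"
      using xs ys by (intro act_right) auto
    have c: "over_R (mb_concat K A ks ls (drop i xs) (drop j ys))" for ks ls
      using xs ys by (intro mb_concat_closed) auto
    show "(\<Oplus>\<^bsub>T\<^esub>ks\<in>weak_compositions (?p - i) l. \<Oplus>\<^bsub>T\<^esub>ls\<in>weak_compositions (?q - j) l. ?w i j ks ls)
        = prep (h (take i xs) (take j ys)) (layer l (drop i xs) (drop j ys))"
      unfolding layer_def using xs ys c
      by (simp add: linear_map_finsum[OF module_T module_T lin] prep_word)
  qed
  finally show ?thesis .
qed

text \<open>Each iteration of \<open>step\<close> puts one more operation in front of a
  concatenation, while \<open>unit_at\<close> contributes the empty concatenation.\<close>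

lemma approx_layers:
  "over_R xs \<Longrightarrow> over_R ys \<Longrightarrow> approx n xs ys = (\<Oplus>\<^bsub>T\<^esub>l\<in>{..n}. layer l xs ys)"
proof (induction n arbitrary: xs ys)
  case 0
  then show ?case by (simp add: layer_0 T.M.finsum_one)
next
  case (Suc n)
  have "(\<Oplus>\<^bsub>T\<^esub>l\<in>{..Suc n}. layer l xs ys) = unit_at xs ys \<oplus>\<^bsub>T\<^esub> (\<Oplus>\<^bsub>T\<^esub>l\<in>{..n}. layer (Suc l) xs ys)"
    using Suc.prems by (subst T.M.finsum_atMost_Suc_shift) (auto simp: layer_0)
  also have "(\<Oplus>\<^bsub>T\<^esub>l\<in>{..n}. layer (Suc l) xs ys) = (\<Oplus>\<^bsub>T\<^esub>l\<in>{..n}. dsum T (length xs) (length ys)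
     (\<lambda>i j. prep (h (take i xs) (take j ys)) (layer l (drop i xs) (drop j ys))))"
    using Suc.prems by (simp add: layer_Suc)
  also have "\<dots> = dsum T (length xs) (length ys)
     (\<lambda>i j. \<Oplus>\<^bsub>T\<^esub>l\<in>{..n}. prep (h (take i xs) (take j ys)) (layer l (drop i xs) (drop j ys)))"
    using Suc.prems by (intro T.M.finsum_dsum_swap) auto
  also have "\<dots> = dsum T (length xs) (length ys)
     (\<lambda>i j. prep (h (take i xs) (take j ys)) (approx n (drop i xs) (drop j ys)))"
  proof (rule dsum_cong)
    fix i j
    have lin: "linear_map K T T (prep (h (take i xs) (take j ys)))"
      using Suc.prems by (intro act_right) auto
    show "(\<Oplus>\<^bsub>T\<^esub>l\<in>{..n}. prep (h (take i xs) (take j ys)) (layer l (drop i xs) (drop j ys)))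
        = prep (h (take i xs) (take j ys)) (approx n (drop i xs) (drop j ys))"
      using Suc.prems by (simp add: Suc.IH linear_map_finsum[OF module_T module_T lin])
  qed
  finally show ?case by (simp add: step_def)
qed

text \<open>A concatenation of more operations than there are letters contains M_00 and vanishes,
  which explains the upper bound. The linear map \<open>f\<close> is part of the statement so that
  one lemma serves multiplication by a third word on either side, followed by \<open>proj\<close>,
  as well as \<open>tc_map\<close>.\<close>

lemma linear_map_solution:
  assumes W: "module K W" and f: "linear_map K T W f" and xs: "over_R xs" and ys: "over_R ys"
  shows "f (solution xs ys) = (\<Oplus>\<^bsub>W\<^esub>l\<in>{..length xs + length ys}.
     \<Oplus>\<^bsub>W\<^esub>ks\<in>weak_compositions (length xs) l. \<Oplus>\<^bsub>W\<^esub>ls\<in>weak_compositions (length ys) l.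
       f (word (mb_concat K A ks ls xs ys)))"
proof -
  note lf = linear_map_finsum[OF module_T W f]
  have "over_R (mb_concat K A ks ls xs ys)" for ks ls
    using xs ys by (rule mb_concat_closed)
  then show ?thesis
    unfolding solution_def approx_layers[OF xs ys] using xs ys
    by (subst lf) (simp_all add: layer_def lf)
qed

end

text \<open>The inner product is unrolled into words, and the outer one becomes a brace under
  \<open>proj\<close>. The term \<open>l = 0\<close> exists only if both inner words are empty; one
  nonempty word removes it and lets the sum start at 1, as in the multibrace relations.\<close>

lemma (in star_bialgebra) proj_star_star:
  assumes A: "\<And>xs ys. over_R xs \<Longrightarrow> over_R ys \<Longrightarrow> mb_apply K A xs ys = brace xs ys"
    and xs: "over_R xs" and ys: "over_R ys" and zs: "over_R zs"
  shows "xs \<noteq> [] \<Longrightarrow> proj (star (star (word xs) (word ys)) (word zs)) =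
      (\<Oplus>\<^bsub>R\<^esub>l\<in>{1..length xs + length ys}. \<Oplus>\<^bsub>R\<^esub>is\<in>weak_compositions (length xs) l.
        \<Oplus>\<^bsub>R\<^esub>js\<in>weak_compositions (length ys) l. mb_apply K A (mb_concat K A is js xs ys) zs)"
    and "ys \<noteq> [] \<Longrightarrow> proj (star (word xs) (star (word ys) (word zs))) =
      (\<Oplus>\<^bsub>R\<^esub>l\<in>{1..length ys + length zs}. \<Oplus>\<^bsub>R\<^esub>is\<in>weak_compositions (length ys) l.
        \<Oplus>\<^bsub>R\<^esub>js\<in>weak_compositions (length zs) l. mb_apply K A xs (mb_concat K A is js ys zs))"
proof -
  interpret B: brace_recursion K R brace A
    by unfold_locales (rule A)
  have skip: "finsum R f {..n} = finsum R f {1..n}"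
    if "f 0 = \<zero>\<^bsub>R\<^esub>" "\<And>l. f l \<in> carrier R" for f and n :: nat
    by (rule R.M.finsum_mono_neutral[symmetric]) (use that in \<open>auto simp: Suc_le_eq\<close>)
  have c: "over_R (mb_concat K A is js xs ys)" "over_R (mb_concat K A is js ys zs)" for "is" js
    using xs ys zs by (simp_all add: B.mb_concat_closed)
  show "proj (star (star (word xs) (word ys)) (word zs)) =
      (\<Oplus>\<^bsub>R\<^esub>l\<in>{1..length xs + length ys}. \<Oplus>\<^bsub>R\<^esub>is\<in>weak_compositions (length xs) l.
        \<Oplus>\<^bsub>R\<^esub>js\<in>weak_compositions (length ys) l. mb_apply K A (mb_concat K A is js xs ys) zs)"
    if "xs \<noteq> []"
  proof -
    have lin: "linear_map K T R (\<lambda>t. proj (star t (word zs)))"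
      using zs by (intro linear_map_comp[OF star_left proj_linear]) auto
    show ?thesis
      unfolding star_words[OF xs ys] B.linear_map_solution[OF module_R lin xs ys]
      using that c zs by (subst skip) (auto simp: weak_compositions_0 A brace_def R.M.finsum_empty)
  qed
  show "proj (star (word xs) (star (word ys) (word zs))) =
      (\<Oplus>\<^bsub>R\<^esub>l\<in>{1..length ys + length zs}. \<Oplus>\<^bsub>R\<^esub>is\<in>weak_compositions (length ys) l.
        \<Oplus>\<^bsub>R\<^esub>js\<in>weak_compositions (length zs) l. mb_apply K A xs (mb_concat K A is js ys zs))"
    if "ys \<noteq> []"
  proof -
    have lin: "linear_map K T R (\<lambda>t. proj (star (word xs) t))"
      using xs by (intro linear_map_comp[OF star_right proj_linear]) auto
    show ?thesis
      unfolding star_words[OF ys zs] B.linear_map_solution[OF module_R lin ys zs]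
      using that c xs by (subst skip) (auto simp: weak_compositions_0 A brace_def R.M.finsum_empty)
  qed
qed

text \<open>The coalgebra half of the correspondence: a family of braces that is unital, but not
  necessarily associative, already integrates to a unital bialgebra product.\<close>

locale unital_braces = word_recursion K R R "tensor_space.prep K R" h
  for K :: "'k ring" and R :: "('k, 'v) module" and h +
  assumes h_Nil_left: "\<And>ys. over_R ys \<Longrightarrow> h [] ys = (if length ys = 1 then hd ys else \<zero>\<^bsub>R\<^esub>)"
    and h_Nil_right: "\<And>xs. over_R xs \<Longrightarrow> h xs [] = (if length xs = 1 then hd xs else \<zero>\<^bsub>R\<^esub>)"
begin

text \<open>Restricted to the carriers because an object of \<open>CHA\<close> carries an
  extensional product.\<close>

definition star :: "('k, 'v) tc \<Rightarrow> ('k, 'v) tc \<Rightarrow> ('k, 'v) tc" where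
  "star = (\<lambda>s\<in>carrier T. \<lambda>t\<in>carrier T. ext2 solution s t)"

lemma star_extensional: "star \<in> carrier T \<rightarrow>\<^sub>E carrier T \<rightarrow>\<^sub>E carrier T"
  unfolding star_def using bilinear_map_closed[OF bilinear_ext2[OF solution_right solution_left]] by auto

sublocale tensor_product K R star
proof
  have b: "bilinear_map K T T T (ext2 solution)"
    by (rule bilinear_ext2[OF solution_right solution_left])
  show "bilinear_map K T T T star"
  proof (rule bilinear_mapI)
    fix s assume s: "s \<in> carrier T"
    show "linear_map K T T (star s)" "linear_map K T T (\<lambda>t. star t s)"
      using bilinear_map_right[OF b s] bilinear_map_left[OF b s] s
      by (simp_all add: star_def cong: linear_map_cong[OF module_T])
  qed
qed

lemma star_solution: "over_R xs \<Longrightarrow> over_R ys \<Longrightarrow> star (word xs) (word ys) = solution xs ys"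
  unfolding star_def by (simp add: ext2_word[OF solution_right solution_left])

text \<open>Against an empty word \<open>h\<close> vanishes except on single letters, so only the
  cut after the first letter of \<open>ys\<close> contributes and the word is rebuilt letter by
  letter.\<close>

lemma solution_Nil_left: "over_R ys \<Longrightarrow> solution [] ys = word ys"
proof (induction ys)
  case Nil
  then show ?case by (subst solution_step) (simp_all add: step_def T.M.dsum_eq_zero h_Nil unit_at_def)
next
  case (Cons y ys)
  have "dsum T 0 (length (y # ys)) (\<lambda>i j. prep (h (take i []) (take j (y # ys))) (solution (drop i []) (drop j (y # ys))))
     = prep (h (take 0 []) (take 1 (y # ys))) (solution (drop 0 []) (drop 1 (y # ys)))"
  proof (rule T.M.dsum_delta)
    fix i j :: nat assume ij: "i \<le> 0" "j \<le> length (y # ys)" "(i, j) \<noteq> (0, 1)"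
    have "over_R (take j (y # ys))" "over_R (drop j (y # ys))" using Cons.prems over_R_take over_R_drop by blast+
    then show "prep (h (take i []) (take j (y # ys))) (solution (drop i []) (drop j (y # ys))) = \<zero>\<^bsub>T\<^esub>"
      using ij by (simp add: h_Nil_left)
  qed (use Cons.prems in auto)
  then show ?case
    using Cons by (subst solution_step) (simp_all add: step_def unit_at_def h_Nil_left prep_word)
qed

lemma solution_Nil_right: "over_R xs \<Longrightarrow> solution xs [] = word xs"
proof (induction xs)
  case Nil
  then show ?case by (rule solution_Nil_left)
next
  case (Cons x xs)
  have "dsum T (length (x # xs)) 0 (\<lambda>i j. prep (h (take i (x # xs)) (take j [])) (solution (drop i (x # xs)) (drop j [])))
     = prep (h (take 1 (x # xs)) (take 0 [])) (solution (drop 1 (x # xs)) (drop 0 []))"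
  proof (rule T.M.dsum_delta)
    fix i j :: nat assume ij: "i \<le> length (x # xs)" "j \<le> 0" "(i, j) \<noteq> (1, 0)"
    have "over_R (take i (x # xs))" "over_R (drop i (x # xs))" using Cons.prems over_R_take over_R_drop by blast+
    then show "prep (h (take i (x # xs)) (take j [])) (solution (drop i (x # xs)) (drop j [])) = \<zero>\<^bsub>T\<^esub>"
      using ij by (simp add: h_Nil_right)
  qed (use Cons.prems in auto)
  then show ?case
    using Cons by (subst solution_step) (simp_all add: step_def unit_at_def h_Nil_right prep_word)
qed

text \<open>Every term of the recursion other than \<open>unit_at\<close> lies in the image of
  \<open>prep\<close>, where the counit vanishes.\<close>

lemma \<epsilon>_solution:
  assumes "over_R xs" "over_R ys"
  shows "\<epsilon> (solution xs ys) = (if xs = [] \<and> ys = [] then \<one>\<^bsub>K\<^esub> else \<zero>\<^bsub>K\<^esub>)"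
proof -
  have "\<epsilon> (dsum T (length xs) (length ys) (\<lambda>i j. prep (h (take i xs) (take j ys)) (solution (drop i xs) (drop j ys)))) = \<zero>\<^bsub>K\<^esub>"
    using assms
    by (subst linear_map_dsum[OF module_T module_self \<epsilon>_linear]) (auto simp: \<epsilon>_prep abelian_monoid.dsum_eq_zero[OF module_abelian_monoid[OF module_self], simplified])
  moreover have "\<epsilon> \<zero>\<^bsub>T\<^esub> = \<zero>\<^bsub>K\<^esub>"
    using linear_map_zero[OF module_T module_self \<epsilon>_linear] by simp
  ultimately show ?thesis
    unfolding solution_step[OF assms] step_def using assms
    by (subst linear_map_add[OF \<epsilon>_linear]) (auto simp: unit_at_def \<epsilon>_word)
qed

text \<open>By \<open>proj_prep\<close> a cut contributes through the counit of what it leaves over,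
  so only the cut taking both words whole survives: the product returns the operations from which it
  was built.\<close>

lemma proj_solution:
  assumes "over_R xs" "over_R ys"
  shows "proj (solution xs ys) = h xs ys"
proof -
  have "proj (dsum T (length xs) (length ys) (\<lambda>i j. prep (h (take i xs) (take j ys)) (solution (drop i xs) (drop j ys))))
      = dsum R (length xs) (length ys) (\<lambda>i j. \<epsilon> (solution (drop i xs) (drop j ys)) \<odot>\<^bsub>R\<^esub> h (take i xs) (take j ys))"
    using assms by (subst linear_map_dsum[OF module_T module_R proj_linear]) (auto simp: proj_prep)
  also have "\<dots> = h xs ys"
    using assms by (subst R.M.dsum_delta[where a="length xs" and b="length ys"]) (auto simp: \<epsilon>_solution)
  finally show ?thesis
    unfolding solution_step[OF assms] step_def using assms
    by (subst linear_map_add[OF proj_linear])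
      (auto simp: unit_at_def proj_word linear_map_zero[OF module_T module_R proj_linear])
qed

text \<open>By \<open>\<Delta>_prep\<close> and induction the left side becomes
  \<open>word [] \<boxtimes> solution xs ys\<close> plus a sum over two successive pairs of cuts. On
  the right side the left factors are unrolled by the recursion, which gives the same sum in the
  order exchanged by \<open>dsum_triangle\<close>.\<close>

lemma \<Delta>_solution:
  "over_R xs \<Longrightarrow> over_R ys \<Longrightarrow> \<Delta> (solution xs ys) = dsum TT (length xs) (length ys)
    (\<lambda>a b. solution (take a xs) (take b ys) \<boxtimes> solution (drop a xs) (drop b ys))"
proof (induction "length xs + length ys" arbitrary: xs ys rule: less_induct)
  case less
  note xs = less.prems(1) and ys = less.prems(2)
  let ?p = "length xs" and ?q = "length ys"
  define E where "E xs ys = dsum TT (length xs) (length ys)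
    (\<lambda>a b. solution (take a xs) (take b ys) \<boxtimes> solution (drop a xs) (drop b ys))" for xs ys
  let ?m = "\<lambda>i j. h (take i xs) (take j ys)" and ?s = "\<lambda>i j. solution (drop i xs) (drop j ys)"
  let ?one = "pt (word [])"
  have m: "?m i j \<in> carrier R" and s: "?s i j \<in> carrier T" and S: "solution xs ys \<in> carrier T" for i j
    using xs ys by auto
  have E_cl: "E us vs \<in> carrier TT" if "over_R us" "over_R vs" for us vs
    using that unfolding E_def by auto
  have one: "linear_map K T TT ?one" by (rule bilinear_map_right[OF pt_bilinear]) simp
  have pz: "prep2 \<zero>\<^bsub>R\<^esub> X = \<zero>\<^bsub>TT\<^esub>" if "X \<in> carrier TT" for X
    by (rule TT_agree[OF module_TT prep2_linear linear_map_const_zero[OF module_TT] _ that])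
      (auto simp: prep2_pt linear_map_zero[OF module_T module_TT bilinear_map_left[OF pt_bilinear]])
  have IH: "prep2 (?m i j) (\<Delta> (?s i j)) = prep2 (?m i j) (E (drop i xs) (drop j ys))" if "i \<le> ?p" "j \<le> ?q" for i j
  proof (cases "i = 0 \<and> j = 0")
    case True
    then show ?thesis using xs ys E_cl[of xs ys] by (simp add: h_Nil pz)
  next
    case False
    then show ?thesis
      using less.hyps[of "drop i xs" "drop j ys"] xs ys that by (auto simp: E_def)
  qed
  \<comment> \<open>This form lets the unit term be absorbed into
    \<open>word [] \<boxtimes> solution xs ys\<close>.\<close>
  have unit: "\<Delta> (unit_at us vs) = word [] \<boxtimes> unit_at us vs" for us vs
    by (auto simp: unit_at_def \<Delta>_one linear_map_zero[OF module_T module_TT \<Delta>_linear] linear_map_zero[OF module_T module_TT one])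
  have "\<Delta> (solution xs ys) = \<Delta> (unit_at xs ys) \<oplus>\<^bsub>TT\<^esub> \<Delta> (dsum T ?p ?q (\<lambda>i j. prep (?m i j) (?s i j)))"
    unfolding solution_step[OF xs ys] step_def
    by (rule linear_map_add[OF \<Delta>_linear]) (use m s in auto)
  also have "\<Delta> (dsum T ?p ?q (\<lambda>i j. prep (?m i j) (?s i j)))
      = dsum TT ?p ?q (\<lambda>i j. word [] \<boxtimes> prep (?m i j) (?s i j) \<oplus>\<^bsub>TT\<^esub> prep2 (?m i j) (\<Delta> (?s i j)))"
    using m s by (subst linear_map_dsum[OF module_T module_TT \<Delta>_linear]) (auto simp: \<Delta>_prep)
  also have "\<dots> = dsum TT ?p ?q (\<lambda>i j. word [] \<boxtimes> prep (?m i j) (?s i j) \<oplus>\<^bsub>TT\<^esub> prep2 (?m i j) (E (drop i xs) (drop j ys)))"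
    by (rule dsum_cong) (simp add: IH)
  also have "\<dots> = dsum TT ?p ?q (\<lambda>i j. word [] \<boxtimes> prep (?m i j) (?s i j))
      \<oplus>\<^bsub>TT\<^esub> dsum TT ?p ?q (\<lambda>i j. prep2 (?m i j) (E (drop i xs) (drop j ys)))"
    by (rule TT.M.dsum_add) (use m s xs ys E_cl in \<open>auto intro!: linear_map_closed[OF prep2_linear]\<close>)
  also have "dsum TT ?p ?q (\<lambda>i j. word [] \<boxtimes> prep (?m i j) (?s i j)) = word [] \<boxtimes> dsum T ?p ?q (\<lambda>i j. prep (?m i j) (?s i j))"
    by (rule linear_map_dsum[OF module_T module_TT one, symmetric]) (use m s in auto)
  also have "\<Delta> (unit_at xs ys) \<oplus>\<^bsub>TT\<^esub> (word [] \<boxtimes> dsum T ?p ?q (\<lambda>i j. prep (?m i j) (?s i j))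
        \<oplus>\<^bsub>TT\<^esub> dsum TT ?p ?q (\<lambda>i j. prep2 (?m i j) (E (drop i xs) (drop j ys))))
      = (\<Delta> (unit_at xs ys) \<oplus>\<^bsub>TT\<^esub> word [] \<boxtimes> dsum T ?p ?q (\<lambda>i j. prep (?m i j) (?s i j)))
        \<oplus>\<^bsub>TT\<^esub> dsum TT ?p ?q (\<lambda>i j. prep2 (?m i j) (E (drop i xs) (drop j ys)))"
    by (rule TT.M.a_assoc[symmetric])
      (use m s xs ys E_cl in \<open>auto intro!: linear_map_closed[OF prep2_linear] TT.M.dsum_closed pt_closed T.M.dsum_closed\<close>)
  also have "\<Delta> (unit_at xs ys) \<oplus>\<^bsub>TT\<^esub> word [] \<boxtimes> dsum T ?p ?q (\<lambda>i j. prep (?m i j) (?s i j)) = word [] \<boxtimes> solution xs ys"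
    unfolding unit solution_step[OF xs ys] step_def
    by (rule linear_map_add[OF one, symmetric]) (use m s in auto)
  finally have L: "\<Delta> (solution xs ys) = word [] \<boxtimes> solution xs ys
      \<oplus>\<^bsub>TT\<^esub> dsum TT ?p ?q (\<lambda>i j. prep2 (?m i j) (E (drop i xs) (drop j ys)))" .

  \<comment> \<open>The first operation takes the letters up to \<open>(i, j)\<close>; the left
    tensor factor as a whole takes those up to \<open>(a, b)\<close>.\<close>
  let ?g = "\<lambda>i j a b. prep (?m i j) (solution (drop i (take a xs)) (drop j (take b ys))) \<boxtimes> ?s a b"
  have g: "?g i j a b \<in> carrier TT" for i j a b
    using xs ys m s by auto
  have "solution (take a xs) (take b ys) \<boxtimes> ?s a b
      = unit_at (take a xs) (take b ys) \<boxtimes> ?s a b \<oplus>\<^bsub>TT\<^esub> dsum TT a b (\<lambda>i j. ?g i j a b)"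
    if ab: "a \<le> ?p" "b \<le> ?q" for a b
  proof -
    have tk: "over_R (take a xs)" "over_R (take b ys)" using xs ys by auto
    note l = bilinear_map_left[OF pt_bilinear s[of a b]]
    have min: "min ?p a = a" "min ?q b = b" using ab by auto
    let ?d = "dsum T a b (\<lambda>i j. prep (h (take i (take a xs)) (take j (take b ys)))
      (solution (drop i (take a xs)) (drop j (take b ys))))"
    have d: "?d = dsum T a b (\<lambda>i j. prep (?m i j) (solution (drop i (take a xs)) (drop j (take b ys))))"
      by (rule dsum_cong) (simp add: min_def)
    have "solution (take a xs) (take b ys) = unit_at (take a xs) (take b ys) \<oplus>\<^bsub>T\<^esub> ?d"
      unfolding solution_step[OF tk] step_def by (simp only: length_take min)
    then show ?thesis
      unfolding d using linear_map_add[OF l] linear_map_dsum[OF module_T module_TT l] m xs ys by simp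
  qed
  then have "E xs ys = dsum TT ?p ?q (\<lambda>a b. unit_at (take a xs) (take b ys) \<boxtimes> ?s a b \<oplus>\<^bsub>TT\<^esub> dsum TT a b (\<lambda>i j. ?g i j a b))"
    unfolding E_def by (intro dsum_cong)
  also have "\<dots> = dsum TT ?p ?q (\<lambda>a b. unit_at (take a xs) (take b ys) \<boxtimes> ?s a b)
      \<oplus>\<^bsub>TT\<^esub> dsum TT ?p ?q (\<lambda>a b. dsum TT a b (\<lambda>i j. ?g i j a b))"
    by (rule TT.M.dsum_add) (use g s in auto)
  \<comment> \<open>Prefixes of both words are empty only at the cut 0, 0.\<close>
  also have "dsum TT ?p ?q (\<lambda>a b. unit_at (take a xs) (take b ys) \<boxtimes> ?s a b) = unit_at (take 0 xs) (take 0 ys) \<boxtimes> ?s 0 0"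
    by (rule TT.M.dsum_delta)
      (use s xs ys linear_map_zero[OF module_T module_TT bilinear_map_left[OF pt_bilinear]] in \<open>auto simp: unit_at_def\<close>)
  also have "\<dots> = word [] \<boxtimes> solution xs ys" by (simp add: unit_at_def)
  also have "dsum TT ?p ?q (\<lambda>a b. dsum TT a b (\<lambda>i j. ?g i j a b))
      = dsum TT ?p ?q (\<lambda>i j. dsum TT (?p - i) (?q - j) (\<lambda>k l. ?g i j (i + k) (j + l)))"
    by (rule TT.M.dsum_triangle) (use g in auto)
  also have "\<dots> = dsum TT ?p ?q (\<lambda>i j. prep2 (?m i j) (E (drop i xs) (drop j ys)))"
  proof (rule dsum_cong)
    fix i j
    show "dsum TT (?p - i) (?q - j) (\<lambda>k l. ?g i j (i + k) (j + l)) = prep2 (?m i j) (E (drop i xs) (drop j ys))"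
      unfolding E_def using xs ys m s
      by (subst linear_map_dsum[OF module_TT module_TT prep2_linear]) (auto simp: prep2_pt drop_take add.commute)
  qed
  finally show ?case using L by (simp add: E_def)
qed

sublocale star_bialgebra K R star
proof
  fix s t assume st: "s \<in> carrier T" "t \<in> carrier T"
  show "\<Delta> (star s t) = tsm (\<Delta> s) (\<Delta> t)"
    by (rule T_agree2[OF module_TT linear_bilinear_comp[OF star_bilinear \<Delta>_linear]
          bilinear_map_comp[OF tsm_bilinear \<Delta>_linear \<Delta>_linear] _ st])
      (simp add: star_solution \<Delta>_solution tsm_\<Delta>_word)
  have "bilinear_map K T T (self_module K) (\<lambda>s t. \<epsilon> s \<otimes>\<^bsub>K\<^esub> \<epsilon> t)"
    by (intro bilinear_mapI linear_mapI)
      (auto simp: linear_map_add[OF \<epsilon>_linear] linear_map_smult[OF \<epsilon>_linear] R.R.l_distr R.R.r_distr R.R.m_ac)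
  from T_agree2[OF module_self linear_bilinear_comp[OF star_bilinear \<epsilon>_linear] this _ st]
  show "\<epsilon> (star s t) = \<epsilon> s \<otimes>\<^bsub>K\<^esub> \<epsilon> t"
    by (simp add: star_solution \<epsilon>_solution \<epsilon>_word)
next
  fix t assume t: "t \<in> carrier T"
  show "star (word []) t = t"
    by (rule T_agree[OF module_T star_right linear_map_ident _ t]) (simp_all add: star_solution solution_Nil_left)
  show "star t (word []) = t"
    by (rule T_agree[OF module_T star_left linear_map_ident _ t]) (simp_all add: star_solution solution_Nil_right)
qed

lemma brace_eq: "over_R xs \<Longrightarrow> over_R ys \<Longrightarrow> brace xs ys = h xs ys"
  by (simp add: brace_def star_solution proj_solution)

end

section \<open>Passing between products and multibraces\<close>

text \<open>The restriction to the carrier matches the extensionality demanded of the operations of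
  an \<open>MB\<close> object; it is what turns the round trip into an equality of
  functions.\<close>

definition braces_of :: "'k ring \<Rightarrow> ('k, 'v) module \<Rightarrow> (('k, 'v) tc \<Rightarrow> ('k, 'v) tc \<Rightarrow> ('k, 'v) tc) \<Rightarrow>
    nat \<Rightarrow> nat \<Rightarrow> (('v list \<Rightarrow> 'k) set \<times> ('v list \<Rightarrow> 'k) set \<Rightarrow> 'k) set \<Rightarrow> 'v" where
  "braces_of K R star p q = (\<lambda>t\<in>carrier (mb_domain K R p q).
     linear_ext K R (\<lambda>(s, t). tensor_space.proj K R (star (tc_inj K R p s) (tc_inj K R q t))) t)"

lemma mb_apply_eq: "mb_apply K (R, M) xs ys = M (length xs) (length ys)
   (pure_tensor K (tensor_power K R (length xs)) (tensor_power K R (length ys)) (pure_word K R xs) (pure_word K R ys))"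
  by (simp add: mb_apply_def)

section \<open>From multibrace structures to unital braces\<close>

context tensor_space
begin

abbreviation "P \<equiv> tensor_power K R"

lemmas module_P = module_tensor_power[OF module_R]

lemma pure_word_in: "over_R xs \<Longrightarrow> pure_word K R xs \<in> carrier (P (length xs))"
  by (rule pure_word_closed[OF module_R]) (simp add: words_def)

text \<open>Comparison on pairs of words, by peeling off the tensor product and each tensor power in
  turn, with the other factor held fixed.\<close>

lemma mb_domain_agree:
  assumes f: "linear_map K (mb_domain K R p q) R f" and g: "linear_map K (mb_domain K R p q) R g"
    and eq: "\<And>xs ys. xs \<in> words R p \<Longrightarrow> ys \<in> words R q \<Longrightarrow>
      f (pure_tensor K (P p) (P q) (pure_word K R xs) (pure_word K R ys)) =
      g (pure_tensor K (P p) (P q) (pure_word K R xs) (pure_word K R ys))"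
    and t: "t \<in> carrier (mb_domain K R p q)"
  shows "f t = g t"
proof -
  note b = bilinear_pure_tensor[OF module_P module_P, of p q]
  note f' = linear_bilinear_comp[OF b f[unfolded mb_domain_def]] and g' = linear_bilinear_comp[OF b g[unfolded mb_domain_def]]
  show ?thesis
  proof (rule tensor_agree[OF module_P module_P module_R f[unfolded mb_domain_def] g[unfolded mb_domain_def] _ t[unfolded mb_domain_def]])
    fix v w assume v: "v \<in> carrier (P p)" and w: "w \<in> carrier (P q)"
    show "f (pure_tensor K (P p) (P q) v w) = g (pure_tensor K (P p) (P q) v w)"
    proof (rule tensor_power_agree[OF module_R module_R bilinear_map_left[OF f' w] bilinear_map_left[OF g' w] _ v])
      fix xs assume xs: "xs \<in> words R p"
      note x = pure_word_closed[OF module_R xs]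
      show "f (pure_tensor K (P p) (P q) (pure_word K R xs) w) = g (pure_tensor K (P p) (P q) (pure_word K R xs) w)"
        by (rule tensor_power_agree[OF module_R module_R bilinear_map_right[OF f' x] bilinear_map_right[OF g' x] _ w])
          (rule eq[OF xs])
    qed
  qed
qed

lemma mb_domain_zero:
  assumes "linear_map K (mb_domain K R p q) R (M p q)"
    and "\<And>xs ys. over_R xs \<Longrightarrow> over_R ys \<Longrightarrow> length xs = p \<Longrightarrow> length ys = q \<Longrightarrow> mb_apply K (R, M) xs ys = \<zero>\<^bsub>R\<^esub>"
    and "t \<in> carrier (mb_domain K R p q)"
  shows "M p q t = \<zero>\<^bsub>R\<^esub>"
  by (rule mb_domain_agree[OF assms(1) linear_map_const_zero[OF module_R] _ assms(3)])
    (use assms(2) in \<open>auto simp: words_def mb_apply_eq\<close>)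

lemma unital_braces_mb:
  assumes mb: "is_mb K (R, M)"
  shows "unital_braces K R (mb_apply K (R, M))"
proof -
  have lin: "linear_map K (mb_domain K R p q) R (M p q)" for p q
    using mb by (simp add: is_mb_def)
  have bil: "bilinear_map K (P p) (P q) R (\<lambda>s t. M p q (pure_tensor K (P p) (P q) s t))" for p q
    by (rule linear_bilinear_comp[OF bilinear_pure_tensor[OF module_P module_P] lin[unfolded mb_domain_def]])
  have pt: "pure_tensor K (P (length xs)) (P (length ys)) (pure_word K R xs) (pure_word K R ys)
      \<in> carrier (mb_domain K R (length xs) (length ys))" if "over_R xs" "over_R ys" for xs ys
    unfolding mb_domain_def by (intro pure_tensor_closed[OF module_P module_P] pure_word_in that)
  have cl: "mb_apply K (R, M) xs ys \<in> carrier R" if "over_R xs" "over_R ys" for xs ys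
    unfolding mb_apply_eq using linear_map_closed[OF lin pt] that by blast
  \<comment> \<open>The conditions on M_00, on M_10 and M_01, and on M_p0 and M_0q for larger
    indices combine into one formula, according to whether the nontrivial word has length 0, 1 or
    more.\<close>
  have Nil: "mb_apply K (R, M) [] ys = (if length ys = 1 then hd ys else \<zero>\<^bsub>R\<^esub>)"
    "mb_apply K (R, M) ys [] = (if length ys = 1 then hd ys else \<zero>\<^bsub>R\<^esub>)" if ys: "over_R ys" for ys
  proof -
    consider "ys = []" | y where "ys = [y]" | "length ys > 1"
      by (metis One_nat_def length_0_conv length_Suc_conv linorder_neqE_nat less_one)
    then have "mb_apply K (R, M) [] ys = (if length ys = 1 then hd ys else \<zero>\<^bsub>R\<^esub>) \<and>
      mb_apply K (R, M) ys [] = (if length ys = 1 then hd ys else \<zero>\<^bsub>R\<^esub>)"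
      using mb ys pt[of "[]" ys] pt[of ys "[]"] by cases (simp_all add: is_mb_def mb_apply_eq)
    then show "mb_apply K (R, M) [] ys = (if length ys = 1 then hd ys else \<zero>\<^bsub>R\<^esub>)"
      "mb_apply K (R, M) ys [] = (if length ys = 1 then hd ys else \<zero>\<^bsub>R\<^esub>)" by auto
  qed
  show ?thesis
  proof
    show "multilinear_map K R R (mb_apply K (R, M) xs)" if xs: "over_R xs" for xs
    proof (rule multilinear_mapI[OF cl[OF xs]])
      fix us ws assume s: "over_R us" "over_R ws"
      show "linear_map K R R (\<lambda>x. mb_apply K (R, M) xs (us @ [x] @ ws))"
        using linear_map_comp[OF linear_map_pure_word[OF module_R s refl] bilinear_map_right[OF bil pure_word_in[OF xs]]]
        by (simp add: mb_apply_eq)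
    qed
    show "multilinear_map K R R (\<lambda>xs. mb_apply K (R, M) xs ys)" if ys: "over_R ys" for ys
    proof (rule multilinear_mapI[OF cl[OF _ ys]])
      fix us ws assume s: "over_R us" "over_R ws"
      show "linear_map K R R (\<lambda>x. mb_apply K (R, M) (us @ [x] @ ws) ys)"
        using linear_map_comp[OF linear_map_pure_word[OF module_R s refl] bilinear_map_left[OF bil pure_word_in[OF ys]]]
        by (simp add: mb_apply_eq)
    qed
  qed (auto simp: module_R prep_bilinear Nil)
qed

end

context star_bialgebra
begin

lemma braces_of_bilinear:
  "bilinear_map K (P p) (P q) R (\<lambda>s t. case (s, t) of (s, t) \<Rightarrow> proj (star (tc_inj K R p s) (tc_inj K R q t)))"
  unfolding prod.case
  by (rule linear_bilinear_comp[OF bilinear_map_comp[OF star_bilinear linear_map_tc_inj[OF module_R]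
        linear_map_tc_inj[OF module_R]] proj_linear])

lemma braces_of_linear: "linear_map K (mb_domain K R p q) R (braces_of K R star p q)"
  using linear_map_tensor_ext[OF module_P module_P module_R braces_of_bilinear, of p q]
  unfolding braces_of_def mb_domain_def
  by (subst linear_map_cong[OF module_tensor[OF module_P module_P]]) auto

lemma mb_apply_braces_of:
  assumes "over_R xs" "over_R ys"
  shows "mb_apply K (R, braces_of K R star) xs ys = brace xs ys"
  using assms pure_tensor_closed[OF module_P module_P pure_word_in[OF assms(1)] pure_word_in[OF assms(2)]]
    tensor_ext_pure[OF module_P module_P module_R braces_of_bilinear pure_word_in[OF assms(1)] pure_word_in[OF assms(2)]]
  by (simp add: mb_apply_eq braces_of_def mb_domain_def brace_def tc_inj_pure_word)

end

lemma (in star_monoid) is_mb_braces_of: "is_mb K (R, braces_of K R star)"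
  unfolding is_mb_def prod.case
proof (intro conjI allI ballI impI)
  let ?A = "(R, braces_of K R star)"
  note zero = mb_domain_zero[where M="braces_of K R star", OF braces_of_linear]
  show "braces_of K R star p q \<in> extensional (carrier (mb_domain K R p q))" for p q
    by (simp add: braces_of_def)
  show "braces_of K R star 0 0 t = \<zero>\<^bsub>R\<^esub>" if "t \<in> carrier (mb_domain K R 0 0)" for t
    by (rule zero[OF _ that]) (simp add: mb_apply_braces_of brace_Nil_left)
  show "braces_of K R star p 0 t = \<zero>\<^bsub>R\<^esub>" if "p > 1" "t \<in> carrier (mb_domain K R p 0)" for p t
    by (rule zero[OF _ that(2)]) (use that(1) in \<open>simp add: mb_apply_braces_of brace_Nil_right\<close>)
  show "braces_of K R star 0 q t = \<zero>\<^bsub>R\<^esub>" if "q > 1" "t \<in> carrier (mb_domain K R 0 q)" for q t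
    by (rule zero[OF _ that(2)]) (use that(1) in \<open>simp add: mb_apply_braces_of brace_Nil_left\<close>)
  show "mb_apply K ?A [x] [] = x" "mb_apply K ?A [] [x] = x" if "x \<in> carrier R" for x
    using that by (simp_all add: mb_apply_braces_of brace_Nil_left brace_Nil_right)
  fix i j k :: nat and xs ys zs
  assume "i \<ge> 1" "j \<ge> 1" "k \<ge> 1" and w: "xs \<in> words R i" "ys \<in> words R j" "zs \<in> words R k"
  then have ne: "xs \<noteq> []" "ys \<noteq> []" and o: "over_R xs" "over_R ys" "over_R zs"
    and len: "length xs = i" "length ys = j" "length zs = k" by (auto simp: words_def)
  have "proj (star (star (word xs) (word ys)) (word zs)) = proj (star (word xs) (star (word ys) (word zs)))"
    using o by (simp add: assoc)
  then show "(\<Oplus>\<^bsub>R\<^esub>l\<in>{1..i + j}. \<Oplus>\<^bsub>R\<^esub>is\<in>weak_compositions i l. \<Oplus>\<^bsub>R\<^esub>js\<in>weak_compositions j l.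
       mb_apply K ?A (mb_concat K ?A is js xs ys) zs) =
    (\<Oplus>\<^bsub>R\<^esub>m\<in>{1..j + k}. \<Oplus>\<^bsub>R\<^esub>js\<in>weak_compositions j m. \<Oplus>\<^bsub>R\<^esub>ks\<in>weak_compositions k m.
       mb_apply K ?A xs (mb_concat K ?A js ks ys zs))"
    using proj_star_star(1)[OF mb_apply_braces_of o ne(1)] proj_star_star(2)[OF mb_apply_braces_of o ne(2)]
    by (simp only: len)
qed (rule module_R braces_of_linear)+

definition star_of :: "'k ring \<Rightarrow> ('k, 'v) mb \<Rightarrow> ('k, 'v) tc \<Rightarrow> ('k, 'v) tc \<Rightarrow> ('k, 'v) tc" where
  "star_of K A = unital_braces.star K (fst A) (mb_apply K A)"

context tensor_space
begin

lemma star_monoid_star_of: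
  assumes mb: "is_mb K (R, M)"
  shows "star_monoid K R (star_of K (R, M))"
proof -
  interpret U: unital_braces K R "mb_apply K (R, M)" by (rule unital_braces_mb[OF mb])
  have s: "star_of K (R, M) = U.star" by (simp add: star_of_def)
  have brace: "mb_apply K (R, M) xs ys = U.brace xs ys" if "over_R xs" "over_R ys" for xs ys
    using that by (simp add: U.brace_eq)
  show ?thesis unfolding s
  proof (intro star_monoid.intro star_monoid_axioms.intro U.star_assoc)
    show "star_bialgebra K R U.star" ..
    fix xs ys zs assume o: "over_R xs" "over_R ys" "over_R zs"
    show "proj (U.star (U.star (word xs) (word ys)) (word zs)) = proj (U.star (word xs) (U.star (word ys) (word zs)))"
    \<comment> \<open>The multibrace relations speak of nonempty words only; if one of the words is
      empty, the unit laws identify the two bracketings.\<close>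
    proof (cases "xs = [] \<or> ys = [] \<or> zs = []")
      case True
      then show ?thesis using o U.star_closed
        by (auto simp: U.star_one_left U.star_one_right)
    next
      case False
      have "xs \<in> words R (length xs)" "ys \<in> words R (length ys)" "zs \<in> words R (length zs)"
        using o by (auto simp: words_def)
      moreover have "length xs \<ge> 1" "length ys \<ge> 1" "length zs \<ge> 1"
        using False by (auto simp: Suc_le_eq)
      ultimately show ?thesis
        using mb False unfolding is_mb_def prod.case
        by (simp add: U.proj_star_star[OF brace o])
    qed
  qed
qed

lemma star_of_extensional: "is_mb K (R, M) \<Longrightarrow> star_of K (R, M) \<in> carrier T \<rightarrow>\<^sub>E carrier T \<rightarrow>\<^sub>E carrier T"
  unfolding star_of_def fst_conv by (rule unital_braces.star_extensional[OF unital_braces_mb])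

text \<open>Equality as functions: on the domain it is tested on pairs of words, outside it both
  sides are \<open>undefined\<close> by extensionality.\<close>

lemma braces_of_star_of:
  assumes mb: "is_mb K (R, M)"
  shows "braces_of K R (star_of K (R, M)) = M"
proof (intro ext)
  fix p q t
  interpret U: unital_braces K R "mb_apply K (R, M)" by (rule unital_braces_mb[OF mb])
  have s: "star_of K (R, M) = U.star" by (simp add: star_of_def)
  have lin: "linear_map K (mb_domain K R p q) R (M p q)" and ex: "M p q \<in> extensional (carrier (mb_domain K R p q))"
    using mb by (simp_all add: is_mb_def)
  show "braces_of K R (star_of K (R, M)) p q t = M p q t"
  proof (cases "t \<in> carrier (mb_domain K R p q)")
    case True
    show ?thesis unfolding s
    proof (rule mb_domain_agree[OF U.braces_of_linear lin _ True])
      fix xs ys assume "xs \<in> words R p" "ys \<in> words R q"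
      then have o: "over_R xs" "over_R ys" "length xs = p" "length ys = q" by (auto simp: words_def)
      then show "braces_of K R U.star p q (pure_tensor K (P p) (P q) (pure_word K R xs) (pure_word K R ys)) =
        M p q (pure_tensor K (P p) (P q) (pure_word K R xs) (pure_word K R ys))"
        using U.mb_apply_braces_of[OF o(1,2)] U.brace_eq[OF o(1,2)] by (simp add: mb_apply_eq)
    qed
  next
    case False
    then show ?thesis using ex by (simp add: braces_of_def extensional_def)
  qed
qed

end

text \<open>The given product and the rebuilt one have the same braces on words, so both solve the
  same recursion and agree on words, hence on the carrier; outside it extensionality
  decides.\<close>

lemma (in star_monoid) star_of_braces_of:
  assumes ex: "star \<in> carrier T \<rightarrow>\<^sub>E carrier T \<rightarrow>\<^sub>E carrier T"
  shows "star_of K (R, braces_of K R star) = star"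
proof -
  let ?A = "(R, braces_of K R star)"
  note mb = is_mb_braces_of
  interpret U: unital_braces K R "mb_apply K ?A" by (rule unital_braces_mb[OF mb])
  have s: "star_of K ?A = U.star" by (simp add: star_of_def)
  have ex': "star_of K ?A \<in> carrier T \<rightarrow>\<^sub>E carrier T \<rightarrow>\<^sub>E carrier T"
    by (rule star_of_extensional[OF mb])
  have words: "U.star (word xs) (word ys) = star (word xs) (word ys)" if o: "over_R xs" "over_R ys" for xs ys
  proof -
    have cl: "braces.solution xs ys \<in> carrier T" if "over_R xs" "over_R ys" for xs ys
      using that by simp
    have "braces.solution xs ys = U.solution xs ys"
    proof (rule U.solution_unique[OF cl _ o])
      fix xs ys assume o: "over_R xs" "over_R ys"
      show "braces.solution xs ys = U.step braces.solution xs ys"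
        unfolding braces.solution_step[OF o] braces.step_def U.step_def braces.unit_at_def U.unit_at_def
        using o by (intro arg_cong[where f="\<lambda>t. _ \<oplus>\<^bsub>T\<^esub> t"] dsum_cong) (simp add: mb_apply_braces_of flip: braces.solution_step)
    qed
    then show ?thesis using o by (simp add: U.star_solution star_words)
  qed
  show ?thesis
  proof (rule ext, rule ext)
    fix r t
    show "star_of K ?A r t = star r t"
    proof (cases "r \<in> carrier T")
      case r: True
      show ?thesis
      proof (cases "t \<in> carrier T")
        case True
        show ?thesis
          unfolding s by (rule T_agree2[OF module_T U.star_bilinear star_bilinear words r True])
      next
        case False
        show ?thesis
          using PiE_arb[OF PiE_mem[OF ex r] False] PiE_arb[OF PiE_mem[OF ex' r] False] by simp
      qed
    next
      case False
      show ?thesis using PiE_arb[OF ex False] PiE_arb[OF ex' False] by simp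
    qed
  qed
qed

section \<open>Morphisms\<close>

locale tensor_space_map = A: tensor_space K R + B: tensor_space K R'
  for K :: "'k ring" and R :: "('k, 'v) module" and R' :: "('k, 'v) module" +
  fixes \<phi> :: "'v \<Rightarrow> 'v"
  assumes \<phi>: "linear_map K R R' \<phi>"
begin

abbreviation "F \<equiv> tc_map K R R' \<phi>"

lemmas \<phi>_closed [simp] = linear_map_closed[OF \<phi>]

lemma over_image [simp]: "A.over_R xs \<Longrightarrow> \<phi> ` set xs \<subseteq> carrier R'"
  by auto

lemma over_map: "A.over_R xs \<Longrightarrow> B.over_R (map \<phi> xs)"
  by simp

lemma F_multilinear: "multilinear_map K R B.T (\<lambda>xs. B.word (map \<phi> xs))"
proof (rule multilinear_mapI)
  fix us ws assume "A.over_R us" "A.over_R ws"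
  then have "linear_map K R B.T (\<lambda>x. B.word (map \<phi> us @ [\<phi> x] @ map \<phi> ws))"
    by (intro linear_map_comp[OF \<phi> multilinear_map_slot[OF B.word_multilinear]] over_map)
  then show "linear_map K R B.T (\<lambda>x. B.word (map \<phi> (us @ [x] @ ws)))" by simp
qed (intro B.word_closed over_map)

lemma F_linear: "linear_map K A.T B.T F"
  unfolding tc_map_def by (rule A.ext_linear[OF B.module_T F_multilinear])

lemma F_word: "A.over_R xs \<Longrightarrow> F (A.word xs) = B.word (map \<phi> xs)"
  unfolding tc_map_def by (rule A.ext_word[OF B.module_T F_multilinear])

lemma F_proj:
  assumes t: "t \<in> carrier A.T"
  shows "B.proj (F t) = \<phi> (A.proj t)"
  by (rule A.T_agree[OF B.module_R linear_map_comp[OF F_linear B.proj_linear] linear_map_comp[OF A.proj_linear \<phi>] _ t])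
    (auto simp: F_word A.proj_word B.proj_word over_map length_Suc_conv linear_map_zero[OF A.module_R B.module_R \<phi>])

lemma F_counit:
  assumes t: "t \<in> carrier A.T"
  shows "B.\<epsilon> (F t) = A.\<epsilon> t"
  by (rule A.T_agree[OF A.module_self linear_map_comp[OF F_linear B.\<epsilon>_linear] A.\<epsilon>_linear _ t])
    (auto simp: F_word A.\<epsilon>_word B.\<epsilon>_word over_map)

text \<open>Applying \<phi> letterwise commutes with cutting a word.\<close>

lemma F_comult:
  assumes t: "t \<in> carrier A.T"
  shows "B.\<Delta> (F t) = tensor_map K B.T B.T F F (A.\<Delta> t)"
proof -
  note l = linear_tensor_map[OF A.module_T A.module_T B.module_T B.module_T F_linear F_linear]
  note v = tensor_map_pure[OF A.module_T A.module_T B.module_T B.module_T F_linear F_linear]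
  show ?thesis
  proof (rule A.T_agree[OF B.module_TT linear_map_comp[OF F_linear B.\<Delta>_linear] linear_map_comp[OF A.\<Delta>_linear l] _ t])
    fix xs assume xs: "A.over_R xs"
    show "B.\<Delta> (F (A.word xs)) = tensor_map K B.T B.T F F (A.\<Delta> (A.word xs))"
      unfolding A.linear_\<Delta>_word[OF B.module_TT l xs] F_word[OF xs] B.\<Delta>_word[OF over_map[OF xs]]
      by (rule finsum_cong_on') (use xs in \<open>auto simp: v F_word take_map drop_map\<close>)
  qed
qed

end

locale star_monoid_map = tensor_space_map K R R' \<phi> + A: star_monoid K R star + B: star_monoid K R' star'
  for K :: "'k ring" and R :: "('k, 'v) module" and R' :: "('k, 'v) module" and \<phi> star star'
begin

text \<open>For every linear \<phi> the induced map respects coproduct, counit and empty word, so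
  multiplicativity is the only condition that remains.\<close>

lemma hopf_morphism_iff:
  "hopf_morphism K (tc_algebra K R star) A.\<Delta> A.\<epsilon> (tc_algebra K R' star') B.\<Delta> B.\<epsilon> F \<longleftrightarrow>
     (\<forall>s\<in>carrier A.T. \<forall>t\<in>carrier A.T. F (star s t) = star' (F s) (F t))"
  using F_linear F_comult F_counit F_word[of "[]"] by (auto simp: hopf_morphism_def)

lemma braces_if_product:
  assumes F: "\<And>s t. s \<in> carrier A.T \<Longrightarrow> t \<in> carrier A.T \<Longrightarrow> F (star s t) = star' (F s) (F t)"
    and o: "A.over_R xs" "A.over_R ys"
  shows "\<phi> (A.brace xs ys) = B.brace (map \<phi> xs) (map \<phi> ys)"
  using o by (simp add: A.brace_def B.brace_def F F_word flip: F_proj)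

text \<open>Both products of words are sums over the same compositions; as \<phi> commutes with each
  operation, it carries every concatenation, letter by letter, to the corresponding one.\<close>

lemma product_if_braces:
  assumes br: "\<And>xs ys. A.over_R xs \<Longrightarrow> A.over_R ys \<Longrightarrow> \<phi> (A.brace xs ys) = B.brace (map \<phi> xs) (map \<phi> ys)"
    and st: "s \<in> carrier A.T" "t \<in> carrier A.T"
  shows "F (star s t) = star' (F s) (F t)"
proof (rule A.T_agree2[OF B.module_T linear_bilinear_comp[OF A.star_bilinear F_linear]
      bilinear_map_comp[OF B.star_bilinear F_linear F_linear] _ st])
  fix xs ys assume o: "A.over_R xs" "A.over_R ys"
  let ?A = "(R, braces_of K R star)" and ?B = "(R', braces_of K R' star')"
  interpret AA: brace_recursion K R A.brace ?A by unfold_locales (rule A.mb_apply_braces_of)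
  interpret BB: brace_recursion K R' B.brace ?B by unfold_locales (rule B.mb_apply_braces_of)
  have concat: "map \<phi> (mb_concat K ?A ks ls xs ys) = mb_concat K ?B ks ls (map \<phi> xs) (map \<phi> ys)"
    if "A.over_R xs" "A.over_R ys" for ks ls xs ys
    using that
  proof (induction ks arbitrary: ls xs ys)
    case (Cons k ks)
    show ?case
      by (cases ls) (use Cons over_map in \<open>simp_all add: A.mb_apply_braces_of B.mb_apply_braces_of br take_map drop_map\<close>)
  qed simp
  show "F (star (A.word xs) (A.word ys)) = star' (F (A.word xs)) (F (A.word ys))"
    using o AA.linear_map_solution[OF B.module_T F_linear o]
      BB.linear_map_solution[OF B.module_T linear_map_ident over_map[OF o(1)] over_map[OF o(2)]]
    by (simp add: A.star_words B.star_words F_word AA.mb_concat_closed concat over_map)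
qed

end

lemma is_cha_star_monoid: "is_cha K (R, star) \<Longrightarrow> star_monoid K R star"
  by (auto simp: is_cha_def intro!: tensor_space.star_monoid_if_hopf_algebra tensor_space.intro)

text \<open>Both hom sets consist of extensional linear maps from \<open>R\<close> to
  \<open>R'\<close>, so it remains to compare the multiplicativity condition with compatibility with
  the braces.\<close>

lemma cha_hom_eq_mb_hom:
  fixes R R' :: "('k, 'v) module"
  assumes "is_cha K (R, star)" "is_cha K (R', star')"
  shows "cha_hom K (R, star) (R', star') = mb_hom K (R, braces_of K R star) (R', braces_of K R' star')"
proof -
  interpret A: star_monoid K R star by (rule is_cha_star_monoid[OF assms(1)])
  interpret B: star_monoid K R' star' by (rule is_cha_star_monoid[OF assms(2)])
  have "hopf_morphism K (tc_algebra K R star) A.\<Delta> A.\<epsilon> (tc_algebra K R' star') B.\<Delta> B.\<epsilon> (tc_map K R R' \<phi>) \<longleftrightarrow>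
      (\<forall>p q. \<forall>xs\<in>words R p. \<forall>ys\<in>words R q. \<phi> (mb_apply K (R, braces_of K R star) xs ys) =
         mb_apply K (R', braces_of K R' star') (map \<phi> xs) (map \<phi> ys))"
    if \<phi>: "linear_map K R R' \<phi>" for \<phi>
  proof -
    interpret star_monoid_map K R R' \<phi> star star'
      by unfold_locales (rule \<phi>)
    have "(\<forall>s\<in>carrier A.T. \<forall>t\<in>carrier A.T. F (star s t) = star' (F s) (F t)) \<longleftrightarrow>
      (\<forall>xs ys. A.over_R xs \<longrightarrow> A.over_R ys \<longrightarrow> \<phi> (A.brace xs ys) = B.brace (map \<phi> xs) (map \<phi> ys))"
      using braces_if_product product_if_braces by blast
    then show ?thesis
      using over_map unfolding hopf_morphism_iff
      by (auto simp: words_def A.mb_apply_braces_of B.mb_apply_braces_of)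
  qed
  then show ?thesis by (auto simp: cha_hom_def mb_hom_def)
qed

section \<open>The equivalence of categories\<close>

text \<open>The functors act as the identity on morphisms, and identities serve as components of the
  natural isomorphisms. The category laws are transported from \<open>D\<close> to \<open>C\<close>,
  so they have to be checked for multibrace morphisms only and not for Hopf morphisms.\<close>

lemma equivalent_categories_if_isomorphic:
  fixes C :: "('o, 'm) category" and D :: "('p, 'm) category"
  assumes D: "is_category D"
    and Fo: "\<And>A. A \<in> Ob C \<Longrightarrow> Fo A \<in> Ob D" and Go: "\<And>B. B \<in> Ob D \<Longrightarrow> Go B \<in> Ob C"
    and GF: "\<And>A. A \<in> Ob C \<Longrightarrow> Go (Fo A) = A" and FG: "\<And>B. B \<in> Ob D \<Longrightarrow> Fo (Go B) = B"
    and Hom: "\<And>A B. A \<in> Ob C \<Longrightarrow> B \<in> Ob C \<Longrightarrow> Hom C A B = Hom D (Fo A) (Fo B)"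
    and Id: "\<And>A. A \<in> Ob C \<Longrightarrow> Id C A = Id D (Fo A)"
    and Comp: "\<And>A B E. A \<in> Ob C \<Longrightarrow> B \<in> Ob C \<Longrightarrow> E \<in> Ob C \<Longrightarrow> Comp C A B E = Comp D (Fo A) (Fo B) (Fo E)"
  shows "equivalent_categories C D"
proof -
  have C: "is_category C"
    using D unfolding is_category_def by (simp add: Fo Hom Id Comp)
  have iso_Id: "is_iso X A A (Id X A)" if "is_category X" "A \<in> Ob X" for X :: "('x, 'm) category" and A
    using that unfolding is_category_def is_iso_def by blast
  have units: "Comp X A B B (Id X B) f = f" "Comp X A A B f (Id X A) = f"
    if "is_category X" "A \<in> Ob X" "B \<in> Ob X" "f \<in> Hom X A B" for X :: "('x, 'm) category" and A B f
    using that unfolding is_category_def by blast+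
  have HomG: "Hom C (Go A) (Go B) = Hom D A B" if "A \<in> Ob D" "B \<in> Ob D" for A B
    using that by (simp add: Hom Go FG)
  have "is_functor C D Fo (\<lambda>A B f. f)" "is_functor D C Go (\<lambda>A B f. f)"
    by (simp_all add: is_functor_def Fo Go Hom Id Comp FG)
  moreover have "is_nat_iso C C (\<lambda>A. A) (\<lambda>A B f. f) (\<lambda>A. Go (Fo A)) (\<lambda>A B f. f) (Id C)"
    unfolding is_nat_iso_def by (simp add: GF iso_Id[OF C] units[OF C])
  moreover have "is_nat_iso D D (\<lambda>A. Fo (Go A)) (\<lambda>A B f. f) (\<lambda>A. A) (\<lambda>A B f. f) (Id D)"
    unfolding is_nat_iso_def by (simp add: FG iso_Id[OF D] units[OF D])
  ultimately show ?thesis unfolding equivalent_categories_def using C D by blast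
qed

lemma mb_hom_compose:
  assumes A: "is_mb K A" and f: "f \<in> mb_hom K A B" and g: "g \<in> mb_hom K B D"
  shows "compose (carrier (fst A)) g f \<in> mb_hom K A D"
proof -
  obtain R M where RM: "A = (R, M)" by (cases A)
  have "module K R" using A by (simp add: RM is_mb_def)
  then interpret tensor_space K R by (rule tensor_space.intro)
  interpret U: unital_braces K R "mb_apply K (R, M)"
    using A unfolding RM by (rule unital_braces_mb)
  let ?h = "compose (carrier R) g f"
  have f_lin: "linear_map K R (fst B) f" and g_lin: "linear_map K (fst B) (fst D) g"
    using f g by (simp_all add: mb_hom_def RM)
  have "linear_map K R (fst D) ?h"
    using linear_map_comp[OF f_lin g_lin] by (subst linear_map_cong[OF module_R]) (auto simp: compose_eq)
  moreover have "?h (mb_apply K A xs ys) = mb_apply K D (map ?h xs) (map ?h ys)"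
    if w: "xs \<in> words R p" "ys \<in> words R q" for p q xs ys
  proof -
    have o: "over_R xs" "over_R ys" using w by (auto simp: words_def)
    have m: "map ?h xs = map g (map f xs)" "map ?h ys = map g (map f ys)"
      using o by (auto simp: compose_eq)
    have fw: "map f xs \<in> words (fst B) p" "map f ys \<in> words (fst B) q"
      using w linear_map_closed[OF f_lin] by (auto simp: words_def)
    \<comment> \<open>\<open>compose\<close> evaluates to the composite only on the carrier, so
      closure of the operations enters here.\<close>
    have "?h (mb_apply K A xs ys) = g (f (mb_apply K A xs ys))"
      using U.h_closed[OF o] by (simp add: RM compose_eq)
    also have "f (mb_apply K A xs ys) = mb_apply K B (map f xs) (map f ys)"
      using f w unfolding mb_hom_def RM by auto
    also have "g \<dots> = mb_apply K D (map g (map f xs)) (map g (map f ys))"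
      using g fw unfolding mb_hom_def by blast
    finally show ?thesis unfolding m .
  qed
  ultimately show ?thesis by (auto simp: mb_hom_def RM)
qed

lemma mb_hom_ident:
  assumes A: "is_mb K A"
  shows "(\<lambda>x\<in>carrier (fst A). x) \<in> mb_hom K A A"
proof -
  obtain R M where RM: "A = (R, M)" by (cases A)
  have "module K R" using A by (simp add: RM is_mb_def)
  then interpret tensor_space K R by (rule tensor_space.intro)
  interpret U: unital_braces K R "mb_apply K (R, M)"
    using A unfolding RM by (rule unital_braces_mb)
  have "linear_map K R R (\<lambda>x\<in>carrier R. x)"
    using linear_map_ident by (subst linear_map_cong[OF module_R]) auto
  moreover have "map (\<lambda>x\<in>carrier R. x) xs = xs" if "over_R xs" for xs
    using that by (intro map_idI) auto
  ultimately show ?thesis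
    using U.h_closed by (auto simp: mb_hom_def RM words_def)
qed

lemma is_category_MB: "is_category (MB K :: (('k, 'v) mb, 'v \<Rightarrow> 'v) category)"
proof -
  have hom: "f \<in> extensional (carrier (fst A))" "\<And>x. x \<in> carrier (fst A) \<Longrightarrow> f x \<in> carrier (fst B)"
    if "f \<in> mb_hom K A B" for A B :: "('k, 'v) mb" and f
    using that linear_map_closed by (auto simp: mb_hom_def)
  show ?thesis
    unfolding is_category_def MB_def category.simps mem_Collect_eq
  proof (intro conjI ballI)
    fix A B :: "('k, 'v) mb" and f assume f: "f \<in> mb_hom K A B"
    show "compose (carrier (fst A)) f (\<lambda>x\<in>carrier (fst A). x) = f"
      using hom(1)[OF f] by (intro extensionalityI[OF compose_extensional]) (auto simp: compose_eq)
    show "compose (carrier (fst A)) (\<lambda>x\<in>carrier (fst B). x) f = f"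
      using hom[OF f] by (intro extensionalityI[OF compose_extensional]) (auto simp: compose_eq)
    fix D E :: "('k, 'v) mb" and g h assume "g \<in> mb_hom K B D" "h \<in> mb_hom K D E"
    show "compose (carrier (fst A)) h (compose (carrier (fst A)) g f)
        = compose (carrier (fst A)) (compose (carrier (fst B)) h g) f"
      using hom(2)[OF f] by (intro extensionalityI[OF compose_extensional compose_extensional]) (auto simp: compose_eq)
  qed (auto intro: mb_hom_ident mb_hom_compose)
qed

theorem theorem2p6:
  fixes K :: "'k ring"
  assumes "field K"
  shows "equivalent_categories
           (CHA K :: (('k, 'v) cha, 'v \<Rightarrow> 'v) category)
           (MB K :: (('k, 'v) mb, 'v \<Rightarrow> 'v) category)"
proof (rule equivalent_categories_if_isomorphic[OF is_category_MB,
      where Fo="\<lambda>A. (fst A, braces_of K (fst A) (snd A))" and Go="\<lambda>B. (fst B, star_of K B)"])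
  fix A B E :: "('k, 'v) cha"
  assume A: "A \<in> Ob (CHA K)" and B: "B \<in> Ob (CHA K)" and E: "E \<in> Ob (CHA K)"
  have cha: "is_cha K (fst A, snd A)" "is_cha K (fst B, snd B)"
    using A B by (simp_all add: CHA_def)
  show "(fst A, braces_of K (fst A) (snd A)) \<in> Ob (MB K)"
    using star_monoid.is_mb_braces_of[OF is_cha_star_monoid[OF cha(1)]] by (simp add: MB_def)
  show "(fst (fst A, braces_of K (fst A) (snd A)), star_of K (fst A, braces_of K (fst A) (snd A))) = A"
    using star_monoid.star_of_braces_of[OF is_cha_star_monoid[OF cha(1)]] cha(1)
    by (simp add: is_cha_def split_beta)
  show "Hom (CHA K) A B = Hom (MB K) (fst A, braces_of K (fst A) (snd A)) (fst B, braces_of K (fst B) (snd B))"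
    using cha_hom_eq_mb_hom[OF cha] by (simp add: CHA_def MB_def)
next
  fix B :: "('k, 'v) mb" assume "B \<in> Ob (MB K)"
  then obtain R M where RM: "B = (R, M)" and mb: "is_mb K (R, M)" by (cases B) (simp add: MB_def)
  then have "module K R" by (simp add: is_mb_def)
  then interpret tensor_space K R by (rule tensor_space.intro)
  show "(fst B, star_of K B) \<in> Ob (CHA K)"
    using star_monoid.hopf_algebra[OF star_monoid_star_of[OF mb]] star_of_extensional[OF mb] module_R
    by (simp add: CHA_def is_cha_def RM)
  show "(fst (fst B, star_of K B), braces_of K (fst (fst B, star_of K B)) (snd (fst B, star_of K B))) = B"
    by (simp add: RM braces_of_star_of[OF mb])
qed (simp_all add: CHA_def MB_def)

end
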